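(* Let $K$ be a field of characteristic zero and $U$ a finite-dimensional $K$-vector space. Let $\mathcal{H}$ be a hyperplane arrangement in $U^*$ with intersection lattice $L$, and let $V$ be the relation complex of $\mathcal{H}$. Let $P$ be a subspace of $U$ of codimension $k$, $0\le k\le\mathrm{rk}\,L$, in general position with respect to $\mathcal{H}$. Let $\Lambda$ be the intersection lattice of the hyperplane arrangement in $P^*$ given by the hyperplanes $\pi_P(x)\subset P^*$, $x\in L_{k+1}$, where $\pi_P:U^*\to P^*$ is the canonical projection, and let $l:L_{\ge k}\to\Lambda$, $x\mapsto\pi_P(x)$, be the associated truncation map. If $V$ is $L$-contractible, then the minimal $\Lambda$-graded complex $$\mathcal{O}\big(\mathrm{Sym}\,V_k,\ ((\partial V_{l^{-1}(a)})_{\mathrm{Sym}\,V_k})_{a\in\mathbb{A}(\Lambda)}\big)$$ is exact. Here $l^{-1}(a)$ denotes the unique element of $L_{k+1}$ mapped by $l$ to the atom $a$, and $(X)_{\mathrm{Sym}\,V_k}$ denotes the ideal of $\mathrm{Sym}\,V_k$ generated by a subspace $X\subset V_k$.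
   Context: Lattices. The intersection lattice of a hyperplane arrangement is the set of all intersections of its hyperplanes (with the whole space as minimal element $0$), ordered by reverse inclusion; it is a geometric lattice with rank = codimension and atoms the hyperplanes. For a geometric lattice $L$: $L_i$ is the set of elements of rank $i$, $L_{\ge k}$ (for an integer $k$) the set of elements of rank $\ge k$, $\mathbb{A}(L)=L_1$, $y\prec x$ means $x$ covers $y$, $L_{\le x}=\{y\in L:y\le x\}$. General position. With $P^\perp=\ker\pi_P\subset U^*$, the codimension $k$ subspace $P$ is in general position with respect to $\mathcal{H}$ if $x\cap P^\perp=\{0\}$ for all $x\in L_k$, and the subspaces $\pi_P(x)$, $x\in L_{k+1}$ (which are then hyperplanes of $P^*$) are pairwise distinct. In this case $l$ maps $L_{k+1}$ bijectively to $\mathbb{A}(\Lambda)$. Compatible grading (for a geometric lattice $L$ of rank $n$). A compatible $L$-grading on a chain complex of modules $V_{n+1}=0\to V_n\to\dots\xrightarrow{\partial_i}V_{i-1}\to\dots\to V_0$ is given by submodules $V_x\subset V_{\mathrm{rk}(x)}$, $x\in L$, with $V_i=\bigoplus_{\mathrm{rk}(x)=i}V_x$ and $\partial(V_x)\subset\bigoplus_{y\prec x}V_y$ for $x\ne0$. Then $V_{\le x}=\bigoplus_{y\le x}V_y$ is a subcomplex graded by $L_{\le x}$. Exact means $\mathrm{Ker}\,\partial_i=\mathrm{Im}\,\partial_{i+1}$ for all $i\ge1$ (surjectivity of $\partial_1$ is not required). Minimal complex. For a module $U_0$ with submodules $U_a$, $a\in\mathbb{A}(L)$, the minimal complex $\mathcal{O}(U_0,(U_a))$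 is the unique compatibly $L$-graded complex $W$ with $W_0=U_0$; $W_a=U_a$ with $\partial|_{W_a}$ the inclusion $U_a\hookrightarrow U_0$; and for $\mathrm{rk}(x)=i>1$, $W_x=\mathrm{Ker}(\partial_{i-1}|_{\bigoplus_{y\prec x}W_y})$ with $\partial|_{W_x}$ the inclusion. Relation complex. The relation complex of $\mathcal{H}$ is the minimal complex $\mathcal{O}(U,(H^\perp)_{H\in\mathcal{H}})$, $H^\perp\subset U$ being the annihilator of $H$. $L$-contractible. An $L$-homotopy for a compatibly $L$-graded complex $V$ is a sequence of morphisms $d_0:\mathrm{Im}\,\partial_1\to V_1$, $d_i:V_i\to V_{i+1}$ ($1\le i\le n$) with $d_{i-1}\partial_i+\partial_{i+1}d_i=\mathrm{id}_{V_i}$ for $1\le i\le n$ and $d_{\mathrm{rk}(x)}(V_x)\subset\bigoplus_{y\succ x}V_y$ for $x\ne0$. $V$ is $L$-contractible if for each $x\in L$ the $L_{\le x}$-graded complex $V_{\le x}$ admits an $L_{\le x}$-homotopy. *)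

theory Defs
  imports
    "HOL-Algebra.Algebra"
    "HOL-Algebra.Algebraic_Closure_Type"
    "HOL-Library.Poly_Mapping"
    "HOL-Library.Function_Algebras"
begin

section \<open>Ranked posets and graded complexes\<close>

record 'a ranked_poset = "'a gorder" +
  rk :: "'a \<Rightarrow> nat"

definition level :: "('a, 'z) ranked_poset_scheme \<Rightarrow> nat \<Rightarrow> 'a set" where
  "level L i = {x \<in> carrier L. rk L x = i}"

definition covers :: "('a, 'z) gorder_scheme \<Rightarrow> 'a \<Rightarrow> 'a \<Rightarrow> bool" where
  "covers L x y \<longleftrightarrow> x \<in> carrier L \<and> y \<in> carrier L \<and> y \<sqsubset>\<^bsub>L\<^esub> x \<and>
     \<not> (\<exists>z \<in> carrier L. y \<sqsubset>\<^bsub>L\<^esub> z \<and> z \<sqsubset>\<^bsub>L\<^esub> x)"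

definition below :: "('a, 'z) ranked_poset_scheme \<Rightarrow> 'a \<Rightarrow> ('a, 'z) ranked_poset_scheme" where
  "below L x = L\<lparr>carrier := {y \<in> carrier L. y \<sqsubseteq>\<^bsub>L\<^esub> x}\<rparr>"

definition poset_rank :: "('a, 'z) ranked_poset_scheme \<Rightarrow> nat" where
  "poset_rank L = Max (rk L ` carrier L)"

definition sum_submodules :: "('r, 'm, 'z) module_scheme \<Rightarrow> ('i \<Rightarrow> 'm set) \<Rightarrow> 'i set \<Rightarrow> 'm set" where
  "sum_submodules M A I = {finsum M w I | w. w \<in> Pi I A}"

definition linear_maps ::
  "('r, 'y) ring_scheme \<Rightarrow> ('r, 'm, 'z) module_scheme \<Rightarrow> 'm set \<Rightarrow> 'm set \<Rightarrow> ('m \<Rightarrow> 'm) set" where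
  "linear_maps R M A B = {f \<in> A \<rightarrow> B.
     (\<forall>v \<in> A. \<forall>w \<in> A. f (v \<oplus>\<^bsub>M\<^esub> w) = f v \<oplus>\<^bsub>M\<^esub> f w) \<and>
     (\<forall>r \<in> carrier R. \<forall>v \<in> A. f (r \<odot>\<^bsub>M\<^esub> v) = r \<odot>\<^bsub>M\<^esub> f v)}"

text \<open>The modules \<open>V\<^sub>x\<close> (\<open>piece C x\<close>) of an \<open>L\<close>-graded complex all live in one ambient
  module, and \<open>V\<^sub>i\<close> is the (there direct) sum of the \<open>V\<^sub>x\<close> with \<open>rk x = i\<close>. The map
  \<open>diff C i\<close> is the differential from \<open>V\<^sub>i\<close> to \<open>V\<^sub>i\<^sub>-\<^sub>1\<close>. Since \<open>V\<^sub>i\<close> is computed from the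
  grading poset, the subcomplex of the part below \<open>x\<close> is the same record \<open>C\<close>, regarded as
  graded by \<open>below L x\<close>.\<close>

record ('a, 'r, 'm) graded_complex =
  ambient :: "('r, 'm) module"
  piece :: "'a \<Rightarrow> 'm set"
  diff :: "nat \<Rightarrow> 'm \<Rightarrow> 'm"

definition chains ::
  "('a, 'z) ranked_poset_scheme \<Rightarrow> ('a, 'r, 'm) graded_complex \<Rightarrow> nat \<Rightarrow> 'm set" where
  "chains L C i = sum_submodules (ambient C) (piece C) (level L i)"

definition chain_module ::
  "('a, 'z) ranked_poset_scheme \<Rightarrow> ('a, 'r, 'm) graded_complex \<Rightarrow> nat \<Rightarrow> ('r, 'm) module" where
  "chain_module L C i = (ambient C)\<lparr>carrier := chains L C i\<rparr>"

text \<open>Surjectivity of the differential onto \<open>V\<^sub>0\<close> is not required.\<close>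

definition exact_complex ::
  "('a, 'z) ranked_poset_scheme \<Rightarrow> ('a, 'r, 'm) graded_complex \<Rightarrow> bool" where
  "exact_complex L C \<longleftrightarrow>
     (\<forall>i \<ge> 1. {v \<in> chains L C i. diff C i v = \<zero>\<^bsub>ambient C\<^esub>} = diff C (i + 1) ` chains L C (i + 1))"

text \<open>As the rank function is the one of a geometric lattice, \<open>rk L x \<noteq> 0\<close> says \<open>x \<noteq> 0\<close>.\<close>

definition L_homotopy ::
  "('r, 'y) ring_scheme \<Rightarrow> ('a, 'z) ranked_poset_scheme \<Rightarrow> ('a, 'r, 'm) graded_complex \<Rightarrow>
     (nat \<Rightarrow> 'm \<Rightarrow> 'm) \<Rightarrow> bool" where
  "L_homotopy R L C d \<longleftrightarrow>
     d 0 \<in> linear_maps R (ambient C) (diff C 1 ` chains L C 1) (chains L C 1) \<and>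
     (\<forall>i \<in> {1..poset_rank L}.
        d i \<in> linear_maps R (ambient C) (chains L C i) (chains L C (i + 1)) \<and>
        (\<forall>v \<in> chains L C i.
           d (i - 1) (diff C i v) \<oplus>\<^bsub>ambient C\<^esub> diff C (i + 1) (d i v) = v)) \<and>
     (\<forall>x \<in> carrier L. rk L x \<noteq> 0 \<longrightarrow>
        d (rk L x) ` piece C x \<subseteq> sum_submodules (ambient C) (piece C) {y. covers L y x})"

definition L_contractible ::
  "('r, 'y) ring_scheme \<Rightarrow> ('a, 'z) ranked_poset_scheme \<Rightarrow> ('a, 'r, 'm) graded_complex \<Rightarrow> bool" where
  "L_contractible R L C \<longleftrightarrow> (\<forall>x \<in> carrier L. \<exists>d. L_homotopy R (below L x) C d)"


section \<open>Minimal complexes\<close>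

text \<open>For \<open>rk x > 1\<close>, \<open>W\<^sub>x\<close> is a submodule of \<open>W\<^sub>i\<^sub>-\<^sub>1\<close>, but \<open>W\<^sub>i\<close> is the external direct sum of
  these submodules, so copies are needed. They are realised inside the module of all functions
  from lists of poset elements to \<open>U\<^sub>0\<close>: an element \<open>u\<close> of \<open>W\<^sub>0\<close> is the function with
  value \<open>u\<close> at the empty list, and the copy in \<open>W\<^sub>x\<close> of \<open>w\<close> is the function with value \<open>w c\<close>
  at \<open>x # c\<close>, both zero elsewhere. The inclusions \<open>W\<^sub>x \<rightarrow> W\<^sub>i\<^sub>-\<^sub>1\<close> then combine to the map
  \<open>w \<mapsto> (\<lambda>c. \<Sum>x. w (x # c))\<close>.\<close>

text \<open>The fields \<open>mult\<close> and \<open>one\<close> that a module record inherits from the ring record play no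
  role for modules.\<close>

definition list_module :: "('r, 'm, 'z) module_scheme \<Rightarrow> ('r, 'a list \<Rightarrow> 'm) module" where
  "list_module M = \<lparr>carrier = {w. \<forall>c. w c \<in> carrier M}, monoid.mult = undefined, one = undefined,
     ring.zero = (\<lambda>c. \<zero>\<^bsub>M\<^esub>), ring.add = (\<lambda>v w c. v c \<oplus>\<^bsub>M\<^esub> w c), module.smult = (\<lambda>r w c. r \<odot>\<^bsub>M\<^esub> w c)\<rparr>"

definition root_copy :: "('r, 'm, 'z) module_scheme \<Rightarrow> 'm \<Rightarrow> ('a list \<Rightarrow> 'm)" where
  "root_copy M u = (\<lambda>c. if c = [] then u else \<zero>\<^bsub>M\<^esub>)"

definition copy :: "('r, 'm, 'z) module_scheme \<Rightarrow> 'a \<Rightarrow> ('a list \<Rightarrow> 'm) \<Rightarrow> ('a list \<Rightarrow> 'm)" where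
  "copy M x w = (\<lambda>c. case c of [] \<Rightarrow> \<zero>\<^bsub>M\<^esub> | y # c' \<Rightarrow> if y = x then w c' else \<zero>\<^bsub>M\<^esub>)"

definition list_diff ::
  "('a, 'y) ranked_poset_scheme \<Rightarrow> ('r, 'm, 'z) module_scheme \<Rightarrow> nat \<Rightarrow>
     ('a list \<Rightarrow> 'm) \<Rightarrow> ('a list \<Rightarrow> 'm)" where
  "list_diff L M i w = (\<lambda>c. \<Oplus>\<^bsub>M\<^esub> x \<in> level L i. w (x # c))"

primrec minimal_piece ::
  "('a, 'y) ranked_poset_scheme \<Rightarrow> ('r, 'm, 'z) module_scheme \<Rightarrow> ('a \<Rightarrow> 'm set) \<Rightarrow>
     nat \<Rightarrow> 'a \<Rightarrow> ('a list \<Rightarrow> 'm) set" where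
  "minimal_piece L M A 0 x = root_copy M ` carrier M"
| "minimal_piece L M A (Suc i) x = copy M x `
     (if i = 0 then root_copy M ` A x
      else {w \<in> sum_submodules (list_module M) (minimal_piece L M A i) {y. covers L x y}.
              list_diff L M i w = \<zero>\<^bsub>list_module M\<^esub>})"

definition minimal_complex ::
  "('a, 'y) ranked_poset_scheme \<Rightarrow> ('r, 'm, 'z) module_scheme \<Rightarrow> ('a \<Rightarrow> 'm set) \<Rightarrow>
     ('a, 'r, 'a list \<Rightarrow> 'm) graded_complex" where
  "minimal_complex L M A = \<lparr>ambient = list_module M,
     piece = (\<lambda>x. minimal_piece L M A (rk L x) x), diff = list_diff L M\<rparr>"


section \<open>Symmetric algebras\<close>

text \<open>\<open>Sym W\<close> is the free commutative algebra \<open>K[X\<^sub>w | w \<in> W]\<close> on the underlying set of \<open>W\<close>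
  modulo the relations making \<open>w \<mapsto> X\<^sub>w\<close> linear.\<close>

definition poly_var :: "'m \<Rightarrow> ('m \<Rightarrow>\<^sub>0 nat) \<Rightarrow>\<^sub>0 'k::comm_ring_1" where
  "poly_var w = Poly_Mapping.single (Poly_Mapping.single w 1) 1"

definition poly_const :: "'k::comm_ring_1 \<Rightarrow> ('m \<Rightarrow>\<^sub>0 nat) \<Rightarrow>\<^sub>0 'k" where
  "poly_const c = Poly_Mapping.single 0 c"

definition free_comm_algebra :: "'m set \<Rightarrow> (('m \<Rightarrow>\<^sub>0 nat) \<Rightarrow>\<^sub>0 'k::comm_ring_1) ring" where
  "free_comm_algebra S = ring_of_type_algebra
     \<lparr>carrier := {p. \<forall>m \<in> Poly_Mapping.keys p. Poly_Mapping.keys m \<subseteq> S}\<rparr>"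

definition linear_relations ::
  "('k::comm_ring_1, 'm, 'z) module_scheme \<Rightarrow> (('m \<Rightarrow>\<^sub>0 nat) \<Rightarrow>\<^sub>0 'k) set" where
  "linear_relations W =
     {poly_var (v \<oplus>\<^bsub>W\<^esub> w) - poly_var v - poly_var w | v w. v \<in> carrier W \<and> w \<in> carrier W} \<union>
     {poly_var (c \<odot>\<^bsub>W\<^esub> w) - poly_const c * poly_var w | c w. w \<in> carrier W}"

definition linear_ideal ::
  "('k::comm_ring_1, 'm, 'z) module_scheme \<Rightarrow> (('m \<Rightarrow>\<^sub>0 nat) \<Rightarrow>\<^sub>0 'k) set" where
  "linear_ideal W = Idl\<^bsub>free_comm_algebra (carrier W)\<^esub> (linear_relations W)"

definition Sym ::
  "('k::comm_ring_1, 'm, 'z) module_scheme \<Rightarrow> (('m \<Rightarrow>\<^sub>0 nat) \<Rightarrow>\<^sub>0 'k) set ring" where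
  "Sym W = free_comm_algebra (carrier W) Quot linear_ideal W"

definition Sym_incl ::
  "('k::comm_ring_1, 'm, 'z) module_scheme \<Rightarrow> 'm \<Rightarrow> (('m \<Rightarrow>\<^sub>0 nat) \<Rightarrow>\<^sub>0 'k) set" where
  "Sym_incl W w = linear_ideal W +>\<^bsub>free_comm_algebra (carrier W)\<^esub> poly_var w"

definition Sym_ideal ::
  "('k::comm_ring_1, 'm, 'z) module_scheme \<Rightarrow> 'm set \<Rightarrow> (('m \<Rightarrow>\<^sub>0 nat) \<Rightarrow>\<^sub>0 'k) set set" where
  "Sym_ideal W S = Idl\<^bsub>Sym W\<^esub> (Sym_incl W ` S)"

definition regular_module :: "('r, 'z) ring_scheme \<Rightarrow> ('r, 'r) module" where
  "regular_module R = \<lparr>carrier = carrier R, monoid.mult = (\<otimes>\<^bsub>R\<^esub>), one = \<one>\<^bsub>R\<^esub>,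
     ring.zero = \<zero>\<^bsub>R\<^esub>, ring.add = (\<oplus>\<^bsub>R\<^esub>), module.smult = (\<otimes>\<^bsub>R\<^esub>)\<rparr>"


section \<open>Hyperplane arrangements in dual spaces\<close>

text \<open>The dual \<open>P\<^sup>*\<close> of a subspace \<open>P\<close> of \<open>U\<close>: functionals on \<open>P\<close> are extended by zero (as mere
  functions) to all of \<open>U\<close>, which makes them unique as elements of the type and closed under the
  pointwise operations.\<close>

definition dual_space ::
  "('k::field \<Rightarrow> 'u::ab_group_add \<Rightarrow> 'u) \<Rightarrow> 'u set \<Rightarrow> ('u \<Rightarrow> 'k) set" where
  "dual_space scale P = {f. (\<forall>u \<in> P. \<forall>v \<in> P. f (u + v) = f u + f v) \<and>
     (\<forall>c. \<forall>u \<in> P. f (scale c u) = c * f u) \<and> (\<forall>u. u \<notin> P \<longrightarrow> f u = 0)}"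

definition fun_scale :: "'k::field \<Rightarrow> ('u \<Rightarrow> 'k) \<Rightarrow> ('u \<Rightarrow> 'k)" where
  "fun_scale c f = (\<lambda>u. c * f u)"

definition dual_proj :: "'u set \<Rightarrow> ('u \<Rightarrow> 'k::field) \<Rightarrow> ('u \<Rightarrow> 'k)" where
  "dual_proj P f = (\<lambda>u. if u \<in> P then f u else 0)"

definition hyperplane_arrangement :: "('u \<Rightarrow> 'k::field) set \<Rightarrow> ('u \<Rightarrow> 'k) set set \<Rightarrow> bool" where
  "hyperplane_arrangement E \<H> \<longleftrightarrow> finite \<H> \<and>
     (\<forall>h \<in> \<H>. h \<subseteq> E \<and> module.subspace fun_scale h \<and>
        vector_space.dim fun_scale h + 1 = vector_space.dim fun_scale E)"

definition intersection_lattice ::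
  "('u \<Rightarrow> 'k::field) set \<Rightarrow> ('u \<Rightarrow> 'k) set set \<Rightarrow> ('u \<Rightarrow> 'k) set ranked_poset" where
  "intersection_lattice E \<H> = \<lparr>carrier = {E \<inter> \<Inter>\<A> | \<A>. \<A> \<subseteq> \<H>}, eq = (=),
     le = (\<lambda>x y. y \<subseteq> x), rk = (\<lambda>x. vector_space.dim fun_scale E - vector_space.dim fun_scale x)\<rparr>"

definition annihilator :: "('u \<Rightarrow> 'k::field) set \<Rightarrow> 'u set" where
  "annihilator h = {u. \<forall>f \<in> h. f u = 0}"

definition space_module ::
  "('k::field \<Rightarrow> 'u::ab_group_add \<Rightarrow> 'u) \<Rightarrow> ('k, 'u) module" where
  "space_module scale = \<lparr>carrier = UNIV, monoid.mult = undefined, one = undefined,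
     ring.zero = 0, ring.add = (+), module.smult = scale\<rparr>"

definition relation_complex ::
  "('k::field \<Rightarrow> 'u::ab_group_add \<Rightarrow> 'u) \<Rightarrow> ('u \<Rightarrow> 'k) set set \<Rightarrow>
     (('u \<Rightarrow> 'k) set, 'k, ('u \<Rightarrow> 'k) set list \<Rightarrow> 'u) graded_complex" where
  "relation_complex scale \<H> =
     minimal_complex (intersection_lattice (dual_space scale UNIV) \<H>) (space_module scale) annihilator"

definition general_position ::
  "('k::field \<Rightarrow> 'u::ab_group_add \<Rightarrow> 'u) \<Rightarrow> ('u \<Rightarrow> 'k) set set \<Rightarrow> 'u set \<Rightarrow> nat \<Rightarrow> bool" where
  "general_position scale \<H> P k \<longleftrightarrow>
     (let L = intersection_lattice (dual_space scale UNIV) \<H>;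
          P_perp = {f \<in> dual_space scale UNIV. dual_proj P f = 0}
      in (\<forall>x \<in> level L k. x \<inter> P_perp = {0}) \<and> inj_on (\<lambda>x. dual_proj P ` x) (level L (k + 1)))"

end

theory Submission
  imports Defs
begin

text \<open>Of the \<open>L\<close>-homotopies only the exactness of the complexes \<open>V\<^sub>\<le>\<^sub>x\<close> in positive degrees is
  needed. General position gives \<open>l (x \<inter> y) = l x \<inter> l y\<close> whenever \<open>x\<close> and \<open>y\<close> have a common lower
  bound of rank \<open>k\<close>. Hence for \<open>t\<close> in \<open>\<Lambda>\<close> the elements \<open>x\<close> of rank \<open>> k\<close> with \<open>l x \<le> t\<close> that lie
  above a given \<open>u\<close> of rank \<open>k\<close> have a greatest element, and the truncated complex
  \<open>V\<^sub>k \<leftarrow> V\<^sub>k\<^sub>+\<^sub>1 \<leftarrow> \<dots>\<close>, restricted to \<open>l x \<le> t\<close>, is exact in positive degrees, because its cycles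
  split into cycles of complexes \<open>V\<^sub>\<le>\<^sub>y\<close>.

  The tensor algebra of this truncated complex, a complex of vector spaces, is graded by \<open>\<Lambda>\<close>
  through joins of positions, and over each \<open>t\<close> it has a contracting homotopy \<open>\<Sum> p \<otimes> \<dots> \<otimes> p \<otimes> h \<otimes> 1 \<otimes> \<dots> \<otimes> 1\<close>
  built from a homotopy \<open>h\<close> of the truncated complex with error \<open>p\<close>. Unfolding the recursion that
  defines the minimal complex turns multiplication from the tensor algebra of \<open>V\<^sub>k\<close> to \<open>Sym V\<^sub>k\<close> and the
  symmetrization in the other direction, which exists in characteristic zero, into chain maps. They make
  the minimal complex a retract of an exact complex.\<close>

section \<open>Minimal complexes of finite ranked orders\<close>

text \<open>The pieces of a minimal complex are iterated kernels without an explicit description, so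
  no contraction is sought inside it. What the recursion offers is that the differential embeds each
  piece \<open>W_x\<close> into the preceding degree: a map into \<open>W_x\<close> is determined by
  a cycle below \<open>x\<close>, and a map out of \<open>W_x\<close> is obtained by filling the
  image of a cycle. So the comparison complex needs a splitting by exact positions and a homotopy
  over each position.

  Tensor words suit this because applying \<open>p\<close> to all letters before \<open>h\<close>
  leaves the error \<open>p\<close> on every letter. This error vanishes in positive degree, where
  \<open>p\<close> meets a letter it kills, and on the symmetrization of the ideal at an atom
  \<open>a\<close>, whose generators are boundaries of elements over \<open>a\<close> and hence
  killed by the \<open>p\<close> chosen for \<open>a\<close>.

  Ranks enter through subadditivity: a word of degree \<open>i\<close> has a position of rank at
  most \<open>i\<close>. Components of rank below \<open>i\<close> must not contribute: for
  \<open>i = 1\<close> there are none, and for larger \<open>i\<close> their boundaries map to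
  cycles of degree \<open>i - 1\<close> over a position of rank less than \<open>i\<close>, where
  the minimal complex has only the zero cycle.\<close>

lemma abelian_group_list_module:
  assumes "abelian_group M"
  shows "abelian_group (list_module M)"
proof -
  interpret M: abelian_group M by (fact assms)
  show ?thesis
  proof (rule abelian_groupI, goal_cases)
    case (6 w)
    then show ?case
      by (intro bexI[of _ "\<lambda>c. \<ominus>\<^bsub>M\<^esub> w c"]) (auto simp: list_module_def M.l_neg)
  qed (auto simp: list_module_def M.a_ac fun_eq_iff)
qed

locale list_fun_module = abelian_group M
  for M :: "('r, 'm, 'z) module_scheme" (structure) +
  fixes N :: "('r, 'a list \<Rightarrow> 'm) module"
  defines N_def: "N \<equiv> list_module M"
begin

sublocale N: abelian_group N
  unfolding N_def by (rule abelian_group_list_module) (rule abelian_group_axioms)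

lemma carrier_N [simp]: "w \<in> carrier N \<longleftrightarrow> (\<forall>c. w c \<in> carrier M)"
  and zero_N [simp]: "\<zero>\<^bsub>N\<^esub> = (\<lambda>c. \<zero>)"
  and add_N [simp]: "v \<oplus>\<^bsub>N\<^esub> w = (\<lambda>c. v c \<oplus> w c)"
  by (auto simp: N_def list_module_def)

lemma finsum_N:
  assumes "finite S" "\<And>x c. x \<in> S \<Longrightarrow> w x c \<in> carrier M"
  shows "finsum N w S c = (\<Oplus>x\<in>S. w x c)"
  using assms
proof (induction S)
  case (insert x S)
  then have "w x \<in> carrier N" "w \<in> S \<rightarrow> carrier N" by auto
  with insert show ?case by (simp add: Pi_def)
qed simp

lemma finsum_single:
  assumes "finite S" "x \<in> S \<Longrightarrow> u \<in> carrier M"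
  shows "(\<Oplus>y\<in>S. if y = x then u else \<zero>) = (if x \<in> S then u else \<zero>)"
proof (cases "x \<in> S")
  case True
  then show ?thesis
    using add.finprod_singleton[of x S "\<lambda>_. u"] assms
    by (simp add: eq_commute[of _ x])
next
  case False
  then have "(\<Oplus>y\<in>S. if y = x then u else \<zero>) = (\<Oplus>y\<in>S. \<zero>)"
    by (intro finsum_cong') auto
  with False show ?thesis by simp
qed

end

text \<open>The submodule before it is tagged with \<open>x\<close>. Membership in a sum of pieces
  can then be tested on each slice \<open>\<lambda>c. w (x # c)\<close>, with no existential over
  copies.\<close>

definition pre_piece ::
  "('a, 'y) ranked_poset_scheme \<Rightarrow> ('r, 'm, 'z) module_scheme \<Rightarrow> ('a \<Rightarrow> 'm set) \<Rightarrow>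
     nat \<Rightarrow> 'a \<Rightarrow> ('a list \<Rightarrow> 'm) set" where
  "pre_piece L M A i x =
     (if i = 0 then root_copy M ` A x
      else {w \<in> sum_submodules (list_module M) (minimal_piece L M A i) {y. covers L x y}.
              list_diff L M i w = \<zero>\<^bsub>list_module M\<^esub>})"

lemma minimal_piece_Suc: "minimal_piece L M A (Suc i) x = copy M x ` pre_piece L M A i x"
  by (simp add: pre_piece_def)

text \<open>\<open>rk_less\<close> and \<open>rk_covers\<close> turn the covering relation of the
  recursion into being below and one rank lower, see \<open>covers_eq\<close>. Equality is fixed
  because the strict order of HOL-Algebra refers to the equivalence stored in the record.\<close>

locale ranked_order =
  fixes L :: "('a, 'y) ranked_poset_scheme"
  assumes finite_L: "finite (carrier L)"
    and eq_L: "eq L = (=)"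
    and le_refl: "x \<in> carrier L \<Longrightarrow> x \<sqsubseteq>\<^bsub>L\<^esub> x"
    and le_trans: "x \<sqsubseteq>\<^bsub>L\<^esub> y \<Longrightarrow> y \<sqsubseteq>\<^bsub>L\<^esub> z \<Longrightarrow> x \<sqsubseteq>\<^bsub>L\<^esub> z"
    and rk_less: "x \<in> carrier L \<Longrightarrow> y \<in> carrier L \<Longrightarrow> x \<sqsubseteq>\<^bsub>L\<^esub> y \<Longrightarrow> x \<noteq> y \<Longrightarrow> rk L x < rk L y"
    and rk_covers: "covers L x y \<Longrightarrow> rk L x = Suc (rk L y)"
begin

lemma finite_level [simp]: "finite (level L i)"
  using finite_L by (simp add: level_def)

lemma level_carrier: "x \<in> level L i \<Longrightarrow> x \<in> carrier L"
  by (simp add: level_def)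

lemma covers_eq:
  assumes "x \<in> level L (Suc i)"
  shows "{y. covers L x y} = {y \<in> level L i. y \<sqsubseteq>\<^bsub>L\<^esub> x}"
proof (intro equalityI subsetI)
  fix y assume "y \<in> {y. covers L x y}"
  with rk_covers[of x y] assms show "y \<in> {y \<in> level L i. y \<sqsubseteq>\<^bsub>L\<^esub> x}"
    by (auto simp: covers_def level_def lless_def)
next
  fix y assume "y \<in> {y \<in> level L i. y \<sqsubseteq>\<^bsub>L\<^esub> x}"
  then have y: "y \<in> level L i" "y \<sqsubseteq>\<^bsub>L\<^esub> x" by auto
  have "\<not> (y \<sqsubset>\<^bsub>L\<^esub> z \<and> z \<sqsubset>\<^bsub>L\<^esub> x)" if "z \<in> carrier L" for z
    using rk_less[of y z] rk_less[of z x] that y assms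
    by (cases "y = z"; cases "z = x") (auto simp: lless_def eq_L level_def)
  with y assms show "y \<in> {y. covers L x y}"
    by (auto simp: covers_def level_def lless_def eq_L)
qed

lemma level_below_self:
  assumes "x \<in> level L i"
  shows "{y \<in> level L i. y \<sqsubseteq>\<^bsub>L\<^esub> x} = {x}"
proof -
  have "y = x" if "y \<in> level L i" "y \<sqsubseteq>\<^bsub>L\<^esub> x" for y
    using rk_less[of y x] assms that by (auto simp: level_def)
  with assms show ?thesis by (auto simp: le_refl level_def)
qed

lemma level_below_empty:
  assumes "x \<in> carrier L" "rk L x < i"
  shows "{y \<in> level L i. y \<sqsubseteq>\<^bsub>L\<^esub> x} = {}"
  using rk_less[of _ x] assms by (force simp: level_def)

end

locale minimal_cx = ranked_order L + list_fun_module M N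
  for L :: "('a, 'y) ranked_poset_scheme"
    and M :: "('r, 'm, 'z) module_scheme" (structure)
    and N :: "('r, 'a list \<Rightarrow> 'm) module" +
  fixes A :: "'a \<Rightarrow> 'm set"
  assumes A_carrier: "a \<in> level L 1 \<Longrightarrow> A a \<subseteq> carrier M"
begin

abbreviation "bd \<equiv> list_diff L M"

abbreviation psum :: "nat \<Rightarrow> 'a set \<Rightarrow> ('a list \<Rightarrow> 'm) set" where
  "psum i S \<equiv> sum_submodules N (minimal_piece L M A i) S"

abbreviation pre :: "nat \<Rightarrow> 'a \<Rightarrow> ('a list \<Rightarrow> 'm) set" where
  "pre \<equiv> pre_piece L M A"

lemma pre_Suc: "x \<in> level L (Suc (Suc i)) \<Longrightarrow>
    pre (Suc i) x = {w \<in> psum (Suc i) {y \<in> level L (Suc i). y \<sqsubseteq>\<^bsub>L\<^esub> x}. bd (Suc i) w = (\<lambda>c. \<zero>)}"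
  by (simp add: pre_piece_def N_def[symmetric] covers_eq)

lemma copy_apply [simp]: "copy M x w [] = \<zero>" "copy M x w (y # c) = (if y = x then w c else \<zero>)"
  by (auto simp: copy_def)

text \<open>The head of a list names the summand, so a sum of copies is read back slice by slice;
  this is the directness of the sum. The carrier condition is an assumption here because
  \<open>pre_carrier\<close> is itself proved by induction through this description;
  \<open>psum_Suc_iff\<close> discharges it.\<close>

lemma psum_Suc_carrier_pre:
  assumes "\<And>x. x \<in> S \<Longrightarrow> pre i x \<subseteq> carrier N" "finite S"
  shows "w \<in> psum (Suc i) S \<longleftrightarrow>
    w [] = \<zero> \<and> (\<forall>x c. x \<notin> S \<longrightarrow> w (x # c) = \<zero>) \<and> (\<forall>x\<in>S. (\<lambda>c. w (x # c)) \<in> pre i x)"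
proof -
  have piece: "v x \<in> copy M x ` pre i x" if "v \<in> Pi S (minimal_piece L M A (Suc i))" "x \<in> S" for v x
    using that minimal_piece_Suc[of L M A i x] by (auto simp del: minimal_piece.simps)
  have fin: "finsum N (\<lambda>x. copy M x (u x)) S c =
      (case c of [] \<Rightarrow> \<zero> | x # c' \<Rightarrow> if x \<in> S then u x c' else \<zero>)"
    if u: "\<And>x. x \<in> S \<Longrightarrow> u x \<in> pre i x" for u c
  proof -
    have car: "u x c \<in> carrier M" if "x \<in> S" for x c
      using assms(1)[OF that] u[OF that] by auto
    have car': "copy M x (u x) c \<in> carrier M" if "x \<in> S" for x c
      using car[OF that] by (cases c) auto
    have 1: "finsum N (\<lambda>x. copy M x (u x)) S c = (\<Oplus>x\<in>S. copy M x (u x) c)"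
      by (rule finsum_N) (use assms car' in auto)
    show ?thesis
    proof (cases c)
      case (Cons y c')
      have "(\<Oplus>x\<in>S. copy M x (u x) c) = (\<Oplus>x\<in>S. if x = y then u y c' else \<zero>)"
        by (rule finsum_cong') (use Cons car in auto)
      also have "\<dots> = (if y \<in> S then u y c' else \<zero>)"
        by (rule finsum_single) (use car assms in auto)
      finally show ?thesis using 1 Cons by simp
    qed (use 1 in simp)
  qed
  show ?thesis
  proof
    assume "w \<in> psum (Suc i) S"
    then obtain v where v: "v \<in> Pi S (minimal_piece L M A (Suc i))" and w: "w = finsum N v S"
      by (auto simp: sum_submodules_def simp del: minimal_piece.simps)
    have "\<forall>x\<in>S. \<exists>u. u \<in> pre i x \<and> v x = copy M x u" using piece[OF v] by auto
    then obtain u where u: "\<And>x. x \<in> S \<Longrightarrow> u x \<in> pre i x" "\<And>x. x \<in> S \<Longrightarrow> v x = copy M x (u x)"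
      by metis
    have "copy M x (u x) \<in> carrier N" if "x \<in> S" for x
      using assms(1)[OF that] u(1)[OF that] by (auto simp: copy_def split: list.split)
    then have w: "w = finsum N (\<lambda>x. copy M x (u x)) S"
      unfolding w by (intro N.finsum_cong') (use u(2) in auto)
    show "w [] = \<zero> \<and> (\<forall>x c. x \<notin> S \<longrightarrow> w (x # c) = \<zero>) \<and> (\<forall>x\<in>S. (\<lambda>c. w (x # c)) \<in> pre i x)"
      using u(1) by (simp add: w fin[OF u(1)])
  next
    assume *: "w [] = \<zero> \<and> (\<forall>x c. x \<notin> S \<longrightarrow> w (x # c) = \<zero>) \<and> (\<forall>x\<in>S. (\<lambda>c. w (x # c)) \<in> pre i x)"
    have "w = finsum N (\<lambda>x. copy M x (\<lambda>c. w (x # c))) S"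
    proof
      fix c show "w c = finsum N (\<lambda>x. copy M x (\<lambda>c. w (x # c))) S c"
        by (subst fin) (use * in \<open>auto split: list.split\<close>)
    qed
    moreover have "(\<lambda>x. copy M x (\<lambda>c. w (x # c))) \<in> Pi S (minimal_piece L M A (Suc i))"
      using * by (auto simp: minimal_piece_Suc simp del: minimal_piece.simps)
    ultimately show "w \<in> psum (Suc i) S"
      by (auto simp: sum_submodules_def simp del: minimal_piece.simps)
  qed
qed

lemma pre_carrier: "x \<in> level L (Suc i) \<Longrightarrow> pre i x \<subseteq> carrier N"
proof (induction i arbitrary: x)
  case 0
  with A_carrier[of x] show ?case by (auto simp: pre_piece_def root_copy_def)
next
  case (Suc i)
  let ?S = "{y \<in> level L (Suc i). y \<sqsubseteq>\<^bsub>L\<^esub> x}"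
  have "w c \<in> carrier M" if "w \<in> psum (Suc i) ?S" for w c
  proof -
    have *: "w [] = \<zero>" "\<And>x c. x \<notin> ?S \<Longrightarrow> w (x # c) = \<zero>" "\<And>x. x \<in> ?S \<Longrightarrow> (\<lambda>c. w (x # c)) \<in> pre i x"
      using that psum_Suc_carrier_pre[of ?S i w] Suc.IH by auto
    show ?thesis
    proof (cases c)
      case (Cons y c')
      show ?thesis
      proof (cases "y \<in> ?S")
        case True
        then have "(\<lambda>c. w (y # c)) \<in> carrier N" using *(3)[OF True] Suc.IH[of y] by auto
        with Cons show ?thesis by simp
      qed (use *(2) Cons in simp)
    qed (use *(1) in simp)
  qed
  with Suc.prems show ?case by (auto simp: pre_Suc)
qed

lemma psum_Suc_iff:
  assumes "S \<subseteq> level L (Suc i)"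
  shows "w \<in> psum (Suc i) S \<longleftrightarrow>
    w [] = \<zero> \<and> (\<forall>x c. x \<notin> S \<longrightarrow> w (x # c) = \<zero>) \<and> (\<forall>x\<in>S. (\<lambda>c. w (x # c)) \<in> pre i x)"
  using assms pre_carrier finite_subset[OF assms finite_level] by (intro psum_Suc_carrier_pre) auto

lemma psum_carrier:
  assumes "w \<in> psum (Suc i) S" "S \<subseteq> level L (Suc i)"
  shows "w c \<in> carrier M"
proof (cases c)
  case (Cons x c')
  show ?thesis
  proof (cases "x \<in> S")
    case True
    then have "(\<lambda>c. w (x # c)) \<in> carrier N"
      using pre_carrier[of x i] assms psum_Suc_iff[OF assms(2), of w] by blast
    with Cons show ?thesis by simp
  qed (use Cons assms in \<open>simp add: psum_Suc_iff\<close>)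
qed (use assms in \<open>auto simp: psum_Suc_iff\<close>)

text \<open>On one summand the differential only strips the tag \<open>x\<close>, hence is injective
  there. This injectivity drives the comparison with other complexes, through
  \<open>psum_single_eqI\<close>.\<close>

lemma diff_single:
  assumes "w \<in> psum (Suc i) {x}" "x \<in> level L (Suc i)"
  shows "bd (Suc i) w = (\<lambda>c. w (x # c))"
proof
  fix c
  have "bd (Suc i) w c = (\<Oplus>y\<in>level L (Suc i). if y = x then w (x # c) else \<zero>)"
    unfolding list_diff_def
    by (rule finsum_cong') (use assms psum_carrier[OF assms(1)] in \<open>auto simp: psum_Suc_iff\<close>)
  also have "\<dots> = w (x # c)"
    using assms psum_carrier[OF assms(1)] by (subst finsum_single) auto
  finally show "bd (Suc i) w c = w (x # c)" .
qed

lemma diff_diff: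
  assumes "w \<in> psum (Suc (Suc i)) (level L (Suc (Suc i)))"
  shows "bd (Suc i) (bd (Suc (Suc i)) w) = (\<lambda>c. \<zero>)"
proof
  fix c
  let ?I = "level L (Suc i)" and ?J = "level L (Suc (Suc i))"
  have car: "w c \<in> carrier M" for c using psum_carrier[OF assms] by auto
  have "bd (Suc i) (bd (Suc (Suc i)) w) c = (\<Oplus>y\<in>?I. \<Oplus>x\<in>?J. w (x # y # c))"
    by (simp add: list_diff_def)
  also have "\<dots> = (\<Oplus>x\<in>?J. \<Oplus>y\<in>?I. w (x # y # c))"
  proof -
    have *: "(\<Oplus>y\<in>B. \<Oplus>x\<in>C. f x y) = (\<Oplus>x\<in>C. \<Oplus>y\<in>B. f x y)"
      if "finite B" "finite C" "\<And>x y. f x y \<in> carrier M" for B C and f :: "'a \<Rightarrow> 'a \<Rightarrow> 'm"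
      using that(1)
    proof (induction B)
      case (insert b B)
      then show ?case using that(2,3) by (simp add: finsum_addf Pi_def)
    qed (use that in simp)
    show ?thesis by (rule *) (use car in auto)
  qed
  \<comment> \<open>After the exchange the inner sum is the differential of the slice at
    \<open>x\<close>, and slices are cycles by construction.\<close>
  also have "\<dots> = (\<Oplus>x\<in>?J. \<zero>)"
  proof (rule finsum_cong')
    fix x assume x: "x \<in> ?J"
    then have "(\<lambda>c. w (x # c)) \<in> pre (Suc i) x" using assms by (simp add: psum_Suc_iff)
    then have "bd (Suc i) (\<lambda>c. w (x # c)) = (\<lambda>c. \<zero>)" using x by (simp add: pre_Suc)
    then show "(\<Oplus>y\<in>?I. w (x # y # c)) = \<zero>" by (auto simp: list_diff_def dest: fun_cong)
  qed auto
  finally show "bd (Suc i) (bd (Suc (Suc i)) w) c = \<zero>" by simp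
qed

end

declare minimal_piece.simps(2) [simp del]

text \<open>The complex \<open>F\<close> comes with contracting homotopies \<open>H y\<close> of its parts \<open>F i y\<close>, and \<open>r z\<close> extracts
  the component of a chain at position exactly \<open>z\<close>. By induction the maps \<open>\<phi>0\<close> and \<open>\<psi>0\<close> in degree 0
  extend to chain maps \<open>\<phi>\<close> and \<open>\<psi>\<close> with \<open>\<phi> \<circ> \<psi>\<close> the identity of the minimal complex.\<close>

locale koszul_retract = minimal_cx L M N A
  for L :: "('a, 'y) ranked_poset_scheme"
    and M :: "('r, 'm, 'z) module_scheme" (structure)
    and N :: "('r, 'a list \<Rightarrow> 'm) module"
    and A :: "'a \<Rightarrow> 'm set" +
  fixes G :: "'f::ab_group_add set"
    and F :: "nat \<Rightarrow> 'a \<Rightarrow> 'f set"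
    and r :: "'a \<Rightarrow> 'f \<Rightarrow> 'f"
    and D :: "'f \<Rightarrow> 'f"
    and H :: "'a \<Rightarrow> 'f \<Rightarrow> 'f"
    and \<phi>0 :: "'f \<Rightarrow> 'm"
    and \<psi>0 :: "'m \<Rightarrow> 'f"
    and top :: 'a
  assumes G_zero: "0 \<in> G"
    and G_add: "f \<in> G \<Longrightarrow> g \<in> G \<Longrightarrow> f + g \<in> G"
    and G_D: "f \<in> G \<Longrightarrow> D f \<in> G"
    and G_r: "f \<in> G \<Longrightarrow> r x f \<in> G"
    and F_G: "F i y \<subseteq> G"
    and F_zero: "0 \<in> F i y"
    and F_add: "f \<in> F i y \<Longrightarrow> g \<in> F i y \<Longrightarrow> f + g \<in> F i y"
    and F_mono: "x \<in> carrier L \<Longrightarrow> y \<in> carrier L \<Longrightarrow> x \<sqsubseteq>\<^bsub>L\<^esub> y \<Longrightarrow> F i x \<subseteq> F i y"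
    and F_1: "z \<in> carrier L \<Longrightarrow> rk L z = 0 \<Longrightarrow> F 1 z \<subseteq> {0}"
    and D_add: "D (f + g) = D f + D g"
    and D_F: "y \<in> carrier L \<Longrightarrow> f \<in> F (Suc i) y \<Longrightarrow> D f \<in> F i y"
    and D_D: "y \<in> carrier L \<Longrightarrow> f \<in> F (Suc (Suc i)) y \<Longrightarrow> D (D f) = 0"
    and H_add: "H y (f + g) = H y f + H y g"
    and H_F: "y \<in> carrier L \<Longrightarrow> f \<in> F i y \<Longrightarrow> H y f \<in> F (Suc i) y"
    and H_cycle: "y \<in> carrier L \<Longrightarrow> f \<in> F (Suc i) y \<Longrightarrow> D f = 0 \<Longrightarrow> D (H y f) = f"
    and r_add: "r x (f + g) = r x f + r x g"
    and r_F: "y \<in> carrier L \<Longrightarrow> x \<in> carrier L \<Longrightarrow> f \<in> F i y \<Longrightarrow> r x f \<in> F i x"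
    and r_outside: "y \<in> carrier L \<Longrightarrow> x \<in> carrier L \<Longrightarrow> f \<in> F i y \<Longrightarrow> \<not> x \<sqsubseteq>\<^bsub>L\<^esub> y \<Longrightarrow> r x f = 0"
    and r_sum: "y \<in> carrier L \<Longrightarrow> f \<in> F i y \<Longrightarrow>
          (\<Sum>z | z \<in> carrier L \<and> z \<sqsubseteq>\<^bsub>L\<^esub> y \<and> rk L z \<le> i. r z f) = f"
    and top: "top \<in> carrier L" "x \<in> carrier L \<Longrightarrow> x \<sqsubseteq>\<^bsub>L\<^esub> top"
    and \<phi>0_carrier: "f \<in> G \<Longrightarrow> \<phi>0 f \<in> carrier M"
    and \<phi>0_add: "f \<in> G \<Longrightarrow> g \<in> G \<Longrightarrow> \<phi>0 (f + g) = \<phi>0 f \<oplus> \<phi>0 g"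
    and \<phi>0_A: "a \<in> level L 1 \<Longrightarrow> f \<in> F 1 a \<Longrightarrow> \<phi>0 (D f) \<in> A a"
    and \<psi>0_F: "y \<in> carrier L \<Longrightarrow> u \<in> carrier M \<Longrightarrow> \<psi>0 u \<in> F 0 y"
    and \<psi>0_add: "u \<in> carrier M \<Longrightarrow> v \<in> carrier M \<Longrightarrow> \<psi>0 (u \<oplus> v) = \<psi>0 u + \<psi>0 v"
    and \<psi>0_A: "a \<in> level L 1 \<Longrightarrow> u \<in> A a \<Longrightarrow> D (H a (\<psi>0 u)) = \<psi>0 u"
    and \<phi>0_\<psi>0: "u \<in> carrier M \<Longrightarrow> \<phi>0 (\<psi>0 u) = u"
begin

text \<open>The only possible chain map that respects positions: the slice at \<open>x\<close> must
  be the boundary of the image of the component at \<open>x\<close>, that is, the image of the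
  boundary one degree lower.\<close>

primrec \<phi> :: "nat \<Rightarrow> 'f \<Rightarrow> 'a list \<Rightarrow> 'm" where
  "\<phi> 0 f = root_copy M (\<phi>0 f)"
| "\<phi> (Suc i) f = (\<lambda>c. case c of [] \<Rightarrow> \<zero>
     | x # c' \<Rightarrow> if x \<in> level L (Suc i) then \<phi> i (D (r x f)) c' else \<zero>)"

text \<open>A slice of \<open>w\<close> at \<open>x\<close> is a cycle of the minimal complex; its
  image is a cycle over \<open>x\<close>, which \<open>H x\<close> fills.\<close>

primrec \<psi> :: "nat \<Rightarrow> ('a list \<Rightarrow> 'm) \<Rightarrow> 'f" where
  "\<psi> 0 w = \<psi>0 (w [])"
| "\<psi> (Suc i) w = (\<Sum>x\<in>level L (Suc i). H x (\<psi> i (\<lambda>c. w (x # c))))"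

lemma D_zero [simp]: "D 0 = 0" using D_add[of 0 0] by simp
lemma H_zero [simp]: "H y 0 = 0" using H_add[of y 0 0] by simp
lemma r_zero [simp]: "r x 0 = 0" using r_add[of x 0 0] by simp

lemma D_sum: "D (sum g S) = (\<Sum>x\<in>S. D (g x))"
  by (induction S rule: infinite_finite_induct) (auto simp: D_add)

lemma G_sum: "(\<And>x. x \<in> S \<Longrightarrow> g x \<in> G) \<Longrightarrow> sum g S \<in> G"
  by (induction S rule: infinite_finite_induct) (auto simp: G_zero G_add)

lemma F_sum: "(\<And>x. x \<in> S \<Longrightarrow> g x \<in> F i y) \<Longrightarrow> sum g S \<in> F i y"
  by (induction S rule: infinite_finite_induct) (auto simp: F_zero F_add)

lemma \<phi>0_zero [simp]: "\<phi>0 0 = \<zero>"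
  using \<phi>0_add[of 0 0] \<phi>0_carrier[of 0] add.r_cancel_one'[of "\<phi>0 0" "\<phi>0 0"] by (simp add: G_zero)

lemma \<psi>0_zero [simp]: "\<psi>0 \<zero> = 0"
  using \<psi>0_add[of \<zero> \<zero>] by simp

lemma \<phi>_carrier: "f \<in> G \<Longrightarrow> \<phi> i f c \<in> carrier M"
proof (induction i arbitrary: f c)
  case 0 then show ?case by (auto simp: root_copy_def \<phi>0_carrier)
next
  case (Suc i) then show ?case by (auto simp: G_D G_r split: list.split)
qed

lemma \<phi>_add: "f \<in> G \<Longrightarrow> g \<in> G \<Longrightarrow> \<phi> i (f + g) c = \<phi> i f c \<oplus> \<phi> i g c"
proof (induction i arbitrary: f g c)
  case 0 then show ?case by (auto simp: root_copy_def \<phi>0_add)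
next
  case (Suc i) then show ?case by (auto simp: G_D G_r D_add r_add split: list.split)
qed

lemma \<phi>_zero [simp]: "\<phi> i 0 = (\<lambda>c. \<zero>)"
  by (induction i) (auto simp: root_copy_def fun_eq_iff split: list.split)

lemma \<phi>_sum:
  assumes "finite S" "\<And>x. x \<in> S \<Longrightarrow> g x \<in> G"
  shows "\<phi> i (sum g S) c = (\<Oplus>x\<in>S. \<phi> i (g x) c)"
  using assms by (induction S) (auto simp: \<phi>_add G_sum \<phi>_carrier Pi_def)

lemma psum_Suc_empty:
  assumes "w \<in> psum (Suc i) {}"
  shows "w = (\<lambda>c. \<zero>)"
proof
  fix c show "w c = \<zero>" using assms by (cases c) (auto simp: psum_Suc_iff)
qed

lemma psum_single_eqI:
  assumes "v \<in> psum (Suc i) {x}" "w \<in> psum (Suc i) {x}" "x \<in> level L (Suc i)"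
    and "bd (Suc i) v = bd (Suc i) w"
  shows "v = w"
proof
  fix c
  have "v (x # c) = w (x # c)" for c
    using assms diff_single[OF assms(1,3)] diff_single[OF assms(2,3)] by metis
  then show "v c = w c"
    using assms by (cases c) (auto simp: psum_Suc_iff, metis)
qed

lemma zero_pre: "x \<in> level L (Suc i) \<Longrightarrow> (\<lambda>c. \<zero>) \<in> pre i x"
proof (induction i arbitrary: x)
  case 0
  \<comment> \<open>That \<open>A x\<close> contains zero is read off from \<open>\<phi>0_A\<close>
    at the zero chain.\<close>
  with \<phi>0_A[of x 0] have "\<zero> \<in> A x" by (simp add: F_zero)
  then have "root_copy M \<zero> \<in> pre 0 x" by (simp add: pre_piece_def)
  moreover have "root_copy M \<zero> = (\<lambda>c :: 'a list. \<zero>)" by (auto simp: root_copy_def)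
  ultimately show ?case by simp
next
  case (Suc i)
  then have "(\<lambda>c. \<zero>) \<in> psum (Suc i) {y \<in> level L (Suc i). y \<sqsubseteq>\<^bsub>L\<^esub> x}"
    by (subst psum_Suc_iff) auto
  with Suc.prems show ?case by (auto simp: pre_Suc list_diff_def)
qed

lemma psum_mono:
  assumes "S \<subseteq> T" "T \<subseteq> level L (Suc i)" "w \<in> psum (Suc i) S"
  shows "w \<in> psum (Suc i) T"
proof -
  have S: "S \<subseteq> level L (Suc i)" using assms by auto
  have *: "w [] = \<zero>" "\<And>x c. x \<notin> S \<Longrightarrow> w (x # c) = \<zero>" "\<And>x. x \<in> S \<Longrightarrow> (\<lambda>c. w (x # c)) \<in> pre i x"
    using assms(3) unfolding psum_Suc_iff[OF S] by auto
  have "(\<lambda>c. w (x # c)) \<in> pre i x" if "x \<in> T" for x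
    using *(2,3)[of x] zero_pre[of x i] assms(2) that by (cases "x \<in> S") auto
  with * assms(1) show ?thesis unfolding psum_Suc_iff[OF assms(2)] by auto
qed

text \<open>\<open>D f\<close> is the sum of the boundaries of all components of \<open>f\<close>.
  Those at rank \<open>Suc i\<close> give exactly the slices of \<open>\<phi> (Suc i) f\<close>, and
  by \<open>low\<close> the remaining ones have image zero, so summing the slices recovers the image
  of \<open>D f\<close>.\<close>

lemma \<phi>_step:
  assumes y: "y \<in> carrier L" and f: "f \<in> F (Suc i) y"
    and low: "\<And>z. z \<in> carrier L \<Longrightarrow> z \<sqsubseteq>\<^bsub>L\<^esub> y \<Longrightarrow> rk L z \<le> i \<Longrightarrow> \<phi> i (D (r z f)) = (\<lambda>c. \<zero>)"
    and pre: "\<And>x. x \<in> level L (Suc i) \<Longrightarrow> \<phi> i (D (r x f)) \<in> pre i x"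
  shows "\<phi> (Suc i) f \<in> psum (Suc i) {x \<in> level L (Suc i). x \<sqsubseteq>\<^bsub>L\<^esub> y} \<and>
    bd (Suc i) (\<phi> (Suc i) f) = \<phi> i (D f)"
proof
  let ?S = "{x \<in> level L (Suc i). x \<sqsubseteq>\<^bsub>L\<^esub> y}"
  let ?Z = "{z. z \<in> carrier L \<and> z \<sqsubseteq>\<^bsub>L\<^esub> y \<and> rk L z \<le> Suc i}"
  have out: "\<phi> i (D (r x f)) = (\<lambda>c. \<zero>)" if "x \<in> level L (Suc i)" "\<not> x \<sqsubseteq>\<^bsub>L\<^esub> y" for x
    using r_outside[OF y level_carrier f] that by simp
  show "\<phi> (Suc i) f \<in> psum (Suc i) ?S"
    using pre out by (subst psum_Suc_iff) auto
  have fG: "f \<in> G" using f F_G by blast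
  have car: "\<phi> i (D (r x f)) c \<in> carrier M" for x c
    using fG by (intro \<phi>_carrier G_D G_r)
  have finZ: "finite ?Z" using finite_L by simp
  show "bd (Suc i) (\<phi> (Suc i) f) = \<phi> i (D f)"
  proof
    fix c
    have "bd (Suc i) (\<phi> (Suc i) f) c = (\<Oplus>x\<in>level L (Suc i). \<phi> i (D (r x f)) c)"
      unfolding list_diff_def by (rule finsum_cong') (use car in auto)
    also have "\<dots> = (\<Oplus>x\<in>?S. \<phi> i (D (r x f)) c)"
      by (rule add.finprod_mono_neutral_cong_right) (use out car in auto)
    also have "\<dots> = (\<Oplus>z\<in>?Z. \<phi> i (D (r z f)) c)"
    proof (rule add.finprod_mono_neutral_cong_left)
      show "?S \<subseteq> ?Z" by (auto simp: level_def)
      show "\<phi> i (D (r z f)) c = \<zero>" if "z \<in> ?Z - ?S" for z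
      proof -
        from that have "z \<in> carrier L" "z \<sqsubseteq>\<^bsub>L\<^esub> y" "rk L z \<le> i" by (auto simp: level_def)
        from low[OF this] show ?thesis by simp
      qed
    qed (use car finZ in auto)
    also have "\<dots> = \<phi> i (\<Sum>z\<in>?Z. D (r z f)) c"
      by (rule \<phi>_sum[symmetric]) (use finZ fG G_D G_r in auto)
    also have "(\<Sum>z\<in>?Z. D (r z f)) = D f"
      by (simp only: D_sum[symmetric] r_sum[OF y f])
    finally show "bd (Suc i) (\<phi> (Suc i) f) c = \<phi> i (D f) c" .
  qed
qed

lemma \<phi>_Suc:
  assumes "y \<in> carrier L" "f \<in> F (Suc i) y"
  shows "\<phi> (Suc i) f \<in> psum (Suc i) {x \<in> level L (Suc i). x \<sqsubseteq>\<^bsub>L\<^esub> y} \<and>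
    bd (Suc i) (\<phi> (Suc i) f) = \<phi> i (D f)"
  using assms
proof (induction i arbitrary: y f)
  case (0 y f)
  have "\<phi> 0 (D (r z f)) = (\<lambda>c. \<zero>)" if "z \<in> carrier L" "z \<sqsubseteq>\<^bsub>L\<^esub> y" "rk L z \<le> 0" for z
  proof -
    \<comment> \<open>Degree 0 imposes no cycle condition, so here the component itself has to
      vanish; \<open>F_1\<close> provides that.\<close>
    have "r z f = 0" using r_F[OF 0(1) that(1) 0(2)] F_1[of z] that by auto
    then show ?thesis by (auto simp: root_copy_def)
  qed
  moreover have "(\<lambda>c. \<phi> 0 (D (r x f)) c) \<in> pre 0 x" if "x \<in> level L 1" for x
    using r_F[of y x f 1] 0 that \<phi>0_A[of x "r x f"] by (auto simp: pre_piece_def level_carrier)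
  ultimately show ?case by (intro \<phi>_step 0) auto
next
  case (Suc i y f)
  have "\<phi> (Suc i) (D (r z f)) = (\<lambda>c. \<zero>)"
    if z: "z \<in> carrier L" "z \<sqsubseteq>\<^bsub>L\<^esub> y" "rk L z \<le> Suc i" for z
  proof -
    let ?w = "\<phi> (Suc i) (D (r z f))"
    have rz: "r z f \<in> F (Suc (Suc i)) z" using r_F[OF Suc(2) z(1) Suc(3)] .
    have *: "?w \<in> psum (Suc i) {x \<in> level L (Suc i). x \<sqsubseteq>\<^bsub>L\<^esub> z}" "bd (Suc i) ?w = (\<lambda>c. \<zero>)"
      using Suc.IH[OF z(1) D_F[OF z(1) rz]] D_D[OF z(1) rz] by (auto simp del: \<phi>.simps)
    show ?thesis
    \<comment> \<open>The image \<open>?w\<close> is a cycle below \<open>z\<close> in degree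
      \<open>Suc i\<close>. At rank \<open>Suc i\<close> only the summand of \<open>z\<close> is
      available and the differential is injective on it; at smaller rank there is no summand at
      all.\<close>
    proof (cases "rk L z = Suc i")
      case True
      then have zl: "z \<in> level L (Suc i)" using z by (simp add: level_def)
      have w: "?w \<in> psum (Suc i) {z}" using * unfolding level_below_self[OF zl] by simp
      have "(\<lambda>c. \<zero>) \<in> psum (Suc i) {z}"
        using zl zero_pre[OF zl] by (subst psum_Suc_iff) auto
      moreover have "bd (Suc i) (\<lambda>c. \<zero>) = (\<lambda>c. \<zero>)" by (simp add: list_diff_def)
      ultimately show ?thesis using psum_single_eqI[OF w _ zl] * by metis
    next
      case False
      then show ?thesis using * z level_below_empty[of z "Suc i"] psum_Suc_empty[of ?w i] by simp
    qed
  qed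
  moreover have "(\<lambda>c. \<phi> (Suc i) (D (r x f)) c) \<in> pre (Suc i) x" if x: "x \<in> level L (Suc (Suc i))" for x
  proof -
    have xc: "x \<in> carrier L" using x by (rule level_carrier)
    have rx: "r x f \<in> F (Suc (Suc i)) x" using r_F[OF Suc(2) xc Suc(3)] .
    show ?thesis
      using Suc.IH[OF xc D_F[OF xc rx]] D_D[OF xc rx] by (simp add: pre_Suc[OF x] del: \<phi>.simps)
  qed
  ultimately show ?case by (intro \<phi>_step Suc.prems) auto
qed

lemma \<psi>_add:
  assumes "\<And>c. w c \<in> carrier M" "\<And>c. v c \<in> carrier M"
  shows "\<psi> i (\<lambda>c. w c \<oplus> v c) = \<psi> i w + \<psi> i v"
  using assms
  by (induction i arbitrary: v w) (auto simp: \<psi>0_add H_add sum.distrib)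

lemma \<psi>_zero [simp]: "\<psi> i (\<lambda>c. \<zero>) = 0"
  by (induction i) auto

lemma \<psi>_sum:
  assumes "finite S" "\<And>x c. x \<in> S \<Longrightarrow> w x c \<in> carrier M"
  shows "\<psi> i (\<lambda>c. \<Oplus>x\<in>S. w x c) = (\<Sum>x\<in>S. \<psi> i (w x))"
  using assms
proof (induction S)
  case (insert x S)
  then show ?case by (simp add: Pi_def \<psi>_add)
qed simp

lemma \<psi>_step:
  assumes y: "y \<in> carrier L" and w: "w \<in> psum (Suc i) {x \<in> level L (Suc i). x \<sqsubseteq>\<^bsub>L\<^esub> y}"
    and F: "\<And>x. x \<in> level L (Suc i) \<Longrightarrow> x \<sqsubseteq>\<^bsub>L\<^esub> y \<Longrightarrow> \<psi> i (\<lambda>c. w (x # c)) \<in> F i x"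
  shows "\<psi> (Suc i) w \<in> F (Suc i) y"
  unfolding \<psi>.simps
proof (rule F_sum)
  fix x assume x: "x \<in> level L (Suc i)"
  show "H x (\<psi> i (\<lambda>c. w (x # c))) \<in> F (Suc i) y"
  proof (cases "x \<sqsubseteq>\<^bsub>L\<^esub> y")
    case True
    then show ?thesis
      using H_F[OF level_carrier[OF x] F[OF x True]] F_mono[OF level_carrier[OF x] y True] by auto
  next
    case False
    then have "(\<lambda>c. w (x # c)) = (\<lambda>c. \<zero>)" using w by (subst (asm) psum_Suc_iff) auto
    then show ?thesis by (simp add: F_zero)
  qed
qed

lemma \<psi>_F:
  assumes "y \<in> carrier L" "w \<in> psum (Suc i) {x \<in> level L (Suc i). x \<sqsubseteq>\<^bsub>L\<^esub> y}"
  shows "\<psi> (Suc i) w \<in> F (Suc i) y"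
  using assms
proof (induction i arbitrary: y w)
  case (0 y w)
  have "\<psi> 0 (\<lambda>c. w (x # c)) \<in> F 0 x" if "x \<in> level L 1" "x \<sqsubseteq>\<^bsub>L\<^esub> y" for x
  proof -
    have "(\<lambda>c. w (x # c)) \<in> pre 0 x" using 0 that by (subst (asm) psum_Suc_iff) auto
    then obtain u where "u \<in> A x" "(\<lambda>c. w (x # c)) = root_copy M u"
      by (auto simp: pre_piece_def)
    then show ?thesis
      using A_carrier[OF that(1)] \<psi>0_F[of x u] that by (auto simp: level_carrier root_copy_def)
  qed
  then show ?case using 0 by (intro \<psi>_step) auto
next
  case (Suc i y w)
  have "\<psi> (Suc i) (\<lambda>c. w (x # c)) \<in> F (Suc i) x" if "x \<in> level L (Suc (Suc i))" "x \<sqsubseteq>\<^bsub>L\<^esub> y" for x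
  proof -
    have "(\<lambda>c. w (x # c)) \<in> pre (Suc i) x" using Suc.prems that by (subst (asm) psum_Suc_iff) auto
    then show ?thesis
      using Suc.IH[of x "\<lambda>c. w (x # c)"] that by (auto simp: pre_Suc level_carrier simp del: \<psi>.simps)
  qed
  then show ?case using Suc.prems by - (rule \<psi>_step, auto simp del: \<psi>.simps)
qed

lemma D_\<psi>_step:
  assumes w: "w \<in> psum (Suc i) (level L (Suc i))"
    and "\<And>x. x \<in> level L (Suc i) \<Longrightarrow> D (H x (\<psi> i (\<lambda>c. w (x # c)))) = \<psi> i (\<lambda>c. w (x # c))"
  shows "D (\<psi> (Suc i) w) = \<psi> i (bd (Suc i) w)"
proof -
  have "D (\<psi> (Suc i) w) = (\<Sum>x\<in>level L (Suc i). \<psi> i (\<lambda>c. w (x # c)))"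
    using assms(2) by (simp add: D_sum)
  also have "\<dots> = \<psi> i (bd (Suc i) w)"
    unfolding list_diff_def by (rule \<psi>_sum[symmetric]) (use psum_carrier[OF w] in auto)
  finally show ?thesis .
qed

text \<open>The boundary of a filling is the filled element as soon as that element is a cycle.
  Slices are cycles, so the claim one degree lower shows that their images are cycles too; in degree
  0 the axiom \<open>\<psi>0_A\<close> takes the place of the cycle condition.\<close>

lemma D_\<psi>:
  assumes "w \<in> psum (Suc i) (level L (Suc i))"
  shows "D (\<psi> (Suc i) w) = \<psi> i (bd (Suc i) w)"
  using assms
proof (induction i arbitrary: w)
  case (0 w)
  have "D (H x (\<psi> 0 (\<lambda>c. w (x # c)))) = \<psi> 0 (\<lambda>c. w (x # c))" if "x \<in> level L 1" for x
  proof -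
    have "(\<lambda>c. w (x # c)) \<in> pre 0 x" using 0 that by (subst (asm) psum_Suc_iff) auto
    then obtain u where "u \<in> A x" "(\<lambda>c. w (x # c)) = root_copy M u"
      by (auto simp: pre_piece_def)
    then show ?thesis using \<psi>0_A[OF that] by (auto simp: root_copy_def)
  qed
  then show ?case using 0 by (intro D_\<psi>_step) auto
next
  case (Suc i w)
  have "D (H x (\<psi> (Suc i) (\<lambda>c. w (x # c)))) = \<psi> (Suc i) (\<lambda>c. w (x # c))"
    if x: "x \<in> level L (Suc (Suc i))" for x
  proof -
    let ?v = "\<lambda>c. w (x # c)"
    have "?v \<in> pre (Suc i) x" using Suc.prems x by (subst (asm) psum_Suc_iff) auto
    then have v: "?v \<in> psum (Suc i) {y \<in> level L (Suc i). y \<sqsubseteq>\<^bsub>L\<^esub> x}" "bd (Suc i) ?v = (\<lambda>c. \<zero>)"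
      by (auto simp: pre_Suc[OF x])
    have "D (\<psi> (Suc i) ?v) = 0"
      using Suc.IH[of ?v] psum_mono[OF _ _ v(1)] v(2) by (simp del: \<psi>.simps)
    then show ?thesis
      using H_cycle[OF level_carrier[OF x] \<psi>_F[OF level_carrier[OF x] v(1)]] by simp
  qed
  then show ?case using Suc.prems by - (rule D_\<psi>_step, auto simp del: \<psi>.simps)
qed

text \<open>By additivity it suffices to treat one summand. There the differential is injective and
  both maps commute with differentials, so the identity follows from the one for the slice, one
  degree lower.\<close>

lemma \<phi>_\<psi>_step:
  assumes w: "w \<in> psum (Suc i) (level L (Suc i))"
    and IH: "\<And>x. x \<in> level L (Suc i) \<Longrightarrow> \<phi> i (\<psi> i (\<lambda>c. w (x # c))) = (\<lambda>c. w (x # c))"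
  shows "\<phi> (Suc i) (\<psi> (Suc i) w) = w"
proof -
  let ?I = "level L (Suc i)"
  let ?w = "\<lambda>x. copy M x (\<lambda>c. w (x # c))"
  have car: "w c \<in> carrier M" for c using psum_carrier[OF w] by auto
  have single: "?w x \<in> psum (Suc i) {x}" if "x \<in> ?I" for x
    using that w by (auto simp: psum_Suc_iff)
  have \<psi>_single: "\<psi> (Suc i) (?w x) = H x (\<psi> i (\<lambda>c. w (x # c)))" if x: "x \<in> ?I" for x
  proof -
    have "H y (\<psi> i (\<lambda>c. ?w x (y # c))) = (if y = x then H x (\<psi> i (\<lambda>c. w (x # c))) else 0)" for y
      by simp
    then show ?thesis unfolding \<psi>.simps using x by simp
  qed
  have F: "\<psi> (Suc i) (?w x) \<in> F (Suc i) x" if x: "x \<in> ?I" for x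
    using single[OF x] by (intro \<psi>_F) (auto simp: level_carrier[OF x] level_below_self[OF x])
  have \<phi>_single: "\<phi> (Suc i) (\<psi> (Suc i) (?w x)) = ?w x" if x: "x \<in> ?I" for x
  proof (rule psum_single_eqI[OF _ single[OF x] x])
    note * = \<phi>_Suc[OF level_carrier[OF x] F[OF x], unfolded level_below_self[OF x]]
    then show "\<phi> (Suc i) (\<psi> (Suc i) (?w x)) \<in> psum (Suc i) {x}" by simp
    have "bd (Suc i) (\<phi> (Suc i) (\<psi> (Suc i) (?w x))) = \<phi> i (D (\<psi> (Suc i) (?w x)))"
      using * by simp
    also have "D (\<psi> (Suc i) (?w x)) = \<psi> i (bd (Suc i) (?w x))"
      using psum_mono[OF _ _ single[OF x]] x by (intro D_\<psi>) auto
    also have "bd (Suc i) (?w x) = (\<lambda>c. w (x # c))"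
      using diff_single[OF single[OF x] x] by simp
    also have "\<phi> i (\<psi> i \<dots>) = \<dots>" by (rule IH[OF x])
    finally show "bd (Suc i) (\<phi> (Suc i) (\<psi> (Suc i) (?w x))) = bd (Suc i) (?w x)"
      using diff_single[OF single[OF x] x] by simp
  qed
  show ?thesis
  proof
    fix c
    have "\<psi> (Suc i) w = (\<Sum>x\<in>?I. \<psi> (Suc i) (?w x))"
      unfolding \<psi>.simps(2)[of i w] by (rule sum.cong) (simp_all only: \<psi>_single)
    then have "\<phi> (Suc i) (\<psi> (Suc i) w) c = (\<Oplus>x\<in>?I. \<phi> (Suc i) (\<psi> (Suc i) (?w x)) c)"
      using F F_G by (simp only:) (rule \<phi>_sum, auto)
    also have "\<dots> = (\<Oplus>x\<in>?I. ?w x c)"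
    proof (rule finsum_cong')
      fix x assume "x \<in> ?I"
      then show "\<phi> (Suc i) (\<psi> (Suc i) (?w x)) c = ?w x c" by (simp only: \<phi>_single)
    qed (use car in \<open>auto simp: copy_def split: list.split\<close>)
    also have "\<dots> = w c"
    proof (cases c)
      case Nil
      then show ?thesis using w by (simp add: psum_Suc_iff)
    next
      case (Cons y c')
      have "(\<Oplus>x\<in>?I. ?w x c) = (\<Oplus>x\<in>?I. if x = y then w c else \<zero>)"
        by (rule finsum_cong') (use Cons car in auto)
      also have "\<dots> = w c"
        using w Cons car by (subst finsum_single) (auto simp: psum_Suc_iff)
      finally show ?thesis .
    qed
    finally show "\<phi> (Suc i) (\<psi> (Suc i) w) c = w c" .
  qed
qed

lemma \<phi>_\<psi>:
  assumes "w \<in> psum (Suc i) (level L (Suc i))"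
  shows "\<phi> (Suc i) (\<psi> (Suc i) w) = w"
  using assms
proof (induction i arbitrary: w)
  case (0 w)
  have "\<phi> 0 (\<psi> 0 (\<lambda>c. w (x # c))) = (\<lambda>c. w (x # c))" if "x \<in> level L 1" for x
  proof -
    have "(\<lambda>c. w (x # c)) \<in> pre 0 x" using 0 that by (subst (asm) psum_Suc_iff) auto
    then obtain u where u: "u \<in> A x" "(\<lambda>c. w (x # c)) = root_copy M u"
      by (auto simp: pre_piece_def)
    then have "u \<in> carrier M" using A_carrier[OF that] by auto
    with u show ?thesis using \<phi>0_\<psi>0 by (simp add: root_copy_def)
  qed
  then show ?case using 0 by (intro \<phi>_\<psi>_step) auto
next
  case (Suc i w)
  have "\<phi> (Suc i) (\<psi> (Suc i) (\<lambda>c. w (x # c))) = (\<lambda>c. w (x # c))"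
    if x: "x \<in> level L (Suc (Suc i))" for x
  proof (rule Suc.IH)
    have "(\<lambda>c. w (x # c)) \<in> pre (Suc i) x" using Suc.prems x by (subst (asm) psum_Suc_iff) auto
    then show "(\<lambda>c. w (x # c)) \<in> psum (Suc i) (level L (Suc i))"
      by (auto simp: pre_Suc[OF x] intro: psum_mono[rotated 2])
  qed
  then show ?case using Suc.prems by - (rule \<phi>_\<psi>_step, auto simp del: \<psi>.simps \<phi>.simps)
qed

theorem exact_minimal_complex: "exact_complex L (minimal_complex L M A)"
proof -
  have chains: "chains L (minimal_complex L M A) i = psum i (level L i)" for i
  proof -
    have "Pi (level L i) (\<lambda>x. minimal_piece L M A (rk L x) x) = Pi (level L i) (minimal_piece L M A i)"
      by (auto simp: level_def Pi_def)
    then show ?thesis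
      by (simp add: chains_def minimal_complex_def sum_submodules_def N_def)
  qed
  have "{v \<in> psum (Suc i) (level L (Suc i)). bd (Suc i) v = (\<lambda>c. \<zero>)} =
      bd (Suc (Suc i)) ` psum (Suc (Suc i)) (level L (Suc (Suc i)))" for i
  proof (intro equalityI subsetI)
    fix v assume "v \<in> {v \<in> psum (Suc i) (level L (Suc i)). bd (Suc i) v = (\<lambda>c. \<zero>)}"
    then have v: "v \<in> psum (Suc i) (level L (Suc i))" "bd (Suc i) v = (\<lambda>c. \<zero>)" by auto
    have lev: "{x \<in> level L j. x \<sqsubseteq>\<^bsub>L\<^esub> top} = level L j" for j
      using top(2) by (auto simp: level_def)
    \<comment> \<open>The cycle is moved to the comparison complex, filled there over the greatest
      element, and the filling is moved back.\<close>
    define f where "f = \<psi> (Suc i) v"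
    have f: "f \<in> F (Suc i) top" unfolding f_def by (rule \<psi>_F) (use top v lev in auto)
    have "D f = 0" unfolding f_def by (simp only: D_\<psi>[OF v(1)] v(2) \<psi>_zero)
    then have Hf: "H top f \<in> F (Suc (Suc i)) top" "D (H top f) = f"
      using H_F[OF top(1) f] H_cycle[OF top(1) f] by auto
    have "\<phi> (Suc (Suc i)) (H top f) \<in> psum (Suc (Suc i)) (level L (Suc (Suc i)))"
      and "bd (Suc (Suc i)) (\<phi> (Suc (Suc i)) (H top f)) = v"
      using \<phi>_Suc[OF top(1) Hf(1)] \<phi>_\<psi>[OF v(1)] unfolding lev Hf(2) f_def[symmetric] by auto
    then show "v \<in> bd (Suc (Suc i)) ` psum (Suc (Suc i)) (level L (Suc (Suc i)))" by blast
  next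
    fix v assume "v \<in> bd (Suc (Suc i)) ` psum (Suc (Suc i)) (level L (Suc (Suc i)))"
    then obtain w where w: "w \<in> psum (Suc (Suc i)) (level L (Suc (Suc i)))" "v = bd (Suc (Suc i)) w"
      by auto
    have lev: "{x \<in> level L j. x \<sqsubseteq>\<^bsub>L\<^esub> top} = level L j" for j
      using top(2) by (auto simp: level_def)
    define f where "f = \<psi> (Suc (Suc i)) w"
    have f: "f \<in> F (Suc (Suc i)) top" unfolding f_def by (rule \<psi>_F) (use top w lev in auto)
    \<comment> \<open>Writing the boundary as a value of \<open>\<phi>\<close> shows that it lies in
      the chain module.\<close>
    have "v = \<phi> (Suc i) (D f)"
      using \<phi>_Suc[OF top(1) f] \<phi>_\<psi>[OF w(1)] w(2) by (simp only: f_def)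
    also have "\<dots> \<in> psum (Suc i) (level L (Suc i))"
      using \<phi>_Suc[OF top(1) D_F[OF top(1) f]] unfolding lev by simp
    finally show "v \<in> {v \<in> psum (Suc i) (level L (Suc i)). bd (Suc i) v = (\<lambda>c. \<zero>)}"
      using diff_diff[OF w(1)] w(2) by simp
  qed
  then have "{v \<in> psum i (level L i). bd i v = (\<lambda>c. \<zero>)} = bd (i + 1) ` psum (i + 1) (level L (i + 1))"
    if "1 \<le> i" for i
    using that by (cases i) auto
  then show ?thesis
    unfolding exact_complex_def chains by (simp add: minimal_complex_def N_def[symmetric])
qed

end

section \<open>Matrices over a finite basis and contracting homotopies\<close>

definition matmul :: "'e set \<Rightarrow> ('e \<Rightarrow> 'e \<Rightarrow> 'k::comm_ring_1) \<Rightarrow> ('e \<Rightarrow> 'e \<Rightarrow> 'k) \<Rightarrow> 'e \<Rightarrow> 'e \<Rightarrow> 'k" where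
  "matmul E a b e e'' = (\<Sum>e'\<in>E. a e e' * b e' e'')"

lemma matmul_assoc: "matmul E (matmul E a b) c = matmul E a (matmul E b c)"
proof (intro ext)
  fix e f
  have "(\<Sum>y\<in>E. (\<Sum>x\<in>E. a e x * b x y) * c y f) = (\<Sum>y\<in>E. \<Sum>x\<in>E. a e x * (b x y * c y f))"
    by (simp add: sum_distrib_right mult.assoc)
  also have "\<dots> = (\<Sum>x\<in>E. a e x * (\<Sum>y\<in>E. b x y * c y f))"
    by (subst sum.swap) (simp add: sum_distrib_left)
  finally show "matmul E (matmul E a b) c e f = matmul E a (matmul E b c) e f"
    by (simp add: matmul_def)
qed

lemma matmul_diff_left: "matmul E (\<lambda>e f. a e f - b e f) c e f = matmul E a c e f - matmul E b c e f"
  and matmul_diff_right: "matmul E a (\<lambda>e f. b e f - c e f) e f = matmul E a b e f - matmul E a c e f"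
  by (simp_all add: matmul_def algebra_simps sum_subtractf)

definition matvec :: "'e set \<Rightarrow> ('e \<Rightarrow> 'e \<Rightarrow> 'k::comm_ring_1) \<Rightarrow> ('e \<Rightarrow> 'k) \<Rightarrow> 'e \<Rightarrow> 'k" where
  "matvec E a g e = (\<Sum>e'\<in>E. a e e' * g e')"

lemma matvec_diff: "matvec E a (\<lambda>e. g e - h e) e = matvec E a g e - matvec E a h e"
  by (simp add: matvec_def algebra_simps sum_subtractf)

lemma matmul_column: "matmul E a b e f = matvec E a (\<lambda>e'. b e' f) e"
  by (simp add: matmul_def matvec_def)

lemma sum_fun_apply: "(\<Sum>i\<in>I. f i) x = (\<Sum>i\<in>I. f i x :: 'k::comm_monoid_add)"
  by (induction I rule: infinite_finite_induct) auto

lemma fun_scale_vector_space: "vector_space (fun_scale :: 'k::field \<Rightarrow> ('u \<Rightarrow> 'k) \<Rightarrow> _)"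
  by unfold_locales (auto simp: fun_scale_def fun_eq_iff algebra_simps)

lemma sum_mult_delta:
  assumes "finite E"
  shows "(\<Sum>x\<in>E. g x * (if x = y then 1 else 0)) = (if y \<in> E then g y else 0 :: 'k::comm_ring_1)"
    and "(\<Sum>x\<in>E. g x * (if y = x then 1 else 0)) = (if y \<in> E then g y else 0)"
    and "(\<Sum>x\<in>E. (if y = x then 1 else 0) * g x) = (if y \<in> E then g y else 0)"
proof -
  have *: "(\<lambda>x. g x * (if x = y then 1 else 0)) = (\<lambda>x. if x = y then g x else 0)"
    and "(\<lambda>x. g x * (if y = x then 1 else 0)) = (\<lambda>x. if x = y then g x else 0)"
    and "(\<lambda>x. (if y = x then 1 else 0) * g x) = (\<lambda>x. if x = y then g x else 0)"
    by (auto simp: fun_eq_iff)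
  then show "(\<Sum>x\<in>E. g x * (if x = y then 1 else 0)) = (if y \<in> E then g y else 0)"
    and "(\<Sum>x\<in>E. g x * (if y = x then 1 else 0)) = (if y \<in> E then g y else 0)"
    and "(\<Sum>x\<in>E. (if y = x then 1 else 0) * g x) = (if y \<in> E then g y else 0)"
    by (simp_all only: * sum.delta[OF assms])
qed

lemma sum_nonzero_witness:
  assumes "(\<Sum>x\<in>S. g x) \<noteq> 0"
  obtains x where "x \<in> S" "g x \<noteq> 0"
  using assms by (meson sum.neutral)

text \<open>A differential on a space with finite basis \<open>E\<close> that is exact in positive degrees has a
  contracting homotopy \<open>h\<close> up to an error \<open>p\<close> concentrated in degree \<open>0\<close> and killing boundaries:
  if \<open>s\<close> is a right inverse of \<open>d\<close> on its image, take \<open>h = s - s s d\<close>.\<close>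

lemma exact_imp_homotopy:
  fixes d :: "'e \<Rightarrow> 'e \<Rightarrow> 'k::field" and deg :: "'e \<Rightarrow> nat"
  assumes E: "finite E" and B: "B \<subseteq> E"
    and d_deg: "\<And>e e'. d e e' \<noteq> 0 \<Longrightarrow> deg e' = Suc (deg e)"
    and d_B: "\<And>e e'. d e e' \<noteq> 0 \<Longrightarrow> e' \<in> B \<Longrightarrow> e \<in> B"
    and dd: "\<And>e e'. matmul E d d e e' = 0"
    and exact: "\<And>i g. (\<And>e. g e \<noteq> 0 \<Longrightarrow> e \<in> B \<and> deg e = Suc i) \<Longrightarrow> (\<And>e. matvec E d g e = 0) \<Longrightarrow>
      \<exists>g'. (\<forall>e. g' e \<noteq> 0 \<longrightarrow> e \<in> B \<and> deg e = Suc (Suc i)) \<and> matvec E d g' = g"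
  shows "\<exists>h p. (\<forall>e e'. h e e' \<noteq> 0 \<longrightarrow> e \<in> B \<and> e' \<in> B \<and> deg e = Suc (deg e')) \<and>
    (\<forall>e e'. p e e' \<noteq> 0 \<longrightarrow> e \<in> B \<and> e' \<in> B \<and> deg e = 0 \<and> deg e' = 0) \<and>
    (\<forall>e\<in>B. \<forall>e'\<in>B. matmul E d h e e' + matmul E h d e e' = (if e = e' then 1 else 0) - p e e') \<and>
    (\<forall>e. \<forall>e'\<in>B. matmul E p d e e' = 0)"
proof -
  interpret V: vector_space "fun_scale :: 'k \<Rightarrow> ('e \<Rightarrow> 'k) \<Rightarrow> _" by (rule fun_scale_vector_space)
  interpret VV: vector_space_pair "fun_scale :: 'k \<Rightarrow> ('e \<Rightarrow> 'k) \<Rightarrow> _" "fun_scale :: 'k \<Rightarrow> ('e \<Rightarrow> 'k) \<Rightarrow> _" ..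
  define C where "C = {g :: 'e \<Rightarrow> 'k. \<forall>e. g e \<noteq> 0 \<longrightarrow> e \<in> B}"
  have C: "V.subspace C"
    by (auto simp: V.subspace_def C_def fun_scale_def zero_fun_def plus_fun_def) (metis add_0)
  have lin: "Vector_Spaces.linear fun_scale fun_scale (matvec E d)"
    by (auto simp: Vector_Spaces.linear_iff fun_scale_vector_space matvec_def fun_scale_def fun_eq_iff
        algebra_simps sum.distrib sum_distrib_left)
  obtain s where s_C: "range s \<subseteq> C" and s_lin: "Vector_Spaces.linear fun_scale fun_scale s"
    and s: "\<And>v. v \<in> matvec E d ` C \<Longrightarrow> matvec E d (s v) = v"
    using VV.linear_exists_right_inverse_on[OF lin C] by auto
  interpret s: Vector_Spaces.linear fun_scale fun_scale s by (rule s_lin)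
  define \<delta> where "\<delta> = (\<lambda>(e::'e) (e'::'e). if e = e' then 1 else 0 :: 'k)"
  \<comment> \<open>The right inverse \<open>s\<close> from linear algebra need not respect degrees.
    Only its matrix entries that raise the degree by one are kept.\<close>
  define \<sigma> where "\<sigma> = (\<lambda>e e'. if e \<in> B \<and> e' \<in> B \<and> deg e = Suc (deg e') then s (\<lambda>x. \<delta> x e') e else 0)"
  have "finite B" using E B finite_subset by blast
  have s_expand: "s g e = (\<Sum>e'\<in>E. g e' * s (\<lambda>x. \<delta> x e') e)" if "g \<in> C" for g e
  proof -
    have "g = (\<Sum>e'\<in>E. fun_scale (g e') (\<lambda>x. \<delta> x e'))"
    proof
      fix x show "g x = (\<Sum>e'\<in>E. fun_scale (g e') (\<lambda>x. \<delta> x e')) x"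
        using that B by (auto simp: fun_scale_def \<delta>_def C_def sum_fun_apply sum_mult_delta[OF E])
    qed
    then have "s g = (\<Sum>e'\<in>E. fun_scale (g e') (s (\<lambda>x. \<delta> x e')))"
      by (metis (no_types, lifting) s.sum s.scale sum.cong)
    then show ?thesis by (simp add: fun_scale_def sum_fun_apply)
  qed
  have \<sigma>: "matvec E d (matvec E \<sigma> g) = g"
    if g: "\<And>e. g e \<noteq> 0 \<Longrightarrow> e \<in> B \<and> deg e = i" "g \<in> matvec E d ` C" for g i
  proof -
    have gC: "g \<in> C" using g by (auto simp: C_def)
    have \<sigma>g: "matvec E \<sigma> g e = (if deg e = Suc i then s g e else 0)" for e
    proof (cases "deg e = Suc i \<and> e \<in> B")
      case True
      then have "matvec E \<sigma> g e = (\<Sum>e'\<in>E. g e' * s (\<lambda>x. \<delta> x e') e)"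
        unfolding matvec_def \<sigma>_def by (intro sum.cong) (use g in auto)
      with True s_expand[OF gC] show ?thesis by simp
    next
      case False
      then have "\<sigma> e e' * g e' = 0" for e' using g(1)[of e'] by (auto simp: \<sigma>_def)
      then have "matvec E \<sigma> g e = 0" unfolding matvec_def by (intro sum.neutral ballI)
      moreover have "s g e = 0" if "e \<notin> B" using s_C that by (auto simp: C_def)
      ultimately show ?thesis using False by auto
    qed
    show ?thesis
    proof
      fix e
      \<comment> \<open>Since \<open>d\<close> lowers the degree by exactly one, discarding the
        other degrees of \<open>s g\<close> changes nothing in degree \<open>i\<close>, and
        \<open>g\<close> lives in that degree.\<close>
      have *: "d e e' * (if deg e' = Suc i then s g e' else 0) = (if deg e = i then d e e' * s g e' else 0)" for e'
        using d_deg[of e e'] by (cases "d e e' = 0") auto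
      have "matvec E d (matvec E \<sigma> g) e = (\<Sum>e'\<in>E. d e e' * (if deg e' = Suc i then s g e' else 0))"
        by (simp add: matvec_def[of E d] \<sigma>g)
      also have "\<dots> = (if deg e = i then matvec E d (s g) e else 0)"
        unfolding matvec_def * by simp
      also have "\<dots> = (if deg e = i then g e else 0)" using s[OF g(2)] by simp
      also have "\<dots> = g e" using g(1) by auto
      finally show "matvec E d (matvec E \<sigma> g) e = g e" .
    qed
  qed
  have dcol: "matvec E d (\<lambda>x. \<delta> x f) e = d e f" if "f \<in> B" for e f
    using that B by (auto simp: matvec_def \<delta>_def sum_mult_delta[OF E])
  have d\<sigma>d: "matmul E d (matmul E \<sigma> d) e f = d e f" if f: "f \<in> B" for e f
  proof -
    have "matvec E d (matvec E \<sigma> (\<lambda>e'. d e' f)) = (\<lambda>e'. d e' f)"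
    proof (rule \<sigma>)
      \<comment> \<open>For \<open>deg f = 0\<close> the column of \<open>d\<close> at
        \<open>f\<close> is zero, so the truncated subtraction does no harm.\<close>
      show "e \<in> B \<and> deg e = deg f - 1" if "d e f \<noteq> 0" for e
        using d_B[OF that f] d_deg[OF that] by simp
      have "(\<lambda>e'. d e' f) = matvec E d (\<lambda>x. \<delta> x f)" using dcol[OF f] by auto
      moreover have "(\<lambda>x. \<delta> x f) \<in> C" using f by (auto simp: C_def \<delta>_def)
      ultimately show "(\<lambda>e'. d e' f) \<in> matvec E d ` C" by blast
    qed
    then show ?thesis by (simp add: matmul_column[of E d] matmul_column[of E \<sigma>] fun_eq_iff)
  qed
  \<comment> \<open>On \<open>B\<close> this is the map 1 - \<sigma> d, whose values are cycles
    because d \<sigma> d = d. In positive degree cycles are boundaries, whence d \<sigma> \<rho> =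
    \<rho> there.\<close>
  define \<rho> where "\<rho> = (\<lambda>e f. \<delta> e f - matmul E \<sigma> d e f)"
  have \<sigma>d_deg: "e \<in> B \<and> deg e = deg f" if "matmul E \<sigma> d e f \<noteq> 0" for e f
  proof -
    from that obtain e' where "\<sigma> e e' * d e' f \<noteq> 0"
      unfolding matmul_def by (rule sum_nonzero_witness)
    then show ?thesis using d_deg[of e' f] by (auto simp: \<sigma>_def split: if_splits)
  qed
  have d\<sigma>\<rho>: "matmul E d (matmul E \<sigma> \<rho>) e f = \<rho> e f" if f: "f \<in> B" "deg f = Suc i" for e f i
  proof -
    let ?g = "\<lambda>e'. \<rho> e' f"
    have supp: "e \<in> B \<and> deg e = Suc i" if "?g e \<noteq> 0" for e
      using that \<sigma>d_deg[of e f] f by (auto simp: \<rho>_def \<delta>_def split: if_splits)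
    have "matvec E d ?g e = 0" for e
      using dcol[OF f(1), of e] d\<sigma>d[OF f(1), of e]
      by (simp add: \<rho>_def matvec_diff matmul_column[of E d])
    from exact[of ?g i, OF supp this] obtain g' where
      "\<forall>e. g' e \<noteq> 0 \<longrightarrow> e \<in> B \<and> deg e = Suc (Suc i)" "matvec E d g' = ?g" by auto
    then have "?g \<in> matvec E d ` C" by (auto simp: C_def image_iff intro!: exI[of _ g'])
    from \<sigma>[of ?g "Suc i", OF supp this] have "matvec E d (matvec E \<sigma> ?g) = ?g" by auto
    then show ?thesis by (simp add: matmul_column[of E d] matmul_column[of E \<sigma>] fun_eq_iff)
  qed
  define h where "h = (\<lambda>e f. if e \<in> B \<and> f \<in> B then \<sigma> e f - matmul E \<sigma> (matmul E \<sigma> d) e f else 0)"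
  \<comment> \<open>With \<open>p\<close> taken as the remainder the homotopy identity holds by
    definition; the content is that \<open>p\<close> lives in degree 0 and satisfies p d =
    0.\<close>
  define p where "p = (\<lambda>e f. if e \<in> B \<and> f \<in> B then \<delta> e f - matmul E d h e f - matmul E h d e f else 0)"
  have \<sigma>0: "\<sigma> e f = 0" if "e \<notin> B" for e f using that by (simp add: \<sigma>_def)
  have h_eq: "h e f = matmul E \<sigma> \<rho> e f" if f: "f \<in> B" for e f
  proof -
    have "matmul E \<sigma> \<rho> e f = matmul E \<sigma> \<delta> e f - matmul E \<sigma> (matmul E \<sigma> d) e f"
      by (simp add: \<rho>_def matmul_diff_right)
    also have "matmul E \<sigma> \<delta> e f = \<sigma> e f"
      using f B by (auto simp: matmul_def \<delta>_def sum_mult_delta[OF E])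
    finally show ?thesis using f \<sigma>0[of e] by (auto simp: h_def matmul_def)
  qed
  have hd: "matmul E h d e f = matmul E \<sigma> d e f" if f: "f \<in> B" for e f
  proof -
    have "matmul E h d e f = matmul E (\<lambda>e f. \<sigma> e f - matmul E \<sigma> (matmul E \<sigma> d) e f) d e f"
      unfolding matmul_def[of E h] matmul_def[of E "\<lambda>e f. \<sigma> e f - matmul E \<sigma> (matmul E \<sigma> d) e f"]
    proof (rule sum.cong)
      fix x assume "x \<in> E"
      show "h e x * d x f = (\<sigma> e x - matmul E \<sigma> (matmul E \<sigma> d) e x) * d x f"
      proof (cases "d x f = 0")
        case False
        then have "x \<in> B" using d_B f by blast
        then show ?thesis using \<sigma>0[of e] by (auto simp: h_def matmul_def)
      qed simp
    qed simp
    also have "\<dots> = matmul E \<sigma> d e f - matmul E (matmul E \<sigma> (matmul E \<sigma> d)) d e f"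
      by (rule matmul_diff_left)
    also have "matmul E (matmul E \<sigma> (matmul E \<sigma> d)) d e f = 0"
    proof -
      have "matmul E d d = (\<lambda>e f. 0)" using dd by (intro ext)
      then have "matmul E (matmul E \<sigma> (matmul E \<sigma> d)) d = (\<lambda>e f. 0)"
        by (simp only: matmul_assoc) (simp add: matmul_def fun_eq_iff)
      then show ?thesis by simp
    qed
    finally show ?thesis by simp
  qed
  have h_deg: "e \<in> B \<and> f \<in> B \<and> deg e = Suc (deg f)" if hn: "h e f \<noteq> 0" for e f
  proof -
    have B': "e \<in> B" "f \<in> B" using hn by (auto simp: h_def split: if_splits)
    then have "matmul E \<sigma> \<rho> e f \<noteq> 0" using hn h_eq[of f e] by simp
    then obtain e' where "\<sigma> e e' * \<rho> e' f \<noteq> 0"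
      unfolding matmul_def by (rule sum_nonzero_witness)
    then show ?thesis
      using \<sigma>d_deg[of e' f] B' by (auto simp: \<rho>_def \<delta>_def \<sigma>_def split: if_splits)
  qed
  have p_deg: "e \<in> B \<and> f \<in> B \<and> deg e = 0 \<and> deg f = 0" if pn: "p e f \<noteq> 0" for e f
  proof -
    have B': "e \<in> B" "f \<in> B" using pn by (auto simp: p_def split: if_splits)
    have "deg f = 0"
    proof (cases "deg f")
      case (Suc i)
      have "matmul E d h e f = matmul E d (matmul E \<sigma> \<rho>) e f"
        unfolding matmul_def[of E d] using h_eq[OF B'(2)] by simp
      then have "p e f = 0"
        using d\<sigma>\<rho>[OF B'(2) Suc, of e] hd[OF B'(2), of e] B' by (simp add: p_def \<rho>_def)
      with pn show ?thesis by simp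
    qed
    have "deg e = deg f"
    proof (rule ccontr)
      assume ne: "deg e \<noteq> deg f"
      have "d e x * h x f = 0" for x
        using ne d_deg[of e x] h_deg[of x f] by (cases "d e x = 0") auto
      then have "matmul E d h e f = 0"
        unfolding matmul_def by (intro sum.neutral ballI)
      moreover have "matmul E h d e f = 0"
        using hd[OF B'(2), of e] \<sigma>d_deg[of e f] ne by auto
      ultimately show False using pn ne by (auto simp: p_def \<delta>_def split: if_splits)
    qed
    with \<open>deg f = 0\<close> B' show ?thesis by simp
  qed
  have pd: "matmul E p d e f = 0" if f: "f \<in> B" for e f
  proof (cases "e \<in> B")
    case True
    \<comment> \<open>Here p d = d - d h d - h d d. The last term is zero, and d h d = d \<sigma> d
      = d because h d = \<sigma> d.\<close>
    have "matmul E p d e f = matmul E (\<lambda>e f. (\<delta> e f - matmul E d h e f) - matmul E h d e f) d e f"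
      unfolding matmul_def[of E p]
        matmul_def[of E "\<lambda>e f. (\<delta> e f - matmul E d h e f) - matmul E h d e f"]
    proof (rule sum.cong)
      fix x assume "x \<in> E"
      show "p e x * d x f = (\<delta> e x - matmul E d h e x - matmul E h d e x) * d x f"
      proof (cases "d x f = 0")
        case False
        then have "x \<in> B" using d_B f by blast
        then show ?thesis using True by (simp add: p_def)
      qed simp
    qed simp
    also have "\<dots> = matmul E \<delta> d e f - matmul E (matmul E d h) d e f - matmul E (matmul E h d) d e f"
      by (simp add: matmul_diff_left)
    also have "matmul E \<delta> d e f = d e f"
      using True B by (auto simp: matmul_def \<delta>_def sum_mult_delta[OF E])
    also have "matmul E (matmul E d h) d e f = d e f"
    proof -
      have "matmul E (matmul E d h) d e f = matmul E d (matmul E h d) e f" by (simp only: matmul_assoc)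
      also have "\<dots> = matmul E d (matmul E \<sigma> d) e f"
        unfolding matmul_def[of E d] using hd[OF f] by simp
      finally show ?thesis using d\<sigma>d[OF f] by simp
    qed
    also have "matmul E (matmul E h d) d e f = 0"
    proof -
      have "matmul E d d = (\<lambda>e f. 0)" using dd by (intro ext)
      then show ?thesis by (simp only: matmul_assoc) (simp add: matmul_def fun_eq_iff)
    qed
    finally show ?thesis by simp
  qed (simp add: matmul_def p_def)
  have "matmul E d h e f + matmul E h d e f = (if e = f then 1 else 0) - p e f"
    if "e \<in> B" "f \<in> B" for e f
    using that by (simp add: p_def \<delta>_def)
  with h_deg p_deg pd show ?thesis by blast
qed

section \<open>Tensor algebras in coordinates\<close>

text \<open>An element of the tensor algebra of a space with basis \<open>E\<close> is a function on words in \<open>E\<close>, and a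
  linear map is given by the values of its image at words \<open>es\<close>. Here \<open>word_diff\<close> is the graded
  derivation extending \<open>d\<close>, \<open>word_htpy\<close> the sum of the maps \<open>p \<otimes> \<dots> \<otimes> p \<otimes> h \<otimes> 1 \<otimes> \<dots> \<otimes> 1\<close>, and
  \<open>word_map\<close> the algebra map extending \<open>p\<close>.\<close>

primrec word_diff :: "'e set \<Rightarrow> ('e \<Rightarrow> nat) \<Rightarrow> ('e \<Rightarrow> 'e \<Rightarrow> 'k::comm_ring_1) \<Rightarrow>
    'e list \<Rightarrow> ('e list \<Rightarrow> 'k) \<Rightarrow> 'k" where
  "word_diff E dg d [] f = 0"
| "word_diff E dg d (e # es) f = (\<Sum>e'\<in>E. d e e' * f (e' # es)) +
     (- 1) ^ dg e * word_diff E dg d es (\<lambda>t. f (e # t))"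

primrec word_htpy :: "'e set \<Rightarrow> ('e \<Rightarrow> 'e \<Rightarrow> 'k::comm_ring_1) \<Rightarrow> ('e \<Rightarrow> 'e \<Rightarrow> 'k) \<Rightarrow>
    'e list \<Rightarrow> ('e list \<Rightarrow> 'k) \<Rightarrow> 'k" where
  "word_htpy E h p [] f = 0"
| "word_htpy E h p (e # es) f = (\<Sum>e'\<in>E. h e e' * f (e' # es)) +
     (\<Sum>e'\<in>E. p e e' * word_htpy E h p es (\<lambda>t. f (e' # t)))"

primrec word_map :: "'e set \<Rightarrow> ('e \<Rightarrow> 'e \<Rightarrow> 'k::comm_ring_1) \<Rightarrow> 'e list \<Rightarrow> ('e list \<Rightarrow> 'k) \<Rightarrow> 'k" where
  "word_map E p [] f = f []"
| "word_map E p (e # es) f = (\<Sum>e'\<in>E. p e e' * word_map E p es (\<lambda>t. f (e' # t)))"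

lemma word_diff_zero [simp]: "word_diff E dg d es (\<lambda>t. 0) = 0"
  by (induction es) auto

lemma word_diff_add: "word_diff E dg d es (\<lambda>t. f t + g t) = word_diff E dg d es f + word_diff E dg d es g"
  by (induction es arbitrary: f g) (auto simp: algebra_simps sum.distrib)

lemma word_diff_scale: "word_diff E dg d es (\<lambda>t. c * f t) = c * word_diff E dg d es f"
  by (induction es arbitrary: f) (auto simp: algebra_simps sum_distrib_left)

lemma word_diff_sum: "word_diff E dg d es (\<lambda>t. \<Sum>i\<in>I. c i * f i t) = (\<Sum>i\<in>I. c i * word_diff E dg d es (f i))"
  by (induction I rule: infinite_finite_induct) (auto simp: word_diff_add word_diff_scale)

lemma word_htpy_zero [simp]: "word_htpy E h p es (\<lambda>t. 0) = 0"
  by (induction es) auto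

lemma word_htpy_add: "word_htpy E h p es (\<lambda>t. f t + g t) = word_htpy E h p es f + word_htpy E h p es g"
  by (induction es arbitrary: f g) (auto simp: algebra_simps sum.distrib)

lemma word_htpy_scale: "word_htpy E h p es (\<lambda>t. c * f t) = c * word_htpy E h p es f"
  by (induction es arbitrary: f) (auto simp: algebra_simps sum_distrib_left)

lemma word_htpy_sum: "word_htpy E h p es (\<lambda>t. \<Sum>i\<in>I. c i * f i t) = (\<Sum>i\<in>I. c i * word_htpy E h p es (f i))"
  by (induction I rule: infinite_finite_induct) (auto simp: word_htpy_add word_htpy_scale)

lemma word_map_zero [simp]: "word_map E p es (\<lambda>t. 0) = 0"
  by (induction es) auto

lemma word_map_add: "word_map E p es (\<lambda>t. f t + g t) = word_map E p es f + word_map E p es g"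
  by (induction es arbitrary: f g) (auto simp: algebra_simps sum.distrib)

lemma word_map_scale: "word_map E p es (\<lambda>t. c * f t) = c * word_map E p es f"
  by (induction es arbitrary: f) (auto simp: algebra_simps sum_distrib_left)

lemma word_map_sum: "word_map E p es (\<lambda>t. \<Sum>i\<in>I. c i * f i t) = (\<Sum>i\<in>I. c i * word_map E p es (f i))"
  by (induction I rule: infinite_finite_induct) (auto simp: word_map_add word_map_scale)

text \<open>\<open>word_map\<close> preserves the length of words, so factors depending only on the
  length pass through it. It will be applied to the factor 1/n! of the symmetrization.\<close>

lemma word_map_length_scale:
  "word_map E p es (\<lambda>t. c (length t) * f t) = c (length es) * word_map E p es f"
proof (induction es arbitrary: c f)
  case (Cons e es)
  show ?case
    using Cons.IH[of "\<lambda>n. c (Suc n)"] by (simp add: sum_distrib_left mult.left_commute)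
qed simp

abbreviation word_deg :: "('e \<Rightarrow> nat) \<Rightarrow> 'e list \<Rightarrow> nat" where
  "word_deg dg es \<equiv> sum_list (map dg es)"

locale word_complex =
  fixes E :: "'e set" and dg :: "'e \<Rightarrow> nat" and d :: "'e \<Rightarrow> 'e \<Rightarrow> 'k::field"
  assumes finite_E: "finite E"
    and d_E: "d e e' \<noteq> 0 \<Longrightarrow> e \<in> E \<and> e' \<in> E \<and> dg e' = Suc (dg e)"
    and d_d: "matmul E d d e e' = 0"
begin

abbreviation "wd \<equiv> word_diff E dg d"

lemma wd_wd: "wd es (\<lambda>t. wd t f) = 0"
proof (induction es arbitrary: f)
  case (Cons e es)
  \<comment> \<open>The letter produced by \<open>d\<close> has the opposite parity; therefore the
    two mixed terms, \<open>d\<close> on the first letter and on the rest in either order,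
    cancel.\<close>
  have sgn: "d e e' * (- 1) ^ dg e' = - ((- 1) ^ dg e * d e e')" for e'
    using d_E[of e e'] by (cases "d e e' = 0") auto
  have "wd (e # es) (\<lambda>t. wd t f) =
      (\<Sum>e'\<in>E. d e e' * (\<Sum>e''\<in>E. d e' e'' * f (e'' # es))) +
      (\<Sum>e'\<in>E. d e e' * (- 1) ^ dg e' * wd es (\<lambda>t. f (e' # t))) +
      (- 1) ^ dg e * (\<Sum>e'\<in>E. d e e' * wd es (\<lambda>t. f (e' # t)))"
    using Cons.IH[of "\<lambda>t. f (e # t)"]
    by (simp add: word_diff_add word_diff_scale word_diff_sum distrib_left sum.distrib mult.assoc)
  also have "(\<Sum>e'\<in>E. d e e' * (\<Sum>e''\<in>E. d e' e'' * f (e'' # es))) =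
      (\<Sum>e''\<in>E. matmul E d d e e'' * f (e'' # es))"
    unfolding matmul_def sum_distrib_left sum_distrib_right by (subst sum.swap) (simp add: mult.assoc)
  finally show ?case by (simp add: d_d sgn sum_distrib_left sum_negf mult.assoc)
qed simp

text \<open>A nonzero coefficient at \<open>es\<close> must come from some word in the support of
  \<open>f\<close>. One witness carries the information on length, degree and position; the set
  \<open>B\<close> is quantified inside so that it can later be any part of the basis closed under
  boundaries.\<close>

lemma wd_witness:
  assumes "wd es f \<noteq> 0"
  shows "\<exists>t. f t \<noteq> 0 \<and> length t = length es \<and> word_deg dg t = Suc (word_deg dg es) \<and>
    (\<forall>B. set t \<subseteq> B \<and> (\<forall>e e'. d e e' \<noteq> 0 \<longrightarrow> e' \<in> B \<longrightarrow> e \<in> B) \<longrightarrow> set es \<subseteq> B)"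
  using assms
proof (induction es arbitrary: f)
  case (Cons e es)
  then consider "(\<Sum>e'\<in>E. d e e' * f (e' # es)) \<noteq> 0" | "wd es (\<lambda>t. f (e # t)) \<noteq> 0"
    by fastforce
  then show ?case
  proof cases
    case 1
    then obtain e' where "e' \<in> E" "d e e' * f (e' # es) \<noteq> 0" by (rule sum_nonzero_witness)
    then show ?thesis using d_E[of e e'] by (intro exI[of _ "e' # es"]) auto
  next
    case 2
    from Cons.IH[OF this] obtain t where "f (e # t) \<noteq> 0" "length t = length es"
      "word_deg dg t = Suc (word_deg dg es)"
      "\<forall>B. set t \<subseteq> B \<and> (\<forall>e e'. d e e' \<noteq> 0 \<longrightarrow> e' \<in> B \<longrightarrow> e \<in> B) \<longrightarrow> set es \<subseteq> B" by blast
    then show ?thesis by (intro exI[of _ "e # t"]) auto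
  qed
qed simp

end

locale word_homotopy = word_complex E dg d
  for E :: "'e set" and dg :: "'e \<Rightarrow> nat" and d :: "'e \<Rightarrow> 'e \<Rightarrow> 'k::field" +
  fixes B :: "'e set" and h p :: "'e \<Rightarrow> 'e \<Rightarrow> 'k"
  assumes B_E: "B \<subseteq> E"
    and h_B: "h e e' \<noteq> 0 \<Longrightarrow> e \<in> B \<and> e' \<in> B \<and> dg e = Suc (dg e')"
    and p_B: "p e e' \<noteq> 0 \<Longrightarrow> e \<in> B \<and> e' \<in> B \<and> dg e = 0 \<and> dg e' = 0"
    and dh_hd: "e \<in> B \<Longrightarrow> e' \<in> B \<Longrightarrow>
      matmul E d h e e' + matmul E h d e e' = (if e = e' then 1 else 0) - p e e'"
    and p_d: "e' \<in> B \<Longrightarrow> matmul E p d e e' = 0"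
begin

abbreviation "wh \<equiv> word_htpy E h p"

lemma wh_witness:
  assumes "wh es f \<noteq> 0"
  shows "\<exists>t. f t \<noteq> 0 \<and> length t = length es \<and> word_deg dg es = Suc (word_deg dg t) \<and>
    (set t \<subseteq> B \<longrightarrow> set es \<subseteq> B)"
  using assms
proof (induction es arbitrary: f)
  case (Cons e es)
  then consider "(\<Sum>e'\<in>E. h e e' * f (e' # es)) \<noteq> 0"
    | "(\<Sum>e'\<in>E. p e e' * wh es (\<lambda>t. f (e' # t))) \<noteq> 0"
    by fastforce
  then show ?case
  proof cases
    case 1
    then obtain e' where "e' \<in> E" "h e e' * f (e' # es) \<noteq> 0" by (rule sum_nonzero_witness)
    then show ?thesis using h_B[of e e'] by (intro exI[of _ "e' # es"]) auto
  next
    case 2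
    then obtain e' where "e' \<in> E" and *: "p e e' * wh es (\<lambda>t. f (e' # t)) \<noteq> 0"
      by (rule sum_nonzero_witness)
    from * Cons.IH[of "\<lambda>t. f (e' # t)"] obtain t where "f (e' # t) \<noteq> 0" "length t = length es"
      "word_deg dg es = Suc (word_deg dg t)" "set t \<subseteq> B \<longrightarrow> set es \<subseteq> B" by auto
    with * p_B[of e e'] show ?thesis by (intro exI[of _ "e' # t"]) auto
  qed
qed simp

text \<open>Induction on the first letter, with H = h \<otimes> 1 + p \<otimes> H. The terms with
  \<open>h\<close> on the first letter and the differential on the rest cancel because
  \<open>h\<close> changes the parity; d p and p d contribute zero; what is left is (1 - p)
  \<otimes> 1 plus p \<otimes> (1 - p \<otimes> ... \<otimes> p), which telescopes.\<close>

lemma word_homotopy: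
  assumes "\<And>t. f t \<noteq> 0 \<Longrightarrow> set t \<subseteq> B" "set es \<subseteq> B"
  shows "wd es (\<lambda>t. wh t f) + wh es (\<lambda>t. wd t f) = f es - word_map E p es f"
  using assms
proof (induction es arbitrary: f)
  case (Cons e es)
  let ?s = "\<lambda>e. (- 1) ^ dg e :: 'k"
  let ?f = "\<lambda>e t. f (e # t)"
  have IH: "wd es (\<lambda>t. wh t (?f e')) + wh es (\<lambda>t. wd t (?f e')) = f (e' # es) - word_map E p es (?f e')" for e'
    using Cons.prems by (intro Cons.IH) force+
  have swap: "(\<Sum>e'\<in>E. a e e' * (\<Sum>e''\<in>E. b e' e'' * u e'')) = (\<Sum>e''\<in>E. matmul E a b e e'' * u e'')"
    for a b :: "'e \<Rightarrow> 'e \<Rightarrow> 'k" and u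
    unfolding matmul_def sum_distrib_left sum_distrib_right by (subst sum.swap) (simp add: mult.assoc)
  have dp: "matmul E d p e e' = 0" for e'
    unfolding matmul_def
  proof (rule sum.neutral, rule ballI)
    fix x show "d e x * p x e' = 0" using d_E[of e x] p_B[of x e'] by (cases "d e x = 0") auto
  qed
  have DH: "wd (e # es) (\<lambda>t. wh t f) =
      (\<Sum>e''\<in>E. matmul E d h e e'' * f (e'' # es)) +
      (\<Sum>e'\<in>E. ?s e * (h e e' * wd es (?f e'))) +
      (\<Sum>e'\<in>E. ?s e * (p e e' * wd es (\<lambda>t. wh t (?f e'))))"
  proof -
    have "wd (e # es) (\<lambda>t. wh t f) =
      (\<Sum>e'\<in>E. d e e' * (\<Sum>e''\<in>E. h e' e'' * f (e'' # es))) +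
      (\<Sum>e'\<in>E. d e e' * (\<Sum>e''\<in>E. p e' e'' * wh es (?f e''))) +
      ?s e * ((\<Sum>e'\<in>E. h e e' * wd es (?f e')) + (\<Sum>e'\<in>E. p e e' * wd es (\<lambda>t. wh t (?f e'))))"
      by (simp add: word_diff_add word_diff_sum distrib_left sum.distrib)
    then show ?thesis unfolding swap[of d h] swap[of d p] dp by (simp add: distrib_left sum_distrib_left)
  qed
  have HD: "wh (e # es) (\<lambda>t. wd t f) =
      (\<Sum>e''\<in>E. matmul E h d e e'' * f (e'' # es)) +
      (\<Sum>e'\<in>E. h e e' * (?s e' * wd es (?f e'))) +
      (\<Sum>e'\<in>E. p e e' * (?s e' * wh es (\<lambda>t. wd t (?f e'))))"
  proof -
    have "wh (e # es) (\<lambda>t. wd t f) =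
      (\<Sum>e'\<in>E. h e e' * (\<Sum>e''\<in>E. d e' e'' * f (e'' # es))) +
      (\<Sum>e'\<in>E. h e e' * (?s e' * wd es (?f e'))) +
      (\<Sum>e'\<in>E. p e e' * (\<Sum>e''\<in>E. d e' e'' * wh es (?f e''))) +
      (\<Sum>e'\<in>E. p e e' * (?s e' * wh es (\<lambda>t. wd t (?f e'))))"
      by (simp add: word_htpy_add word_htpy_sum word_htpy_scale distrib_left sum.distrib)
    also have "(\<Sum>e'\<in>E. p e e' * (\<Sum>e''\<in>E. d e' e'' * wh es (?f e''))) = 0"
      unfolding swap[of p d]
    proof (rule sum.neutral, rule ballI)
      fix x show "matmul E p d e x * wh es (?f x) = 0"
      \<comment> \<open>The relation p d = 0 is available on columns in \<open>B\<close>; at other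
        letters \<open>f\<close> vanishes by its support.\<close>
      proof (cases "x \<in> B")
        case False
        then have "?f x = (\<lambda>t. 0)" using Cons.prems(1) by fastforce
        then show ?thesis by simp
      qed (simp add: p_d)
    qed
    finally show ?thesis by (simp add: swap[of h d])
  qed
  have cross: "?s e * (h e e' * x) + h e e' * (?s e' * x) = 0" for e' x
    using h_B[of e e'] by (cases "h e e' = 0") auto
  have pp: "?s e * (p e e' * x) + p e e' * (?s e' * y) = p e e' * (x + y)" for e' x y
    using p_B[of e e'] by (cases "p e e' = 0") (auto simp: distrib_left)
  have main: "matmul E d h e e'' * f (e'' # es) + matmul E h d e e'' * f (e'' # es) =
      ((if e = e'' then 1 else 0) - p e e'') * f (e'' # es)" for e''
  proof (cases "e'' \<in> B")
    case True
    then show ?thesis using dh_hd[of e e''] Cons.prems(2) by (simp add: distrib_right[symmetric])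
  next
    case False
    then have "f (e'' # es) = 0" using Cons.prems(1) by fastforce
    then show ?thesis by simp
  qed
  have "wd (e # es) (\<lambda>t. wh t f) + wh (e # es) (\<lambda>t. wd t f) =
      (\<Sum>e''\<in>E. (matmul E d h e e'' * f (e'' # es) + matmul E h d e e'' * f (e'' # es)) +
        (?s e * (h e e'' * wd es (?f e'')) + h e e'' * (?s e'' * wd es (?f e''))) +
        (?s e * (p e e'' * wd es (\<lambda>t. wh t (?f e''))) + p e e'' * (?s e'' * wh es (\<lambda>t. wd t (?f e'')))))"
    unfolding DH HD by (simp add: sum.distrib algebra_simps)
  also have "\<dots> = (\<Sum>e''\<in>E. (if e = e'' then 1 else 0) * f (e'' # es) - p e e'' * word_map E p es (?f e''))"
    unfolding main cross pp IH by (rule sum.cong) (auto simp: algebra_simps)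
  also have "\<dots> = f (e # es) - word_map E p (e # es) f"
    using Cons.prems(2) B_E by (auto simp: sum_subtractf sum_mult_delta[OF finite_E])
  finally show ?case .
qed simp

end

section \<open>Derivations of polynomial rings\<close>

definition poly_carrier :: "'m set \<Rightarrow> (('m \<Rightarrow>\<^sub>0 nat) \<Rightarrow>\<^sub>0 'k::comm_ring_1) set" where
  "poly_carrier S = {p. \<forall>m \<in> Poly_Mapping.keys p. Poly_Mapping.keys m \<subseteq> S}"

lemma poly_mapping_sum_single:
  "p = (\<Sum>m\<in>Poly_Mapping.keys p. Poly_Mapping.single m (Poly_Mapping.lookup p m))"
  by (rule poly_mapping_eqI)
    (auto simp: lookup_sum lookup_single when_def in_keys_iff sum.delta)

lemma keys_monomial_add:
  fixes m n :: "'m \<Rightarrow>\<^sub>0 nat"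
  shows "Poly_Mapping.keys (m + n) = Poly_Mapping.keys m \<union> Poly_Mapping.keys n"
  by (auto simp: in_keys_iff lookup_add)

lemma poly_carrier_add: "p \<in> poly_carrier S \<Longrightarrow> q \<in> poly_carrier S \<Longrightarrow> p + q \<in> poly_carrier S"
  unfolding poly_carrier_def using keys_add[of p q] by blast

lemma poly_carrier_uminus: "p \<in> poly_carrier S \<Longrightarrow> - p \<in> poly_carrier S"
  by (auto simp: poly_carrier_def in_keys_iff)

lemma poly_carrier_diff: "p \<in> poly_carrier S \<Longrightarrow> q \<in> poly_carrier S \<Longrightarrow> p - q \<in> poly_carrier S"
  using poly_carrier_add[of p S "- q"] poly_carrier_uminus[of q S] by simp

lemma poly_carrier_mult: "p \<in> poly_carrier S \<Longrightarrow> q \<in> poly_carrier S \<Longrightarrow> p * q \<in> poly_carrier S"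
  unfolding poly_carrier_def using keys_mult[of p q] by (fastforce simp: keys_monomial_add)

lemma poly_carrier_zero [simp]: "0 \<in> poly_carrier S"
  and poly_carrier_one [simp]: "1 \<in> poly_carrier S"
  by (auto simp: poly_carrier_def)

lemma poly_carrier_const [simp]: "poly_const c \<in> poly_carrier S"
  by (auto simp: poly_carrier_def poly_const_def)

lemma poly_carrier_var [simp]: "w \<in> S \<Longrightarrow> poly_var w \<in> poly_carrier S"
  by (auto simp: poly_carrier_def poly_var_def)

lemma poly_carrier_sum: "(\<And>i. i \<in> I \<Longrightarrow> p i \<in> poly_carrier S) \<Longrightarrow> sum p I \<in> poly_carrier S"
  by (induction I rule: infinite_finite_induct) (auto simp: poly_carrier_add)

lemma poly_const_zero [simp]: "poly_const 0 = 0"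
  and poly_const_one [simp]: "poly_const 1 = 1"
  and poly_const_add: "poly_const (a + b) = poly_const a + poly_const b"
  and poly_const_mult: "poly_const (a * b) = poly_const a * poly_const b"
  by (simp_all add: poly_const_def single_add mult_single)

lemma poly_const_sum: "poly_const (\<Sum>i\<in>I. c i) = (\<Sum>i\<in>I. poly_const (c i))"
  by (induction I rule: infinite_finite_induct) (auto simp: poly_const_add)

lemma poly_const_of_nat: "poly_const (of_nat n) = of_nat n"
  by (induction n) (auto simp: poly_const_add)

text \<open>Induction on the total degree of a monomial, then on the number of monomials. It reduces
  statements on derivations to the Leibniz rule for one variable times a polynomial.\<close>

lemma poly_carrier_induct [consumes 1, case_names const var add]:
  assumes "p \<in> poly_carrier S"
    and const: "\<And>c. P (poly_const c)"
    and var: "\<And>w p. w \<in> S \<Longrightarrow> p \<in> poly_carrier S \<Longrightarrow> P p \<Longrightarrow> P (poly_var w * p)"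
    and add: "\<And>p q. p \<in> poly_carrier S \<Longrightarrow> q \<in> poly_carrier S \<Longrightarrow> P p \<Longrightarrow> P q \<Longrightarrow> P (p + q)"
  shows "P p"
proof -
  have mono: "P (Poly_Mapping.single m c)" if "Poly_Mapping.keys m \<subseteq> S" for m c
    using that
  proof (induction "\<Sum>w\<in>Poly_Mapping.keys m. Poly_Mapping.lookup m w" arbitrary: m rule: less_induct)
    case less
    show ?case
    proof (cases "m = 0")
      case True
      then show ?thesis using const[of c] by (simp add: poly_const_def)
    next
      case False
      then obtain w where w: "w \<in> Poly_Mapping.keys m"
        by (metis lookup_zero not_in_keys_iff_lookup_eq_zero poly_mapping_eqI)
      define m' where "m' = m - Poly_Mapping.single w 1"
      have m: "m = Poly_Mapping.single w 1 + m'"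
        using w by (intro poly_mapping_eqI)
          (auto simp: m'_def lookup_add lookup_minus lookup_single when_def in_keys_iff)
      have keys: "Poly_Mapping.keys m' \<subseteq> Poly_Mapping.keys m" by (subst m) (auto simp: keys_monomial_add)
      have "(\<Sum>w\<in>Poly_Mapping.keys m'. Poly_Mapping.lookup m' w) = (\<Sum>w\<in>Poly_Mapping.keys m. Poly_Mapping.lookup m' w)"
        by (rule sum.mono_neutral_left) (use keys in \<open>auto simp: in_keys_iff\<close>)
      also have "\<dots> < (\<Sum>w\<in>Poly_Mapping.keys m. Poly_Mapping.lookup m w)"
      proof (rule sum_strict_mono_ex1)
        show "\<forall>x\<in>Poly_Mapping.keys m. Poly_Mapping.lookup m' x \<le> Poly_Mapping.lookup m x"
          by (simp add: m'_def lookup_minus)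
        show "\<exists>x\<in>Poly_Mapping.keys m. Poly_Mapping.lookup m' x < Poly_Mapping.lookup m x"
          using w by (intro bexI[of _ w]) (auto simp: m'_def lookup_minus in_keys_iff)
      qed simp
      finally have "P (Poly_Mapping.single m' c)"
        using less keys by blast
      moreover have "Poly_Mapping.single m c = poly_var w * Poly_Mapping.single m' c"
        by (subst m) (simp add: poly_var_def mult_single)
      moreover have "Poly_Mapping.single m' c \<in> poly_carrier S"
        using keys less.prems by (auto simp: poly_carrier_def split: if_splits)
      ultimately show ?thesis using var[of w] w less.prems by auto
    qed
  qed
  have "P (\<Sum>m\<in>M. Poly_Mapping.single m (Poly_Mapping.lookup p m)) \<and>
      (\<Sum>m\<in>M. Poly_Mapping.single m (Poly_Mapping.lookup p m)) \<in> poly_carrier S"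
    if "M \<subseteq> Poly_Mapping.keys p" "finite M" for M
    using that(2,1)
  proof (induction M)
    case empty
    show ?case using const[of 0] by simp
  next
    case (insert m M)
    have m: "Poly_Mapping.keys m \<subseteq> S" using insert.prems assms(1) by (auto simp: poly_carrier_def)
    then have "Poly_Mapping.single m (Poly_Mapping.lookup p m) \<in> poly_carrier S"
      by (auto simp: poly_carrier_def split: if_splits)
    with insert mono[OF m] add show ?case by (auto intro: poly_carrier_add)
  qed
  from this[of "Poly_Mapping.keys p"] show ?thesis
    using poly_mapping_sum_single[of p] by simp
qed

lemma poly_induct [case_names const var add]:
  assumes "\<And>c. P (poly_const c)" "\<And>w p. P p \<Longrightarrow> P (poly_var w * p)" "\<And>p q. P p \<Longrightarrow> P q \<Longrightarrow> P (p + q)"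
  shows "P p"
proof -
  have "p \<in> poly_carrier UNIV" by (simp add: poly_carrier_def)
  then show ?thesis by (induction rule: poly_carrier_induct) (use assms in auto)
qed

text \<open>The vector field with constant coefficients \<Sum> \<phi>(w) d/dX_w. If \<phi> is
  linear, it is the lift to polynomials of the contraction of a symmetric tensor with
  \<phi>.\<close>

definition derivation :: "('m \<Rightarrow> 'k::comm_ring_1) \<Rightarrow> (('m \<Rightarrow>\<^sub>0 nat) \<Rightarrow>\<^sub>0 'k) \<Rightarrow> (('m \<Rightarrow>\<^sub>0 nat) \<Rightarrow>\<^sub>0 'k)" where
  "derivation \<phi> p = (\<Sum>m\<in>Poly_Mapping.keys p. \<Sum>w\<in>Poly_Mapping.keys m.
     Poly_Mapping.single (m - Poly_Mapping.single w 1)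
       (Poly_Mapping.lookup p m * of_nat (Poly_Mapping.lookup m w) * \<phi> w))"

lemma derivation_add: "derivation \<phi> (p + q) = derivation \<phi> p + derivation \<phi> q"
  unfolding derivation_def
  by (rule setsum_keys_plus_distrib) (auto simp: algebra_simps single_add sum.distrib)

lemma derivation_single:
  assumes "finite S" "Poly_Mapping.keys m \<subseteq> S"
  shows "derivation \<phi> (Poly_Mapping.single m c) = (\<Sum>w\<in>S.
     Poly_Mapping.single (m - Poly_Mapping.single w 1) (c * of_nat (Poly_Mapping.lookup m w) * \<phi> w))"
proof -
  have "derivation \<phi> (Poly_Mapping.single m c) = (\<Sum>w\<in>Poly_Mapping.keys m.
     Poly_Mapping.single (m - Poly_Mapping.single w 1) (c * of_nat (Poly_Mapping.lookup m w) * \<phi> w))"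
    by (cases "c = 0") (simp_all add: derivation_def)
  also have "\<dots> = (\<Sum>w\<in>S.
     Poly_Mapping.single (m - Poly_Mapping.single w 1) (c * of_nat (Poly_Mapping.lookup m w) * \<phi> w))"
    by (rule sum.mono_neutral_left) (use assms in \<open>auto simp: in_keys_iff\<close>)
  finally show ?thesis .
qed

lemma derivation_const [simp]: "derivation \<phi> (poly_const c) = 0"
  unfolding poly_const_def by (subst derivation_single[of "{}"]) auto

lemma derivation_zero [simp]: "derivation \<phi> 0 = 0"
  using derivation_const[of \<phi> 0] by simp

lemma derivation_var_mult:
  "derivation \<phi> (poly_var w * p) = poly_const (\<phi> w) * p + poly_var w * derivation \<phi> p"
proof -
  have mono: "derivation \<phi> (poly_var w * Poly_Mapping.single m c) =
    poly_const (\<phi> w) * Poly_Mapping.single m c + poly_var w * derivation \<phi> (Poly_Mapping.single m c)" for m c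
  proof -
    let ?S = "insert w (Poly_Mapping.keys m)"
    let ?m = "Poly_Mapping.single w 1 + m"
    have "derivation \<phi> (poly_var w * Poly_Mapping.single m c) = (\<Sum>v\<in>?S.
       Poly_Mapping.single (?m - Poly_Mapping.single v 1) (c * of_nat (Poly_Mapping.lookup ?m v) * \<phi> v))"
      unfolding poly_var_def mult_single mult_1_left
      by (rule derivation_single) (auto simp: keys_monomial_add)
    also have "\<dots> = (\<Sum>v\<in>?S. (if v = w then Poly_Mapping.single m (c * \<phi> w) else 0) +
       poly_var w * Poly_Mapping.single (m - Poly_Mapping.single v 1) (c * of_nat (Poly_Mapping.lookup m v) * \<phi> v))"
    proof (rule sum.cong)
      fix v
      have 1: "?m - Poly_Mapping.single w 1 = m" by (rule poly_mapping_eqI) (simp add: lookup_minus lookup_add)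
      show "Poly_Mapping.single (?m - Poly_Mapping.single v 1) (c * of_nat (Poly_Mapping.lookup ?m v) * \<phi> v) =
        (if v = w then Poly_Mapping.single m (c * \<phi> w) else 0) +
        poly_var w * Poly_Mapping.single (m - Poly_Mapping.single v 1) (c * of_nat (Poly_Mapping.lookup m v) * \<phi> v)"
      \<comment> \<open>Subtraction of exponents is truncated, but exactly where it truncates in
        \<open>m\<close> the coefficient is zero.\<close>
      proof (cases "Poly_Mapping.lookup m v = 0")
        case True
        then show ?thesis by (auto simp: lookup_add lookup_single 1)
      next
        case False
        then have "?m - Poly_Mapping.single v 1 = Poly_Mapping.single w 1 + (m - Poly_Mapping.single v 1)"
          by (intro poly_mapping_eqI) (auto simp: lookup_add lookup_minus lookup_single when_def)
        with 1 False show ?thesis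
          by (auto simp: lookup_add lookup_single poly_var_def mult_single algebra_simps
              simp flip: single_add)
      qed
    qed simp
    also have "\<dots> = Poly_Mapping.single m (c * \<phi> w) + poly_var w * derivation \<phi> (Poly_Mapping.single m c)"
      by (subst derivation_single[of ?S]) (auto simp: sum.distrib sum_distrib_left)
    finally show ?thesis by (simp add: poly_const_def mult_single mult.commute)
  qed
  have "derivation \<phi> (poly_var w * (\<Sum>m\<in>M. Poly_Mapping.single m (Poly_Mapping.lookup p m))) =
    poly_const (\<phi> w) * (\<Sum>m\<in>M. Poly_Mapping.single m (Poly_Mapping.lookup p m)) +
    poly_var w * derivation \<phi> (\<Sum>m\<in>M. Poly_Mapping.single m (Poly_Mapping.lookup p m))" if "finite M" for M
    using that by (induction M) (simp_all add: distrib_left derivation_add mono)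
  from this[of "Poly_Mapping.keys p"] show ?thesis
    using poly_mapping_sum_single[of p] by simp
qed

lemma derivation_const_mult: "derivation \<phi> (poly_const c * p) = poly_const c * derivation \<phi> p"
proof (induction p rule: poly_induct)
  case (const a)
  show ?case unfolding poly_const_mult[symmetric] by simp
next
  case (var w p)
  have "derivation \<phi> (poly_const c * (poly_var w * p)) = derivation \<phi> (poly_var w * (poly_const c * p))"
    by (simp add: ac_simps)
  also have "\<dots> = poly_const c * derivation \<phi> (poly_var w * p)"
    by (simp only: derivation_var_mult var) (simp add: algebra_simps)
  finally show ?case .
qed (simp add: distrib_left derivation_add)

text \<open>Linearity in the functional. It lets a row of a matrix act on polynomials as one
  contraction instead of a sum over coordinates.\<close>

lemma derivation_functional_sum:
  "derivation (\<lambda>w. \<Sum>i\<in>I. c i * \<phi> i w) p = (\<Sum>i\<in>I. poly_const (c i) * derivation (\<phi> i) p)"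
proof (induction p rule: poly_induct)
  case (var w p)
  have "derivation (\<lambda>w. \<Sum>i\<in>I. c i * \<phi> i w) (poly_var w * p) =
    (\<Sum>i\<in>I. poly_const (c i) * poly_const (\<phi> i w)) * p +
    poly_var w * (\<Sum>i\<in>I. poly_const (c i) * derivation (\<phi> i) p)"
    by (simp add: derivation_var_mult var poly_const_sum poly_const_mult)
  also have "\<dots> = (\<Sum>i\<in>I. poly_const (c i) * derivation (\<phi> i) (poly_var w * p))"
    by (simp only: derivation_var_mult)
      (simp add: sum_distrib_left sum_distrib_right algebra_simps sum.distrib)
  finally show ?case .
qed (simp_all add: derivation_add algebra_simps sum.distrib)

definition const_term :: "(('m \<Rightarrow>\<^sub>0 nat) \<Rightarrow>\<^sub>0 'k::comm_ring_1) \<Rightarrow> 'k" where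
  "const_term p = Poly_Mapping.lookup p 0"

lemma const_term_add [simp]: "const_term (p + q) = const_term p + const_term q"
  by (simp add: const_term_def lookup_add)

lemma const_term_const [simp]: "const_term (poly_const c) = c"
  by (simp add: const_term_def poly_const_def)

lemma const_term_zero [simp]: "const_term 0 = 0"
  by (simp add: const_term_def)

lemma const_term_const_mult [simp]: "const_term (poly_const c * p) = c * const_term p"
proof -
  have "poly_const c * p = Poly_Mapping.map ((*) c) p"
    by (simp add: poly_const_def mult_map_scale_conv_mult)
  then show ?thesis by (simp add: const_term_def map.rep_eq when_def)
qed

lemma const_term_var_mult [simp]:
  fixes w :: 'm and p :: "('m \<Rightarrow>\<^sub>0 nat) \<Rightarrow>\<^sub>0 'k::comm_ring_1"
  shows "const_term (poly_var w * p) = 0"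
proof -
  have "0 \<notin> Poly_Mapping.keys (poly_var w * p)"
  proof
    assume "0 \<in> Poly_Mapping.keys (poly_var w * p)"
    then obtain m where m: "(0 :: 'm \<Rightarrow>\<^sub>0 nat) = Poly_Mapping.single w 1 + m"
      using keys_mult[of "poly_var w" p] by (auto simp: poly_var_def split: if_splits)
    have "w \<in> Poly_Mapping.keys (Poly_Mapping.single w 1 + m)" by (simp add: keys_monomial_add)
    then show False unfolding m[symmetric] by simp
  qed
  then show ?thesis by (simp add: const_term_def in_keys_iff)
qed

text \<open>Homogeneous polynomials of degree \<open>n\<close> with variables in \<open>S\<close>,
  generated inductively so that Euler's formula and degree counts become rule inductions.\<close>

inductive homog :: "'m set \<Rightarrow> nat \<Rightarrow> (('m \<Rightarrow>\<^sub>0 nat) \<Rightarrow>\<^sub>0 'k::comm_ring_1) \<Rightarrow> bool" for S where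
  homog_zero: "homog S n 0"
| homog_const: "homog S 0 (poly_const c)"
| homog_var: "w \<in> S \<Longrightarrow> homog S n p \<Longrightarrow> homog S (Suc n) (poly_var w * p)"
| homog_add: "homog S n p \<Longrightarrow> homog S n q \<Longrightarrow> homog S n (p + q)"

lemma homog_carrier: "homog S n p \<Longrightarrow> p \<in> poly_carrier S"
  by (induction rule: homog.induct) (auto intro: poly_carrier_add poly_carrier_mult)

lemma homog_const_mult: "homog S n p \<Longrightarrow> homog S n (poly_const c * p)"
proof (induction rule: homog.induct)
  case (homog_const a)
  then show ?case using homog.homog_const[of S "c * a"] by (simp add: poly_const_mult)
next
  case (homog_var w n p)
  then show ?case using homog.homog_var[of w S n "poly_const c * p"] by (simp add: mult.left_commute)
qed (auto simp: distrib_left intro: homog.intros)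

lemma derivation_homog:
  "homog S n p \<Longrightarrow> (n = 0 \<longrightarrow> derivation \<phi> p = 0) \<and> (\<forall>m. n = Suc m \<longrightarrow> homog S m (derivation \<phi> p))"
proof (induction rule: homog.induct)
  case (homog_var w n p)
  have "homog S n (poly_const (\<phi> w) * p)" using homog_var by (intro homog_const_mult)
  moreover have "homog S n (poly_var w * derivation \<phi> p)"
  proof (cases n)
    case 0
    then show ?thesis using homog_var.IH by (simp add: homog.homog_zero)
  next
    case (Suc m)
    then show ?thesis using homog_var by (auto intro: homog.homog_var)
  qed
  ultimately show ?case by (auto simp: derivation_var_mult intro: homog.homog_add)
qed (auto simp: derivation_add intro: homog.intros)

text \<open>Every polynomial is a finite sum of homogeneous ones; multiplying by a variable shifts
  the index set of such a decomposition by one.\<close>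

lemma poly_carrier_homog_induct [consumes 1, case_names homog add]:
  assumes "p \<in> poly_carrier S"
    and homog: "\<And>n p. homog S n p \<Longrightarrow> P p"
    and add: "\<And>p q. p \<in> poly_carrier S \<Longrightarrow> q \<in> poly_carrier S \<Longrightarrow> P p \<Longrightarrow> P q \<Longrightarrow> P (p + q)"
  shows "P p"
proof -
  have "\<exists>F I. finite I \<and> (\<forall>i\<in>I. homog S (i :: nat) (F i)) \<and> p = sum F I"
    using assms(1)
  proof (induction rule: poly_carrier_induct)
    case (const c)
    show ?case by (intro exI[of _ "\<lambda>_. poly_const c"] exI[of _ "{0}"]) (auto intro: homog.intros)
  next
    case (var w p)
    then obtain F I where F: "finite I" "\<And>i. i \<in> I \<Longrightarrow> homog S i (F i)" "p = sum F I" by blast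
    have "poly_var w * p = (\<Sum>i\<in>Suc ` I. poly_var w * F (i - 1))"
      by (subst sum.reindex) (auto simp: F(3) sum_distrib_left)
    with F var show ?case
      by (intro exI[of _ "\<lambda>i. poly_var w * F (i - 1)"] exI[of _ "Suc ` I"]) (auto intro: homog.intros)
  next
    case (add p q)
    then obtain F I G J where F: "finite I" "\<And>i. i \<in> I \<Longrightarrow> homog S i (F i)" "p = sum F I"
      and G: "finite J" "\<And>i. i \<in> J \<Longrightarrow> homog S i (G i)" "q = sum G J" by blast
    let ?F = "\<lambda>i. (if i \<in> I then F i else 0) + (if i \<in> J then G i else 0)"
    have "(\<Sum>i\<in>I \<union> J. if i \<in> I then F i else 0) = sum F I"
      and "(\<Sum>i\<in>I \<union> J. if i \<in> J then G i else 0) = sum G J"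
      using F(1) G(1) by (auto simp: sum.If_cases Int_absorb1)
    then have "p + q = sum ?F (I \<union> J)" using F(3) G(3) by (simp add: sum.distrib)
    with F G show ?case
      by (intro exI[of _ ?F] exI[of _ "I \<union> J"]) (auto intro!: homog.intros(1,4))
  qed
  then obtain F I where F: "finite I" "\<And>i. i \<in> I \<Longrightarrow> homog S (i :: nat) (F i)" "p = sum F I" by blast
  have "sum F I \<in> poly_carrier S \<and> P (sum F I)"
    using F(1,2)
    by (induction I) (auto intro: homog[OF homog.homog_zero] homog homog_carrier add poly_carrier_add)
  with F(3) show ?thesis by simp
qed

section \<open>Polarization\<close>

text \<open>The coefficients of the symmetrization of \<open>p\<close> in the tensor algebra, before the division
  by factorials: iterated derivatives evaluated at the origin.\<close>

primrec polar :: "('e \<Rightarrow> 'm \<Rightarrow> 'k::comm_ring_1) \<Rightarrow> 'e list \<Rightarrow> (('m \<Rightarrow>\<^sub>0 nat) \<Rightarrow>\<^sub>0 'k) \<Rightarrow> 'k" where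
  "polar co [] p = const_term p"
| "polar co (e # es) p = polar co es (derivation (co e) p)"

lemma polar_add: "polar co es (p + q) = polar co es p + polar co es q"
  by (induction es arbitrary: p q) (auto simp: derivation_add)

lemma polar_const_mult: "polar co es (poly_const c * p) = c * polar co es p"
  by (induction es arbitrary: p) (auto simp: derivation_const_mult)

lemma polar_zero [simp]: "polar co es 0 = 0"
  using polar_const_mult[of co es 0 0] by simp

lemma polar_sum: "polar co es (sum p I) = (\<Sum>i\<in>I. polar co es (p i))"
  by (induction I rule: infinite_finite_induct) (auto simp: polar_add)

text \<open>With fewer than \<open>n\<close> derivatives no constant term is left, with more the
  result is zero.\<close>

lemma polar_homog:
  assumes "homog S n p" "length es \<noteq> n"
  shows "polar co es p = 0"
  using assms
proof (induction es arbitrary: p n)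
  case Nil
  have "n \<noteq> 0 \<longrightarrow> const_term p = 0" using Nil(1)
    by (induction rule: homog.induct) auto
  with Nil(2) show ?case by simp
next
  case (Cons e es)
  show ?case
  proof (cases n)
    case 0
    then show ?thesis using derivation_homog[OF Cons.prems(1)] by simp
  next
    case (Suc m)
    then show ?thesis using derivation_homog[OF Cons.prems(1)] Cons.prems(2) Cons.IH by auto
  qed
qed

text \<open>The multiplication map on tensors of length \<open>n\<close>, lifted from the symmetric
  algebra to polynomials in the basis elements.\<close>

primrec word_poly :: "'m set \<Rightarrow> nat \<Rightarrow> ('m list \<Rightarrow> 'k::comm_ring_1) \<Rightarrow> (('m \<Rightarrow>\<^sub>0 nat) \<Rightarrow>\<^sub>0 'k)" where
  "word_poly E 0 f = poly_const (f [])"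
| "word_poly E (Suc n) f = (\<Sum>e\<in>E. poly_var e * word_poly E n (\<lambda>t. f (e # t)))"

lemma word_poly_add: "word_poly E n (\<lambda>t. f t + g t) = word_poly E n f + word_poly E n g"
  by (induction n arbitrary: f g) (auto simp: poly_const_add distrib_left sum.distrib)

lemma word_poly_scale: "word_poly E n (\<lambda>t. c * f t) = poly_const c * word_poly E n f"
  by (induction n arbitrary: f) (auto simp: poly_const_mult sum_distrib_left mult.left_commute)

lemma word_poly_zero: "(\<And>t. length t = n \<Longrightarrow> f t = 0) \<Longrightarrow> word_poly E n f = 0"
  by (induction n arbitrary: f) auto

lemma word_poly_cong: "(\<And>t. length t = n \<Longrightarrow> f t = g t) \<Longrightarrow> word_poly E n f = word_poly E n g"
proof (induction n arbitrary: f g)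
  case (Suc n)
  have "word_poly E n (\<lambda>t. f (e # t)) = word_poly E n (\<lambda>t. g (e # t))" for e
    by (rule Suc.IH) (simp add: Suc.prems)
  then show ?case by simp
qed simp

lemma word_poly_sum: "word_poly E n (\<lambda>t. \<Sum>i\<in>I. c i * f i t) = (\<Sum>i\<in>I. poly_const (c i) * word_poly E n (f i))"
  by (induction I rule: infinite_finite_induct) (auto simp: word_poly_add word_poly_scale word_poly_zero)

lemma word_poly_carrier: "E \<subseteq> S \<Longrightarrow> word_poly E n f \<in> poly_carrier S"
  by (induction n arbitrary: f) (auto intro!: poly_carrier_sum poly_carrier_mult)

section \<open>Symmetric algebras as quotients of polynomial rings\<close>

lemma free_comm_algebra_simps [simp]:
  "carrier (free_comm_algebra S) = poly_carrier S"
  "p \<oplus>\<^bsub>free_comm_algebra S\<^esub> q = p + q"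
  "p \<otimes>\<^bsub>free_comm_algebra S\<^esub> q = p * q"
  "\<zero>\<^bsub>free_comm_algebra S\<^esub> = 0"
  "\<one>\<^bsub>free_comm_algebra S\<^esub> = 1"
  by (simp_all add: free_comm_algebra_def poly_carrier_def ring_of_type_algebra_def)

lemma cring_free_comm_algebra: "cring (free_comm_algebra S :: (('m \<Rightarrow>\<^sub>0 nat) \<Rightarrow>\<^sub>0 'k::comm_ring_1) ring)"
proof (rule cringI)
  show "abelian_group (free_comm_algebra S :: (('m \<Rightarrow>\<^sub>0 nat) \<Rightarrow>\<^sub>0 'k) ring)"
  proof (rule abelian_groupI, goal_cases)
    case (6 p)
    then show ?case by (intro bexI[of _ "- p"]) (auto intro: poly_carrier_uminus)
  qed (auto intro: poly_carrier_add simp: ac_simps)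
  show "comm_monoid (free_comm_algebra S :: (('m \<Rightarrow>\<^sub>0 nat) \<Rightarrow>\<^sub>0 'k) ring)"
    by unfold_locales (auto intro: poly_carrier_mult simp: ac_simps)
qed (auto simp: distrib_right)

lemma free_comm_algebra_uminus:
  fixes p :: "('m \<Rightarrow>\<^sub>0 nat) \<Rightarrow>\<^sub>0 'k::comm_ring_1"
  assumes "p \<in> poly_carrier S"
  shows "\<ominus>\<^bsub>free_comm_algebra S\<^esub> p = - p"
proof -
  interpret cring "free_comm_algebra S :: (('m \<Rightarrow>\<^sub>0 nat) \<Rightarrow>\<^sub>0 'k) ring" by (rule cring_free_comm_algebra)
  show ?thesis
    using minus_equality[of "- p" p] assms poly_carrier_uminus[OF assms] by simp
qed

text \<open>The functionals \<open>co\<close> split, linearly, the map that sends a family of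
  coefficients on the finite set \<open>E0\<close> to its linear combination in \<open>W\<close>.
  All computations in the symmetric algebra go through these coordinates, although its polynomial
  ring has a variable for every element of \<open>W\<close>.\<close>

locale sym_words =
  fixes W :: "('k::field_char_0, 'm::ab_group_add) module"
    and sc :: "'k \<Rightarrow> 'm \<Rightarrow> 'm"
    and E0 :: "'m set"
    and co :: "'m \<Rightarrow> 'm \<Rightarrow> 'k"
  assumes W_add: "v \<oplus>\<^bsub>W\<^esub> w = v + w"
    and W_smult: "c \<odot>\<^bsub>W\<^esub> w = sc c w"
    and sc_zero: "sc 0 v = 0"
    and W_zero: "0 \<in> carrier W"
    and W_closed_add: "v \<in> carrier W \<Longrightarrow> w \<in> carrier W \<Longrightarrow> v + w \<in> carrier W"
    and W_closed_scale: "v \<in> carrier W \<Longrightarrow> sc c v \<in> carrier W"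
    and E0: "finite E0" "E0 \<subseteq> carrier W"
    and co_add: "v \<in> carrier W \<Longrightarrow> w \<in> carrier W \<Longrightarrow> co e (v + w) = co e v + co e w"
    and co_scale: "v \<in> carrier W \<Longrightarrow> co e (sc c v) = c * co e v"
    and co_expand: "v \<in> carrier W \<Longrightarrow> (\<Sum>e\<in>E0. sc (co e v) e) = v"
    and co_outside: "e \<notin> E0 \<Longrightarrow> co e v = 0"
begin

definition R :: "(('m \<Rightarrow>\<^sub>0 nat) \<Rightarrow>\<^sub>0 'k) ring" where "R = free_comm_algebra (carrier W)"
abbreviation I where "I \<equiv> linear_ideal W"
abbreviation car where "car \<equiv> poly_carrier (carrier W)"
definition \<pi> where "\<pi> p = I +>\<^bsub>R\<^esub> p"

lemma R_simps [simp]: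
  "carrier R = car" "p \<oplus>\<^bsub>R\<^esub> q = p + q" "p \<otimes>\<^bsub>R\<^esub> q = p * q" "\<zero>\<^bsub>R\<^esub> = 0" "\<one>\<^bsub>R\<^esub> = 1"
  by (simp_all add: R_def)

sublocale R: cring R unfolding R_def by (rule cring_free_comm_algebra)

lemma R_minus [simp]: "p \<in> car \<Longrightarrow> q \<in> car \<Longrightarrow> p \<ominus>\<^bsub>R\<^esub> q = p - q"
  by (simp add: a_minus_def free_comm_algebra_uminus R_def)

lemma relations_car: "linear_relations W \<subseteq> carrier R"
  by (auto simp: linear_relations_def W_add W_smult W_closed_add W_closed_scale
      intro!: poly_carrier_diff poly_carrier_mult)

sublocale I: ideal I R
  using R.genideal_ideal[OF relations_car] by (simp add: linear_ideal_def R_def)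

lemma I_zero: "0 \<in> I" using I.zero_closed by simp
lemma I_add: "p \<in> I \<Longrightarrow> q \<in> I \<Longrightarrow> p + q \<in> I" using I.a_closed[of p q] by simp
lemma I_mult: "p \<in> I \<Longrightarrow> q \<in> car \<Longrightarrow> q * p \<in> I" using I.I_l_closed[of p q] by simp
lemma I_car: "p \<in> I \<Longrightarrow> p \<in> car" using I.Icarr[of p] by simp
lemma I_minus: "p \<in> I \<Longrightarrow> - p \<in> I"
  using I_mult[of p "- 1"] poly_carrier_uminus[of 1 "carrier W"] by simp
lemma I_sum: "(\<And>i. i \<in> J \<Longrightarrow> p i \<in> I) \<Longrightarrow> sum p J \<in> I"
  by (induction J rule: infinite_finite_induct) (auto simp: I_zero I_add)

lemma relations_I: "linear_relations W \<subseteq> I"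
  using R.genideal_self[OF relations_car] by (simp add: linear_ideal_def R_def)

lemma var_add_I: "v \<in> carrier W \<Longrightarrow> w \<in> carrier W \<Longrightarrow> poly_var (v + w) - poly_var v - poly_var w \<in> I"
  using relations_I by (force simp: linear_relations_def W_add)

lemma var_scale_I: "v \<in> carrier W \<Longrightarrow> poly_var (sc c v) - poly_const c * poly_var v \<in> I"
  using relations_I by (force simp: linear_relations_def W_smult)

lemma var_zero_I: "poly_var 0 \<in> I"
  using var_scale_I[OF W_zero, of 0] by (simp add: sc_zero)

lemma var_sum_I:
  assumes "finite J" "J \<subseteq> carrier W"
  shows "(\<Sum>e\<in>J. sc (c e) e) \<in> carrier W \<and>
    poly_var (\<Sum>e\<in>J. sc (c e) e) - (\<Sum>e\<in>J. poly_const (c e) * poly_var e) \<in> I"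
  using assms
proof (induction J)
  case empty
  then show ?case by (simp add: var_zero_I W_zero)
next
  case (insert e J)
  let ?s = "\<Sum>e\<in>J. sc (c e) e"
  have e: "e \<in> carrier W" "sc (c e) e \<in> carrier W" and s: "?s \<in> carrier W"
    using insert W_closed_scale by auto
  have "poly_var (sc (c e) e + ?s) - (\<Sum>e\<in>insert e J. poly_const (c e) * poly_var e) =
    (poly_var (sc (c e) e + ?s) - poly_var (sc (c e) e) - poly_var ?s) +
    (poly_var (sc (c e) e) - poly_const (c e) * poly_var e) +
    (poly_var ?s - (\<Sum>e\<in>J. poly_const (c e) * poly_var e))"
    using insert.hyps by (simp add: algebra_simps)
  also have "\<dots> \<in> I"
    using var_add_I[OF e(2) s] var_scale_I[OF e(1)] insert by (intro I_add) auto
  finally show ?case using insert.hyps W_closed_add[OF e(2) s] by simp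
qed

lemma var_expand_I:
  assumes "w \<in> carrier W"
  shows "(\<Sum>e\<in>E0. poly_const (co e w) * poly_var e) - poly_var w \<in> I"
proof -
  have "poly_var w - (\<Sum>e\<in>E0. poly_const (co e w) * poly_var e) \<in> I"
    using var_sum_I[OF E0, of "\<lambda>e. co e w"] co_expand[OF assms] by simp
  from I_minus[OF this] show ?thesis by simp
qed

lemma Sym_eq: "Sym W = R Quot I" by (simp add: Sym_def R_def)

lemma Sym_incl_eq: "Sym_incl W w = \<pi> (poly_var w)" by (simp add: Sym_incl_def R_def \<pi>_def)

lemma cring_Sym: "cring (Sym W)"
  unfolding Sym_eq by (rule I.quotient_is_cring) (rule R.is_cring)

sublocale S: cring "Sym W" by (rule cring_Sym)

lemma \<pi>_hom: "\<pi> \<in> ring_hom R (Sym W)"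
  using I.rcos_ring_hom by (simp add: Sym_eq \<pi>_def[abs_def])

lemma \<pi>_carrier: "p \<in> car \<Longrightarrow> \<pi> p \<in> carrier (Sym W)"
  using ring_hom_closed[OF \<pi>_hom] by simp

lemma \<pi>_add: "p \<in> car \<Longrightarrow> q \<in> car \<Longrightarrow> \<pi> (p + q) = \<pi> p \<oplus>\<^bsub>Sym W\<^esub> \<pi> q"
  using ring_hom_add[OF \<pi>_hom, of p q] by simp

lemma \<pi>_mult: "p \<in> car \<Longrightarrow> q \<in> car \<Longrightarrow> \<pi> (p * q) = \<pi> p \<otimes>\<^bsub>Sym W\<^esub> \<pi> q"
  using ring_hom_mult[OF \<pi>_hom, of p q] by simp

lemma \<pi>_eq_iff: "p \<in> car \<Longrightarrow> q \<in> car \<Longrightarrow> \<pi> p = \<pi> q \<longleftrightarrow> p - q \<in> I"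
  using R.quotient_eq_iff_same_a_r_cos[OF I.is_ideal, of p q] by (simp add: \<pi>_def)

lemma \<pi>_zero: "\<pi> 0 = \<zero>\<^bsub>Sym W\<^esub>"
  using ring_hom_zero[OF \<pi>_hom R.ring_axioms S.ring_axioms] by simp

lemma \<pi>_surj: "u \<in> carrier (Sym W) \<Longrightarrow> \<exists>p\<in>car. u = \<pi> p"
  by (auto simp: Sym_eq FactRing_def A_RCOSETS_def' \<pi>_def)

text \<open>A defining relation has no constant term and is killed by contraction with a linear
  functional. By the Leibniz rule a contraction of \<open>q * g\<close> is therefore again a
  multiple of \<open>g\<close>.\<close>

lemma word_map_polar_relation_mult:
  assumes g: "g \<in> linear_relations W"
  shows "polar co es (q * g) = 0"
proof (induction es arbitrary: q)
  case Nil
  from g show ?case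
  proof (auto simp: linear_relations_def, goal_cases)
    case (1 v w)
    have "q * (poly_var (v \<oplus>\<^bsub>W\<^esub> w) - poly_var v - poly_var w) =
      poly_var (v \<oplus>\<^bsub>W\<^esub> w) * q + poly_var v * (- q) + poly_var w * (- q)" by (simp add: algebra_simps)
    then show ?case by (simp only: const_term_add const_term_var_mult add_0)
  next
    case (2 c w)
    have "q * (poly_var (c \<odot>\<^bsub>W\<^esub> w) - poly_const c * poly_var w) =
      poly_var (c \<odot>\<^bsub>W\<^esub> w) * q + poly_var w * (- (poly_const c * q))" by (simp add: algebra_simps)
    then show ?case by (simp only: const_term_add const_term_var_mult add_0)
  qed
next
  case (Cons e es)
  have "derivation (co e) (q * g) = derivation (co e) q * g"
    using g
  proof (auto simp: linear_relations_def, goal_cases)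
    case (1 v w)
    let ?\<phi> = "co e"
    have q: "derivation ?\<phi> (- q) = - derivation ?\<phi> q"
      using derivation_const_mult[of ?\<phi> "- 1" q] by (simp add: poly_const_def single_uminus)
    have "q * (poly_var (v \<oplus>\<^bsub>W\<^esub> w) - poly_var v - poly_var w) =
      poly_var (v + w) * q + poly_var v * (- q) + poly_var w * (- q)" by (simp add: algebra_simps W_add)
    also have "derivation ?\<phi> \<dots> = derivation ?\<phi> q * (poly_var (v \<oplus>\<^bsub>W\<^esub> w) - poly_var v - poly_var w)"
      using 1 by (simp only: derivation_add derivation_var_mult q co_add poly_const_add)
        (simp add: algebra_simps W_add)
    finally show ?case .
  next
    case (2 c w)
    let ?\<phi> = "co e"
    have q: "derivation ?\<phi> (- q) = - derivation ?\<phi> q" for q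
      using derivation_const_mult[of ?\<phi> "- 1" q] by (simp add: poly_const_def single_uminus)
    have "q * (poly_var (c \<odot>\<^bsub>W\<^esub> w) - poly_const c * poly_var w) =
      poly_var (sc c w) * q + poly_var w * (- (poly_const c * q))" by (simp add: algebra_simps W_smult)
    also have "derivation ?\<phi> \<dots> = derivation ?\<phi> q * (poly_var (c \<odot>\<^bsub>W\<^esub> w) - poly_const c * poly_var w)"
      using 2 by (simp only: derivation_add derivation_var_mult q derivation_const_mult co_scale poly_const_mult)
        (simp add: algebra_simps W_smult)
    finally show ?case .
  qed
  then show ?case using Cons.IH by simp
qed

text \<open>This is the largest ideal on which \<open>T\<close> vanishes. To see that
  \<open>T\<close> vanishes on an ideal given by generators it is then enough to look at multiples
  of the generators.\<close>

lemma ideal_of_vanishing: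
  assumes add: "\<And>p q. T (p + q) = (T p + T q :: 'z::ab_group_add)"
  shows "ideal {p \<in> car. \<forall>q\<in>car. T (q * p) = 0} R"
proof -
  have neg: "T (- p) = - T p" for p
    using add[of p "- p"] add[of 0 0] minus_unique[of "T p" "T (- p)"] by simp
  have T0: "T 0 = 0" using add[of 0 0] by simp
  show ?thesis
  proof (rule idealI)
    show "subgroup {p \<in> car. \<forall>q\<in>car. T (q * p) = 0} (add_monoid R)"
    proof (rule R.add.subgroupI, goal_cases)
      case 2
      show ?case using T0 by (auto intro!: exI[of _ 0])
    next
      case (3 p)
      then show ?case
        by (simp add: a_inv_def[symmetric] R_def free_comm_algebra_uminus poly_carrier_uminus neg)
    qed (auto simp: distrib_left add poly_carrier_add)
  next
    fix a x assume a: "a \<in> {p \<in> car. \<forall>q\<in>car. T (q * p) = 0}" and x: "x \<in> carrier R"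
    have "T (q * (x * a)) = 0" if "q \<in> car" for q
      using a x that poly_carrier_mult[of q "carrier W" x] by (simp add: mult.assoc[symmetric])
    with a x show "x \<otimes>\<^bsub>R\<^esub> a \<in> {p \<in> car. \<forall>q\<in>car. T (q * p) = 0}"
      and "a \<otimes>\<^bsub>R\<^esub> x \<in> {p \<in> car. \<forall>q\<in>car. T (q * p) = 0}"
      by (auto simp: poly_carrier_mult mult.commute[of a])
  qed (rule R.ring_axioms)
qed

lemma polar_I:
  assumes "p \<in> I"
  shows "polar co es p = 0"
proof -
  have "I \<subseteq> {p \<in> car. \<forall>q\<in>car. polar co es (q * p) = 0}"
    unfolding linear_ideal_def R_def[symmetric]
    by (rule R.genideal_minimal[OF ideal_of_vanishing])
      (use relations_car word_map_polar_relation_mult in \<open>auto simp: polar_add\<close>)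
  with assms have "\<forall>q\<in>car. polar co es (q * p) = 0" by blast
  from this[rule_format, OF poly_carrier_one] show ?thesis by simp
qed

text \<open>Taylor's formula for the coefficients of the symmetrization. The choice of a
  representative is harmless because \<open>polar\<close> vanishes on the linear relations, see
  \<open>polar_I\<close>.\<close>

definition sym_word :: "(('m \<Rightarrow>\<^sub>0 nat) \<Rightarrow>\<^sub>0 'k) set \<Rightarrow> 'm list \<Rightarrow> 'k" where
  "sym_word u es = polar co es (SOME p. p \<in> car \<and> u = \<pi> p) / fact (length es)"

lemma sym_word_\<pi>:
  assumes "p \<in> car"
  shows "sym_word (\<pi> p) es = polar co es p / fact (length es)"
proof -
  define q where "q = (SOME q. q \<in> car \<and> \<pi> p = \<pi> q)"
  have "q \<in> car \<and> \<pi> p = \<pi> q" unfolding q_def by (rule someI[of _ p]) (use assms in auto)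
  then have "p - q \<in> I" using \<pi>_eq_iff assms by blast
  then have "polar co es (p - q) = 0" by (rule polar_I)
  then have "polar co es p = polar co es q"
    using polar_add[of co es "p - q" q] by simp
  then show ?thesis by (simp add: sym_word_def q_def)
qed

lemma sym_word_\<pi>_eq: "p \<in> car \<Longrightarrow> sym_word (\<pi> p) = (\<lambda>es. polar co es p / fact (length es))"
  by (intro ext sym_word_\<pi>)

lemma sym_word_add:
  assumes "u \<in> carrier (Sym W)" "v \<in> carrier (Sym W)"
  shows "sym_word (u \<oplus>\<^bsub>Sym W\<^esub> v) = (\<lambda>es. sym_word u es + sym_word v es)"
proof -
  obtain p q where "p \<in> car" "u = \<pi> p" "q \<in> car" "v = \<pi> q" using assms \<pi>_surj by meson
  then show ?thesis
    by (intro ext) (simp add: \<pi>_add[symmetric] sym_word_\<pi> poly_carrier_add polar_add add_divide_distrib)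
qed

lemma polar_bounded:
  assumes "p \<in> car"
  shows "\<exists>n. \<forall>es. length es \<ge> n \<longrightarrow> polar co es p = 0"
  using assms
proof (induction rule: poly_carrier_homog_induct)
  case (homog n p)
  then show ?case using polar_homog[OF homog, of _ co] by (intro exI[of _ "Suc n"]) auto
next
  case (add p q)
  then obtain m n where "\<forall>es. length es \<ge> m \<longrightarrow> polar co es p = 0" "\<forall>es. length es \<ge> n \<longrightarrow> polar co es q = 0"
    by blast
  then show ?case by (intro exI[of _ "max m n"]) (auto simp: polar_add)
qed

lemma sym_word_bounded:
  assumes "u \<in> carrier (Sym W)"
  shows "\<exists>n. \<forall>es. length es \<ge> n \<longrightarrow> sym_word u es = 0"
proof -
  obtain p where p: "p \<in> car" "u = \<pi> p" using assms \<pi>_surj by blast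
  with polar_bounded[OF p(1)] show ?thesis by (auto simp: sym_word_\<pi>)
qed

lemma polar_outside:
  assumes "\<not> set es \<subseteq> E0"
  shows "polar co es p = 0"
  using assms
proof (induction es arbitrary: p)
  case (Cons e es)
  show ?case
  proof (cases "e \<in> E0")
    case False
    \<comment> \<open>The zero functional is written as an empty sum, so that linearity in the
      functional makes its derivation vanish.\<close>
    then have "co e = (\<lambda>w. \<Sum>i\<in>({} :: nat set). 0 * 0)" by (simp add: co_outside fun_eq_iff)
    then have "derivation (co e) p = 0" using derivation_functional_sum[of "\<lambda>_. 0" "\<lambda>_ _. 0" "{} :: nat set" p] by simp
    then show ?thesis by simp
  qed (use Cons in auto)
qed simp

lemma sym_word_outside:
  assumes "u \<in> carrier (Sym W)" "sym_word u es \<noteq> 0"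
  shows "set es \<subseteq> E0"
proof -
  obtain p where p: "p \<in> car" "u = \<pi> p" using assms \<pi>_surj by blast
  with assms(2) polar_outside[of es p] show ?thesis by (auto simp: sym_word_\<pi>)
qed

text \<open>Euler's formula. It holds only modulo the linear relations, because the sum runs over
  \<open>E0\<close> while the polynomial may contain any variable \<open>w\<close>; modulo them the
  variable of \<open>w\<close> is the combination of the basis variables with coefficients
  \<open>co e w\<close>.\<close>

lemma euler_I:
  assumes "homog (carrier W) n p"
  shows "(\<Sum>e\<in>E0. poly_var e * derivation (co e) p) - of_nat n * p \<in> I"
  using assms
proof (induction rule: homog.induct)
  case (homog_var w n p)
  let ?Z = "\<Sum>e\<in>E0. poly_var e * derivation (co e) p"
  let ?Y = "\<Sum>e\<in>E0. poly_const (co e w) * poly_var e"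
  have "(\<Sum>e\<in>E0. poly_var e * derivation (co e) (poly_var w * p)) = ?Y * p + poly_var w * ?Z"
    by (simp only: derivation_var_mult distrib_left sum.distrib sum_distrib_left sum_distrib_right
        mult.assoc mult.left_commute)
  moreover have "y * p + v * x - of_nat (Suc n) * (v * p) = p * (y - v) + v * (x - of_nat n * p)"
    for x y v p :: "('m \<Rightarrow>\<^sub>0 nat) \<Rightarrow>\<^sub>0 'k"
    by (simp add: algebra_simps)
  ultimately have "(\<Sum>e\<in>E0. poly_var e * derivation (co e) (poly_var w * p)) - of_nat (Suc n) * (poly_var w * p) =
    p * (?Y - poly_var w) + poly_var w * (?Z - of_nat n * p)"
    by (simp only:)
  also have "\<dots> \<in> I"
    using homog_var homog_carrier[OF homog_var.hyps(2)] var_expand_I by (intro I_add I_mult) auto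
  finally show ?case .
next
  case (homog_add n p q)
  have "(\<Sum>e\<in>E0. poly_var e * derivation (co e) (p + q)) - of_nat n * (p + q) =
    ((\<Sum>e\<in>E0. poly_var e * derivation (co e) p) - of_nat n * p) +
    ((\<Sum>e\<in>E0. poly_var e * derivation (co e) q) - of_nat n * q)"
    by (simp only: derivation_add distrib_left sum.distrib add_diff_add)
  with homog_add I_add show ?case by simp
qed (auto simp: I_zero)

text \<open>Euler's formula applied \<open>n\<close> times, in degrees n, n - 1, ..., 1, which
  produces the factorial.\<close>

lemma word_poly_polar:
  assumes "homog (carrier W) n p"
  shows "word_poly E0 n (\<lambda>es. polar co es p) - of_nat (fact n) * p \<in> I"
  using assms
proof (induction n arbitrary: p)
  case 0
  from 0 have "poly_const (const_term p) = p"
  proof (induction "0 :: nat" p rule: homog.induct)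
    case (homog_add p q)
    then show ?case by (simp add: poly_const_add)
  qed auto
  then show ?case by (simp add: I_zero)
next
  case (Suc n)
  have der: "homog (carrier W) n (derivation (co e) p)" for e using derivation_homog[OF Suc.prems] by blast
  let ?D = "\<lambda>e. derivation (co e) p"
  define c :: "('m \<Rightarrow>\<^sub>0 nat) \<Rightarrow>\<^sub>0 'k" where "c = poly_const (of_nat (fact n))"
  have c1: "of_nat (fact n) = c" by (simp only: c_def poly_const_of_nat)
  have c2: "of_nat (fact (Suc n)) = c * of_nat (Suc n)"
    unfolding c1[symmetric] of_nat_mult[symmetric] fact_Suc of_nat_id by (simp only: mult.commute)
  let ?w = "\<lambda>e. word_poly E0 n (\<lambda>es. polar co es (?D e))"
  have "(\<Sum>e\<in>E0. poly_var e * (c * ?D e)) = c * (\<Sum>e\<in>E0. poly_var e * ?D e)"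
    by (simp only: sum_distrib_left mult.left_commute)
  then have w: "(\<Sum>e\<in>E0. poly_var e * (?w e - c * ?D e)) =
      (\<Sum>e\<in>E0. poly_var e * ?w e) - c * (\<Sum>e\<in>E0. poly_var e * ?D e)"
    by (simp only: right_diff_distrib sum_subtractf)
  have aux: "x - y * z * t = (x - y * v) + y * (v - z * t)" for x y z t v :: "('m \<Rightarrow>\<^sub>0 nat) \<Rightarrow>\<^sub>0 'k"
    by (simp only: right_diff_distrib mult.assoc diff_add_eq_diff_diff_swap diff_diff_eq2) simp
  have "word_poly E0 (Suc n) (\<lambda>es. polar co es p) - of_nat (fact (Suc n)) * p =
    (\<Sum>e\<in>E0. poly_var e * (?w e - of_nat (fact n) * ?D e)) +
    of_nat (fact n) * ((\<Sum>e\<in>E0. poly_var e * ?D e) - of_nat (Suc n) * p)"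
    unfolding c1 c2 w word_poly.simps polar.simps by (rule aux)
  also have "\<dots> \<in> I"
  proof (rule I_add)
    show "(\<Sum>e\<in>E0. poly_var e * (word_poly E0 n (\<lambda>es. polar co es (?D e)) - of_nat (fact n) * ?D e)) \<in> I"
      using Suc.IH[OF der] E0 by (intro I_sum I_mult) auto
    show "of_nat (fact n) * ((\<Sum>e\<in>E0. poly_var e * ?D e) - of_nat (Suc n) * p) \<in> I"
      unfolding c1 by (intro I_mult euler_I Suc.prems) (simp add: c_def)
  qed
  finally show ?case .
qed

definition words_bounded :: "('m list \<Rightarrow> 'k) \<Rightarrow> nat \<Rightarrow> bool" where
  "words_bounded f n \<longleftrightarrow> (\<forall>es. length es \<ge> n \<longrightarrow> f es = 0)"

text \<open>Multiplication of tensors into the symmetric algebra. The least length bound only serves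
  to obtain a finite sum; by \<open>word_prod_eq\<close> any other bound gives the same value, which
  is what additivity uses.\<close>

definition word_prod :: "('m list \<Rightarrow> 'k) \<Rightarrow> (('m \<Rightarrow>\<^sub>0 nat) \<Rightarrow>\<^sub>0 'k) set" where
  "word_prod f = \<pi> (\<Sum>n<(LEAST n. words_bounded f n). word_poly E0 n f)"

lemma word_prod_eq:
  assumes "words_bounded f N"
  shows "word_prod f = \<pi> (\<Sum>i<N. word_poly E0 i f)"
proof -
  define m where "m = (LEAST n. words_bounded f n)"
  have m1: "words_bounded f m" unfolding m_def using assms by (rule LeastI)
  have m2: "m \<le> N" unfolding m_def using assms by (rule Least_le)
  have "word_poly E0 i f = 0" if "m \<le> i" for i
    using m1 that unfolding words_bounded_def by (intro word_poly_zero) simp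
  then have "(\<Sum>i<m. word_poly E0 i f) = (\<Sum>i<N. word_poly E0 i f)"
    using m2 by (intro sum.mono_neutral_left) auto
  then show ?thesis unfolding word_prod_def m_def[symmetric] by (rule arg_cong)
qed

lemma word_poly_car: "word_poly E0 n f \<in> car"
  using E0 by (rule_tac word_poly_carrier)

lemma word_prod_carrier: "word_prod f \<in> carrier (Sym W)"
  unfolding word_prod_def by (intro \<pi>_carrier poly_carrier_sum word_poly_car)

lemma word_prod_add:
  assumes "words_bounded f m" "words_bounded g n"
  shows "word_prod (\<lambda>t. f t + g t) = word_prod f \<oplus>\<^bsub>Sym W\<^esub> word_prod g"
proof -
  let ?N = "max m n"
  have b: "words_bounded f ?N" "words_bounded g ?N" "words_bounded (\<lambda>t. f t + g t) ?N"
    using assms by (auto simp: words_bounded_def)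
  show ?thesis
    unfolding b[THEN word_prod_eq]
    by (simp add: word_poly_add sum.distrib \<pi>_add poly_carrier_sum word_poly_car)
qed

text \<open>This is where characteristic zero enters: for a homogeneous polynomial of degree m only
  words of length m contribute, and dividing by m! undoes the factor in
  \<open>word_poly_polar\<close>.\<close>

lemma word_prod_sym_word:
  assumes "u \<in> carrier (Sym W)"
  shows "word_prod (sym_word u) = u"
proof -
  obtain p where p: "p \<in> car" "u = \<pi> p" using assms \<pi>_surj by blast
  let ?f = "\<lambda>p es. polar co es p / fact (length es)"
  \<comment> \<open>Stated for all large bounds \<open>n\<close>, so that the bounds of two
    summands, and later one for \<open>sym_word u\<close>, can be merged.\<close>
  have "\<exists>N. \<forall>n\<ge>N. (\<Sum>i<n. word_poly E0 i (?f p)) - p \<in> I"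
    using p(1)
  proof (induction rule: poly_carrier_homog_induct)
    case (homog m p)
    have zero: "word_poly E0 i (?f p) = 0" if "i \<noteq> m" for i
      using polar_homog[OF homog, of _ co] that by (intro word_poly_zero) auto
    have "word_poly E0 m (?f p) = word_poly E0 m (\<lambda>es. 1 / fact m * polar co es p)"
      by (rule word_poly_cong) simp
    also have "\<dots> = poly_const (1 / fact m) * word_poly E0 m (\<lambda>es. polar co es p)"
      by (rule word_poly_scale)
    finally have 0: "word_poly E0 m (?f p) = poly_const (1 / fact m) * word_poly E0 m (\<lambda>es. polar co es p)" .
    have "poly_const (1 / fact m) * of_nat (fact m) = (1 :: ('m \<Rightarrow>\<^sub>0 nat) \<Rightarrow>\<^sub>0 'k)"
      unfolding poly_const_of_nat[symmetric] poly_const_mult[symmetric] by simp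
    then have "poly_const (1 / fact m) * (of_nat (fact m) * p) = p" by (simp flip: mult.assoc)
    then have 1: "word_poly E0 m (?f p) - p =
      poly_const (1 / fact m) * (word_poly E0 m (\<lambda>es. polar co es p) - of_nat (fact m) * p)"
      unfolding 0 right_diff_distrib by (simp only:)
    have "word_poly E0 m (?f p) - p \<in> I"
      unfolding 1 using word_poly_polar[OF homog] by (intro I_mult) auto
    moreover have "(\<Sum>i<n. word_poly E0 i (?f p)) = word_poly E0 m (?f p)" if "n > m" for n
      using sum.mono_neutral_right[of "{..<n}" "{m}" "\<lambda>i. word_poly E0 i (?f p)"] that zero by auto
    ultimately show ?case by (intro exI[of _ "Suc m"]) auto
  next
    case (add p q)
    then obtain M N where MN: "\<forall>n\<ge>M. (\<Sum>i<n. word_poly E0 i (?f p)) - p \<in> I"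
      "\<forall>n\<ge>N. (\<Sum>i<n. word_poly E0 i (?f q)) - q \<in> I" by blast
    have eq: "(\<Sum>i<n. word_poly E0 i (?f (p + q))) - (p + q) =
      ((\<Sum>i<n. word_poly E0 i (?f p)) - p) + ((\<Sum>i<n. word_poly E0 i (?f q)) - q)" for n
      by (simp add: polar_add add_divide_distrib word_poly_add sum.distrib)
    show ?case unfolding eq using MN by (intro exI[of _ "max M N"] allI impI I_add) auto
  qed
  then obtain N where N: "\<And>n. n \<ge> N \<Longrightarrow> (\<Sum>i<n. word_poly E0 i (?f p)) - p \<in> I" by blast
  obtain M where M: "words_bounded (sym_word u) M"
    using sym_word_bounded[OF assms] by (auto simp: words_bounded_def)
  then have b: "words_bounded (sym_word u) (max M N)" by (auto simp: words_bounded_def)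
  have "word_prod (sym_word u) = \<pi> (\<Sum>n<max M N. word_poly E0 n (sym_word u))"
    by (rule word_prod_eq[OF b])
  also have "\<dots> = \<pi> p"
    using N[of "max M N"] p by (subst \<pi>_eq_iff) (auto simp: sym_word_\<pi>_eq poly_carrier_sum word_poly_car)
  finally show ?thesis using p by simp
qed

lemma Sym_ideal_ideal:
  assumes "Z \<subseteq> carrier W"
  shows "ideal (Sym_ideal W Z) (Sym W)" "x \<in> Z \<Longrightarrow> \<pi> (poly_var x) \<in> Sym_ideal W Z"
proof -
  have "Sym_incl W ` Z \<subseteq> carrier (Sym W)"
    using assms by (auto simp: Sym_incl_eq intro!: \<pi>_carrier)
  from S.genideal_ideal[OF this] S.genideal_self[OF this]
  show "ideal (Sym_ideal W Z) (Sym W)" "x \<in> Z \<Longrightarrow> \<pi> (poly_var x) \<in> Sym_ideal W Z"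
    unfolding Sym_ideal_def Sym_incl_eq by blast+
qed

text \<open>Contraction with a row of \<open>p\<close> passes through a factor \<open>x\<close> from
  \<open>Z\<close>, since this functional vanishes at \<open>x\<close>. So the factor survives all
  contractions, and the final constant term is zero.\<close>

lemma word_map_sym_word_ideal:
  assumes Z: "Z \<subseteq> carrier W"
    and p: "\<And>x e. x \<in> Z \<Longrightarrow> (\<Sum>e'\<in>E. p e e' * co e' x) = 0"
    and u: "u \<in> Sym_ideal W Z"
  shows "word_map E p es (sym_word u) = 0"
proof -
  let ?T = "\<lambda>q. word_map E p es (\<lambda>t. polar co t q)"
  let ?J = "{q \<in> car. \<forall>r\<in>car. ?T (r * q) = 0}"
  have add: "?T (q + r) = ?T q + ?T r" for q r by (simp add: polar_add word_map_add)
  have J: "ideal ?J R" by (rule ideal_of_vanishing) (rule add)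
  have X_J: "poly_var x \<in> ?J" if x: "x \<in> Z" for x
  proof -
    have "word_map E p es (\<lambda>t. polar co t (poly_var x * r)) = 0" for r
    proof (induction es arbitrary: r)
      case (Cons e es)
      let ?q = "poly_var x * r"
      let ?\<phi> = "\<lambda>w. \<Sum>e'\<in>E. p e e' * co e' w"
      have "word_map E p (e # es) (\<lambda>t. polar co t ?q) =
        (\<Sum>e'\<in>E. p e e' * word_map E p es (\<lambda>t. polar co t (derivation (co e') ?q)))"
        by (simp only: word_map.simps polar.simps)
      also have "\<dots> = word_map E p es (\<lambda>t. \<Sum>e'\<in>E. p e e' * polar co t (derivation (co e') ?q))"
        by (rule word_map_sum[symmetric])
      also have "\<dots> = word_map E p es (\<lambda>t. polar co t (derivation ?\<phi> ?q))"
        by (simp only: derivation_functional_sum polar_sum polar_const_mult)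
      also have "derivation ?\<phi> ?q = poly_var x * derivation ?\<phi> r"
        by (simp only: derivation_var_mult p[OF x] poly_const_zero mult_zero_left add_0)
      also have "word_map E p es (\<lambda>t. polar co t \<dots>) = 0" by (rule Cons.IH)
      finally show ?case .
    qed simp
    then have "?T (r * poly_var x) = 0" for r by (subst mult.commute)
    moreover have "poly_var x \<in> car" using x Z by (intro poly_carrier_var) blast
    ultimately show ?thesis by blast
  qed
  interpret J: ideal ?J R by (rule J)
  \<comment> \<open>\<open>Sym_ideal\<close> is generated in the quotient, whereas \<open>?J\<close>
    lives upstairs; the image of an ideal under the surjection \<open>\<pi>\<close> is an
    ideal.\<close>
  have "ideal (\<pi> ` ?J) (Sym W)"
  proof (rule idealI)
    show "subgroup (\<pi> ` ?J) (add_monoid (Sym W))"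
    proof (rule S.add.subgroupI, goal_cases)
      case 1 then show ?case using \<pi>_carrier by auto
    next
      case 2
      have "0 \<in> ?J" using J.zero_closed by simp
      then show ?case by blast
    next
      case (3 a)
      then obtain q where q: "q \<in> ?J" "a = \<pi> q" by blast
      then have nq: "- q \<in> ?J" using J.a_inv_closed[OF q(1)] by (simp add: R_def free_comm_algebra_uminus)
      have "\<pi> (- q) \<oplus>\<^bsub>Sym W\<^esub> \<pi> q = \<zero>\<^bsub>Sym W\<^esub>"
        using \<pi>_add[of "- q" q] q nq by (simp add: \<pi>_zero)
      then have "\<ominus>\<^bsub>Sym W\<^esub> a = \<pi> (- q)"
        using q nq by (intro S.minus_equality) (auto intro: \<pi>_carrier)
      with nq show ?case by (auto simp: a_inv_def)
    next
      case (4 a b)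
      then obtain q r where "q \<in> ?J" "a = \<pi> q" "r \<in> ?J" "b = \<pi> r" by blast
      moreover from this have "q + r \<in> ?J" using J.a_closed[of q r] by simp
      ultimately show ?case using \<pi>_add[of q r] by auto
    qed
  next
    fix a x assume "a \<in> \<pi> ` ?J" "x \<in> carrier (Sym W)"
    then obtain q r where *: "q \<in> ?J" "a = \<pi> q" "r \<in> car" "x = \<pi> r" using \<pi>_surj by blast
    moreover from this have "r * q \<in> ?J" using J.I_l_closed[of q r] by simp
    ultimately show "x \<otimes>\<^bsub>Sym W\<^esub> a \<in> \<pi> ` ?J" using \<pi>_mult[of r q] by auto
    from * have "q * r \<in> ?J" using J.I_r_closed[of q r] by simp
    with * show "a \<otimes>\<^bsub>Sym W\<^esub> x \<in> \<pi> ` ?J" using \<pi>_mult[of q r] by auto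
  qed (rule S.ring_axioms)
  moreover have "Sym_incl W ` Z \<subseteq> \<pi> ` ?J" using X_J by (auto simp: Sym_incl_eq)
  ultimately have "Sym_ideal W Z \<subseteq> \<pi> ` ?J"
    unfolding Sym_ideal_def by (rule S.genideal_minimal)
  with u obtain q where q: "q \<in> ?J" "u = \<pi> q" by blast
  have "word_map E p es (sym_word u) = word_map E p es (\<lambda>t. (1 / fact (length t)) * polar co t q)"
    using q by (simp add: sym_word_\<pi>_eq)
  also have "\<dots> = (1 / fact (length es)) * ?T q"
    by (rule word_map_length_scale[of E p es "\<lambda>n. 1 / fact n"])
  also have "?T q = 0" using q(1) poly_carrier_one[of "carrier W"] mult_1_left[of q] by fastforce
  finally show ?thesis by simp
qed

text \<open>A word of degree 1 has exactly one letter of degree 1, and the differential replaces it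
  by its boundary, an element of \<open>Z\<close>. After multiplication this boundary is a factor,
  so the product lies in the ideal. The induction separates the case of the first letter from the
  rest of the word.\<close>

lemma word_poly_diff_ideal:
  assumes E: "E0 = {e \<in> E. dg e = 0}"
    and d_deg: "\<And>e e'. d e e' \<noteq> 0 \<Longrightarrow> dg e' = Suc (dg e)"
    and Z: "Z \<subseteq> carrier W"
    and d_Z: "\<And>e. e \<in> B \<Longrightarrow> (\<Sum>e'\<in>E0. sc (d e' e) e') \<in> Z"
    and f: "\<And>t. f t \<noteq> 0 \<Longrightarrow> set t \<subseteq> E \<and> word_deg dg t = 1 \<and> {e \<in> set t. dg e = 1} \<subseteq> B"
  shows "\<pi> (word_poly E0 n (\<lambda>es. word_diff E dg d es f)) \<in> Sym_ideal W Z"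
proof -
  interpret J: ideal "Sym_ideal W Z" "Sym W" by (rule Sym_ideal_ideal[OF Z])
  define K where "K = {q \<in> car. \<pi> q \<in> Sym_ideal W Z}"
  have K_add: "p + q \<in> K" if "p \<in> K" "q \<in> K" for p q
    using that by (auto simp: K_def \<pi>_add poly_carrier_add)
  have K_mult: "q * p \<in> K" if "p \<in> K" "q \<in> car" for p q
    using that by (auto simp: K_def \<pi>_mult poly_carrier_mult \<pi>_carrier J.I_l_closed)
  have K_zero: "0 \<in> K" by (simp add: K_def \<pi>_zero)
  have K_sum: "sum g S \<in> K" if "\<And>x. x \<in> S \<Longrightarrow> g x \<in> K" for g and S :: "'m set"
    using that by (induction S rule: infinite_finite_induct) (auto simp: K_zero K_add)
  have K_I: "p \<in> K" if "p \<in> I" for p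
  proof -
    have "\<pi> p = \<pi> 0" using that I_car by (subst \<pi>_eq_iff) auto
    then show ?thesis using that I_car by (simp add: K_def \<pi>_zero)
  qed
  have K_d: "(\<Sum>e'\<in>E0. poly_const (d e' e) * poly_var e') \<in> K" if "e \<in> B" for e
  proof -
    let ?s = "\<Sum>e'\<in>E0. sc (d e' e) e'" and ?p = "\<Sum>e'\<in>E0. poly_const (d e' e) * poly_var e'"
    have "poly_var ?s \<in> K"
      using d_Z[OF that] Z Sym_ideal_ideal(2)[OF Z] by (auto simp: K_def)
    \<comment> \<open>The variable of the boundary and the combination of basis variables agree only
      modulo the linear relations.\<close>
    moreover have "- (poly_var ?s - ?p) \<in> K"
      using var_sum_I[OF E0, of "\<lambda>e'. d e' e"] by (intro K_I I_minus) simp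
    ultimately have "poly_var ?s + - (poly_var ?s - ?p) \<in> K" by (rule K_add)
    then show ?thesis by simp
  qed
  have "word_poly E0 n (\<lambda>es. word_diff E dg d es f) \<in> K"
    using f
  proof (induction n arbitrary: f)
    case 0
    then show ?case by (simp add: K_zero)
  next
    case (Suc n f)
    let ?f = "\<lambda>e t. f (e # t)"
    have 1: "word_poly E0 n (\<lambda>es. word_diff E dg d es (?f e)) \<in> K" if e: "e \<in> E0" for e
      by (rule Suc.IH) (use Suc.prems e E in force)
    have 2: "word_poly E0 n (?f e) * (\<Sum>e'\<in>E0. poly_const (d e' e) * poly_var e') \<in> K" for e
    proof (cases "\<exists>t. f (e # t) \<noteq> 0")
      case True
      then obtain t where t: "f (e # t) \<noteq> 0" by blast
      show ?thesis
      proof (cases "dg e")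
        case 0
        then have "d e' e = 0" for e' using d_deg[of e' e] by auto
        then show ?thesis by (simp add: K_zero)
      next
        case Suc
        then have "e \<in> B" using Suc.prems[OF t] by auto
        then show ?thesis using K_d by (intro K_mult word_poly_car)
      qed
    next
      case False
      then show ?thesis using K_zero by (simp add: word_poly_zero)
    qed
    have "word_poly E0 (Suc n) (\<lambda>es. word_diff E dg d es f) =
      (\<Sum>e\<in>E0. poly_var e * ((\<Sum>e'\<in>E. poly_const (d e e') * word_poly E0 n (?f e')) +
        word_poly E0 n (\<lambda>es. word_diff E dg d es (?f e))))"
    proof -
      have "word_poly E0 n (\<lambda>t. word_diff E dg d (e # t) f) =
        (\<Sum>e'\<in>E. poly_const (d e e') * word_poly E0 n (?f e')) +
        word_poly E0 n (\<lambda>es. word_diff E dg d es (?f e))" if "e \<in> E0" for e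
        using that E by (simp add: word_poly_add word_poly_sum)
      then show ?thesis by (simp only: word_poly.simps cong: sum.cong)
    qed
    also have "\<dots> = (\<Sum>e'\<in>E. word_poly E0 n (?f e') * (\<Sum>e\<in>E0. poly_const (d e e') * poly_var e)) +
      (\<Sum>e\<in>E0. poly_var e * word_poly E0 n (\<lambda>es. word_diff E dg d es (?f e)))"
    proof -
      have "(\<Sum>e\<in>E0. poly_var e * (\<Sum>e'\<in>E. poly_const (d e e') * word_poly E0 n (?f e'))) =
        (\<Sum>e'\<in>E. word_poly E0 n (?f e') * (\<Sum>e\<in>E0. poly_const (d e e') * poly_var e))"
        unfolding sum_distrib_left by (subst sum.swap) (simp only: ac_simps)
      then show ?thesis by (simp only: distrib_left sum.distrib)
    qed
    also have "\<dots> \<in> K"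
      using E0 by (intro K_add K_sum K_mult 1 2) auto
    finally show ?case .
  qed
  then show ?thesis by (simp add: K_def)
qed

lemma word_prod_diff_ideal:
  assumes "E0 = {e \<in> E. dg e = 0}"
    and "\<And>e e'. d e e' \<noteq> 0 \<Longrightarrow> dg e' = Suc (dg e)"
    and Z: "Z \<subseteq> carrier W"
    and "\<And>e. e \<in> B \<Longrightarrow> (\<Sum>e'\<in>E0. sc (d e' e) e') \<in> Z"
    and "\<And>t. f t \<noteq> 0 \<Longrightarrow> set t \<subseteq> E \<and> word_deg dg t = 1 \<and> {e \<in> set t. dg e = 1} \<subseteq> B"
  shows "word_prod (\<lambda>es. word_diff E dg d es f) \<in> Sym_ideal W Z"
proof -
  interpret J: ideal "Sym_ideal W Z" "Sym W" by (rule Sym_ideal_ideal[OF Z])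
  let ?p = "\<lambda>n. word_poly E0 n (\<lambda>es. word_diff E dg d es f)"
  have "\<pi> (\<Sum>n<N. ?p n) \<in> Sym_ideal W Z" for N
  proof (induction N)
    case 0
    then show ?case by (simp add: \<pi>_zero)
  next
    case (Suc N)
    then show ?case using word_poly_diff_ideal[OF assms]
      by (simp add: \<pi>_add poly_carrier_sum word_poly_car)
  qed
  then show ?thesis by (simp add: word_prod_def)
qed

end

section \<open>Exactness of minimal complexes over symmetric algebras\<close>

lemma regular_module_simps [simp]:
  "carrier (regular_module R) = carrier R"
  "x \<oplus>\<^bsub>regular_module R\<^esub> y = x \<oplus>\<^bsub>R\<^esub> y"
  "\<zero>\<^bsub>regular_module R\<^esub> = \<zero>\<^bsub>R\<^esub>"
  by (simp_all add: regular_module_def)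

lemma abelian_group_regular_module:
  assumes "ring R"
  shows "abelian_group (regular_module R)"
proof -
  interpret ring R by (fact assms)
  show ?thesis
  proof (rule abelian_groupI, goal_cases)
    case (6 x)
    then show ?case by (intro bexI[of _ "\<ominus>\<^bsub>R\<^esub> x"]) (auto simp: l_neg)
  qed (auto simp: a_ac)
qed

text \<open>\<open>ps e\<close> is the position of a basis letter, and \<open>join\<close> combines
  the positions of letters to that of a word; \<open>rk_join\<close> with \<open>rk_ps\<close>
  bounds its rank by the degree. By \<open>Z_boundary\<close>, multiplication sends boundaries over
  an atom \<open>a\<close> into the ideal of \<open>Z a\<close>. By \<open>Z_span\<close>, the
  elements of \<open>Z a\<close> are boundaries of chains over \<open>a\<close>, so that
  \<open>p\<close> kills them.\<close>

locale sym_koszul = ranked_order L + word_complex E dg d + sym_words W sc E0 co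
  for L :: "('a, 'y) ranked_poset_scheme"
    and E :: "'m::ab_group_add set" and dg :: "'m \<Rightarrow> nat" and d :: "'m \<Rightarrow> 'm \<Rightarrow> 'k::field_char_0"
    and W :: "('k, 'm) module" and sc E0 co +
  fixes ps :: "'m \<Rightarrow> 'a" and join :: "'a \<Rightarrow> 'a \<Rightarrow> 'a" and bot top :: 'a and Z :: "'a \<Rightarrow> 'm set"
  assumes E0_eq: "E0 = {e \<in> E. dg e = 0}"
    and bot: "bot \<in> carrier L" "rk L bot = 0" "x \<in> carrier L \<Longrightarrow> bot \<sqsubseteq>\<^bsub>L\<^esub> x"
    and top: "top \<in> carrier L" "x \<in> carrier L \<Longrightarrow> x \<sqsubseteq>\<^bsub>L\<^esub> top"
    and join_carrier: "x \<in> carrier L \<Longrightarrow> y \<in> carrier L \<Longrightarrow> join x y \<in> carrier L"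
    and join_le: "x \<in> carrier L \<Longrightarrow> y \<in> carrier L \<Longrightarrow> z \<in> carrier L \<Longrightarrow>
      join x y \<sqsubseteq>\<^bsub>L\<^esub> z \<longleftrightarrow> x \<sqsubseteq>\<^bsub>L\<^esub> z \<and> y \<sqsubseteq>\<^bsub>L\<^esub> z"
    and rk_join: "x \<in> carrier L \<Longrightarrow> y \<in> carrier L \<Longrightarrow> rk L (join x y) \<le> rk L x + rk L y"
    and ps_carrier: "e \<in> E \<Longrightarrow> ps e \<in> carrier L"
    and rk_ps: "e \<in> E \<Longrightarrow> rk L (ps e) \<le> dg e"
    and rk_ps_pos: "e \<in> E \<Longrightarrow> 0 < dg e \<Longrightarrow> 0 < rk L (ps e)"
    and d_ps: "d e e' \<noteq> 0 \<Longrightarrow> ps e \<sqsubseteq>\<^bsub>L\<^esub> ps e'"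
    and exact: "y \<in> carrier L \<Longrightarrow> (\<And>e. g e \<noteq> 0 \<Longrightarrow> e \<in> E \<and> ps e \<sqsubseteq>\<^bsub>L\<^esub> y \<and> dg e = Suc i) \<Longrightarrow>
      (\<And>e. matvec E d g e = 0) \<Longrightarrow>
      \<exists>g'. (\<forall>e. g' e \<noteq> 0 \<longrightarrow> e \<in> E \<and> ps e \<sqsubseteq>\<^bsub>L\<^esub> y \<and> dg e = Suc (Suc i)) \<and> matvec E d g' = g"
    and Z_carrier: "a \<in> level L 1 \<Longrightarrow> Z a \<subseteq> carrier W"
    and Z_boundary: "a \<in> level L 1 \<Longrightarrow> e \<in> E \<Longrightarrow> dg e = 1 \<Longrightarrow> ps e \<sqsubseteq>\<^bsub>L\<^esub> a \<Longrightarrow>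
      (\<Sum>e'\<in>E0. sc (d e' e) e') \<in> Z a"
    and Z_span: "a \<in> level L 1 \<Longrightarrow> u \<in> Z a \<Longrightarrow>
      \<exists>c. (\<forall>e. c e \<noteq> 0 \<longrightarrow> e \<in> E \<and> ps e \<sqsubseteq>\<^bsub>L\<^esub> a) \<and> (\<forall>e\<in>E0. co e u = matvec E d c e)"
begin

definition below_basis :: "'a \<Rightarrow> 'm set" where
  "below_basis y = {e \<in> E. ps e \<sqsubseteq>\<^bsub>L\<^esub> y}"

lemma below_basis_mono: "x \<sqsubseteq>\<^bsub>L\<^esub> y \<Longrightarrow> below_basis x \<subseteq> below_basis y"
  by (auto simp: below_basis_def intro: le_trans)

lemma d_below_basis: "d e e' \<noteq> 0 \<Longrightarrow> e' \<in> below_basis y \<Longrightarrow> e \<in> below_basis y"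
  using d_E[of e e'] d_ps[of e e'] by (auto simp: below_basis_def intro: le_trans)

definition posn :: "'m list \<Rightarrow> 'a" where
  "posn es = foldr (\<lambda>e z. join (ps e) z) es bot"

lemma posn:
  assumes "set es \<subseteq> E"
  shows "posn es \<in> carrier L" "rk L (posn es) \<le> word_deg dg es"
    "y \<in> carrier L \<Longrightarrow> posn es \<sqsubseteq>\<^bsub>L\<^esub> y \<longleftrightarrow> set es \<subseteq> below_basis y"
proof -
  have "posn es \<in> carrier L \<and> rk L (posn es) \<le> word_deg dg es \<and>
    (y \<in> carrier L \<longrightarrow> posn es \<sqsubseteq>\<^bsub>L\<^esub> y \<longleftrightarrow> set es \<subseteq> below_basis y)"
    using assms
  proof (induction es)
    case Nil
    then show ?case by (simp add: posn_def bot)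
  next
    case (Cons e es)
    then have e: "e \<in> E" "ps e \<in> carrier L" "posn es \<in> carrier L" using ps_carrier by auto
    have eq: "posn (e # es) = join (ps e) (posn es)" by (simp add: posn_def)
    show ?case
      unfolding eq using Cons join_carrier[OF e(2,3)] rk_join[OF e(2,3)] rk_ps[OF e(1)] join_le[OF e(2,3), of y] e
      by (auto simp: below_basis_def)
  qed
  then show "posn es \<in> carrier L" "rk L (posn es) \<le> word_deg dg es"
    "y \<in> carrier L \<Longrightarrow> posn es \<sqsubseteq>\<^bsub>L\<^esub> y \<longleftrightarrow> set es \<subseteq> below_basis y" by auto
qed

definition words :: "('m list \<Rightarrow> 'k) set" where
  "words = {f. \<exists>n. words_bounded f n}"

definition words_at :: "nat \<Rightarrow> 'a \<Rightarrow> ('m list \<Rightarrow> 'k) set" where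
  "words_at i y = {f \<in> words. \<forall>t. f t \<noteq> 0 \<longrightarrow> set t \<subseteq> below_basis y \<and> word_deg dg t = i}"

definition words_part :: "'a \<Rightarrow> ('m list \<Rightarrow> 'k) \<Rightarrow> 'm list \<Rightarrow> 'k" where
  "words_part x f = (\<lambda>t. if posn t = x then f t else 0)"

lemma words_atD: "f \<in> words_at i y \<Longrightarrow> f t \<noteq> 0 \<Longrightarrow> set t \<subseteq> below_basis y \<and> word_deg dg t = i \<and> set t \<subseteq> E"
  by (auto simp: words_at_def below_basis_def)

lemma words_boundedI:
  assumes "f \<in> words" "\<And>es. g es \<noteq> 0 \<Longrightarrow> \<exists>t. f t \<noteq> 0 \<and> length t = length es"
  shows "g \<in> words"
proof -
  from assms(1) obtain n where n: "words_bounded f n" by (auto simp: words_def)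
  have "g es = 0" if "n \<le> length es" for es
  proof (rule ccontr)
    assume "g es \<noteq> 0"
    from assms(2)[OF this] obtain t where "f t \<noteq> 0" "length t = length es" by blast
    with n that show False by (simp add: words_bounded_def)
  qed
  then have "words_bounded g n" by (simp add: words_bounded_def)
  then show ?thesis by (auto simp: words_def)
qed

lemma words_at_words: "f \<in> words_at i y \<Longrightarrow> f \<in> words"
  by (simp add: words_at_def)

text \<open>Shaped to take the witnesses of both \<open>wd_witness\<close> and
  \<open>wh_witness\<close>: equal length gives boundedness, the other two clauses give degree and
  position.\<close>

lemma words_atI:
  assumes f: "f \<in> words_at j y"
    and g: "\<And>es. g es \<noteq> 0 \<Longrightarrow> \<exists>t. f t \<noteq> 0 \<and> length t = length es \<and>
      (word_deg dg t = j \<longrightarrow> word_deg dg es = i) \<and> (set t \<subseteq> below_basis y \<longrightarrow> set es \<subseteq> below_basis y)"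
  shows "g \<in> words_at i y"
proof -
  have "g \<in> words"
    using words_at_words[OF f] by (rule words_boundedI) (use g in blast)
  moreover have "set es \<subseteq> below_basis y \<and> word_deg dg es = i" if "g es \<noteq> 0" for es
  proof -
    from g[OF that] obtain t where "f t \<noteq> 0" "word_deg dg t = j \<longrightarrow> word_deg dg es = i"
      "set t \<subseteq> below_basis y \<longrightarrow> set es \<subseteq> below_basis y" by blast
    with words_atD[OF f] show ?thesis by blast
  qed
  ultimately show ?thesis by (simp add: words_at_def)
qed

lemma words_add: "f \<in> words \<Longrightarrow> g \<in> words \<Longrightarrow> f + g \<in> words"
proof -
  assume "f \<in> words" "g \<in> words"
  then obtain m n where "words_bounded f m" "words_bounded g n" by (auto simp: words_def)
  then have "words_bounded (f + g) (max m n)" by (simp add: words_bounded_def)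
  then show ?thesis by (auto simp: words_def)
qed

lemma exists_homotopy:
  assumes y: "y \<in> carrier L"
  shows "\<exists>h p. word_homotopy E dg d (below_basis y) h p"
proof -
  have ex: "\<exists>g'. (\<forall>e. g' e \<noteq> 0 \<longrightarrow> e \<in> below_basis y \<and> dg e = Suc (Suc i)) \<and> matvec E d g' = g"
    if "\<And>e. g e \<noteq> 0 \<Longrightarrow> e \<in> below_basis y \<and> dg e = Suc i" "\<And>e. matvec E d g e = 0" for i g
    using exact[OF y, of g i] that unfolding below_basis_def by auto
  have "\<exists>h p. (\<forall>e e'. h e e' \<noteq> 0 \<longrightarrow> e \<in> below_basis y \<and> e' \<in> below_basis y \<and> dg e = Suc (dg e')) \<and>
    (\<forall>e e'. p e e' \<noteq> 0 \<longrightarrow> e \<in> below_basis y \<and> e' \<in> below_basis y \<and> dg e = 0 \<and> dg e' = 0) \<and>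
    (\<forall>e\<in>below_basis y. \<forall>e'\<in>below_basis y.
       matmul E d h e e' + matmul E h d e e' = (if e = e' then 1 else 0) - p e e') \<and>
    (\<forall>e. \<forall>e'\<in>below_basis y. matmul E p d e e' = 0)"
    by (rule exact_imp_homotopy[OF finite_E _ _ _ d_d ex])
      (use d_E d_below_basis in \<open>auto simp: below_basis_def\<close>)
  then obtain h p where hp:
    "\<And>e e'. h e e' \<noteq> 0 \<Longrightarrow> e \<in> below_basis y \<and> e' \<in> below_basis y \<and> dg e = Suc (dg e')"
    "\<And>e e'. p e e' \<noteq> 0 \<Longrightarrow> e \<in> below_basis y \<and> e' \<in> below_basis y \<and> dg e = 0 \<and> dg e' = 0"
    "\<And>e e'. e \<in> below_basis y \<Longrightarrow> e' \<in> below_basis y \<Longrightarrow>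
       matmul E d h e e' + matmul E h d e e' = (if e = e' then 1 else 0) - p e e'"
    "\<And>e e'. e' \<in> below_basis y \<Longrightarrow> matmul E p d e e' = 0"
    by blast
  have "word_homotopy E dg d (below_basis y) h p"
    by unfold_locales (use hp in \<open>auto simp: below_basis_def\<close>)
  then show ?thesis by blast
qed

lemma wd_words_at:
  assumes y: "y \<in> carrier L" and f: "f \<in> words_at (Suc i) y"
  shows "(\<lambda>es. wd es f) \<in> words_at i y"
proof -
  show ?thesis
  proof (rule words_atI[OF f])
    fix es assume "wd es f \<noteq> 0"
    from wd_witness[OF this] obtain t where t: "f t \<noteq> 0" "length t = length es"
      "word_deg dg t = Suc (word_deg dg es)"
      "\<And>B. set t \<subseteq> B \<and> (\<forall>e e'. d e e' \<noteq> 0 \<longrightarrow> e' \<in> B \<longrightarrow> e \<in> B) \<Longrightarrow> set es \<subseteq> B" by blast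
    have "set t \<subseteq> below_basis y \<longrightarrow> set es \<subseteq> below_basis y"
      using t(4)[of "below_basis y"] d_below_basis by blast
    with t show "\<exists>t. f t \<noteq> 0 \<and> length t = length es \<and>
      (word_deg dg t = Suc i \<longrightarrow> word_deg dg es = i) \<and> (set t \<subseteq> below_basis y \<longrightarrow> set es \<subseteq> below_basis y)"
      by (intro exI[of _ t]) simp
  qed
qed

theorem exact_minimal_complex_Sym:
  "exact_complex L (minimal_complex L (regular_module (Sym W)) (\<lambda>a. Sym_ideal W (Z a)))"
proof -
  obtain h p where "\<And>y. y \<in> carrier L \<Longrightarrow> word_homotopy E dg d (below_basis y) (h y) (p y)"
    using exists_homotopy by metis
  note WH = this
  let ?H = "\<lambda>y f es. word_htpy E (h y) (p y) es f" and ?D = "\<lambda>f es. wd es f"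
  have H_words_at: "?H y f \<in> words_at (Suc i) y" if y: "y \<in> carrier L" and f: "f \<in> words_at i y" for y f i
  proof -
    interpret word_homotopy E dg d "below_basis y" "h y" "p y" by (rule WH[OF y])
    show ?thesis
    proof (rule words_atI[OF f])
      fix es assume "wh es f \<noteq> 0"
      from wh_witness[OF this] show "\<exists>t. f t \<noteq> 0 \<and> length t = length es \<and>
        (word_deg dg t = i \<longrightarrow> word_deg dg es = Suc i) \<and> (set t \<subseteq> below_basis y \<longrightarrow> set es \<subseteq> below_basis y)"
        by metis
    qed
  qed
  have htpy: "?D (?H y f) = f"
    if y: "y \<in> carrier L" and f: "f \<in> words_at i y" and Df: "?D f = 0"
      and pf: "\<And>es. word_map E (p y) es f = 0" for y f i
  proof
    fix es
    interpret word_homotopy E dg d "below_basis y" "h y" "p y" by (rule WH[OF y])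
    show "?D (?H y f) es = f es"
    proof (cases "set es \<subseteq> below_basis y")
      case True
      have "wd es (\<lambda>t. wh t f) + wh es (\<lambda>t. wd t f) = f es - word_map E (p y) es f"
        by (rule word_homotopy) (use True words_atD[OF f] in auto)
      moreover have "wh es (\<lambda>t. wd t f) = 0" using Df by (simp add: fun_eq_iff zero_fun_def)
      ultimately show ?thesis using pf by simp
    next
      case False
      then have "f es = 0" "?D (?H y f) es = 0"
        using words_atD[OF f, of es] words_atD[OF wd_words_at[OF y H_words_at[OF y f]], of es] by blast+
      then show ?thesis by simp
    qed
  qed
  \<comment> \<open>A word of positive degree contains a letter of positive degree, on which
    \<open>p\<close> is zero.\<close>
  have pmap0: "word_map E (p y) es f = 0" if y: "y \<in> carrier L" and f: "f \<in> words_at (Suc i) y" for y f i es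
  proof -
    interpret word_homotopy E dg d "below_basis y" "h y" "p y" by (rule WH[OF y])
    have *: "word_map E (p y) es f = 0" if "\<And>t. f t \<noteq> 0 \<Longrightarrow> word_deg dg t \<noteq> 0" for f
      using that
    proof (induction es arbitrary: f)
      case Nil
      then show ?case by force
    next
      case (Cons e es)
      have "p y e e' * word_map E (p y) es (\<lambda>t. f (e' # t)) = 0" for e'
      proof (cases "p y e e' = 0")
        case False
        then have "dg e' = 0" using p_B[of e e'] by blast
        then have "word_deg dg t \<noteq> 0" if "f (e' # t) \<noteq> 0" for t using Cons.prems[OF that] by simp
        then have "word_map E (p y) es (\<lambda>t. f (e' # t)) = 0" by (rule Cons.IH)
        then show ?thesis by simp
      qed simp
      then show ?case by (simp only: word_map.simps sum.neutral_const)
    qed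
    show ?thesis
    proof (rule *)
      show "word_deg dg t \<noteq> 0" if "f t \<noteq> 0" for t
        using words_atD[OF f that] by (metis nat.distinct(1))
    qed
  qed
  \<comment> \<open>A differential of a word of degree 0 would have negative degree.\<close>
  have deg0: "?D f = 0" if "f \<in> words_at 0 y" for f y
  proof
    fix es show "?D f es = 0 es"
    proof (rule ccontr)
      assume "\<not> ?thesis"
      then obtain t where "f t \<noteq> 0" "word_deg dg t = Suc (word_deg dg es)"
        using wd_witness[of es f] by auto
      with words_atD[OF that] show False by fastforce
    qed
  qed
  have sym_words_at: "sym_word u \<in> words_at 0 y" if y: "y \<in> carrier L" and u: "u \<in> carrier (Sym W)" for u y
  proof -
    have E0_y: "e \<in> below_basis y \<and> dg e = 0" if "e \<in> E0" for e
    proof -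
      have e: "e \<in> E" "dg e = 0" using that E0_eq by auto
      \<comment> \<open>A letter of degree 0 has a position of rank 0, hence the least one, and so
        is available over every \<open>y\<close>.\<close>
      have "ps e = bot"
        using rk_less[OF bot(1) ps_carrier[OF e(1)] bot(3)[OF ps_carrier[OF e(1)]]] rk_ps[OF e(1)] e by auto
      with e y show ?thesis by (auto simp: below_basis_def bot)
    qed
    have "set t \<subseteq> below_basis y \<and> word_deg dg t = 0" if "sym_word u t \<noteq> 0" for t
    proof -
      have "set t \<subseteq> E0" using sym_word_outside[OF u that] .
      then show ?thesis using E0_y by (auto simp: sum_list_eq_0_iff)
    qed
    moreover have "sym_word u \<in> words"
      using sym_word_bounded[OF u] by (simp add: words_def words_bounded_def)
    ultimately show ?thesis by (simp add: words_at_def)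
  qed
  interpret RM: abelian_group "regular_module (Sym W)"
    by (rule abelian_group_regular_module) (rule S.ring_axioms)
  have Zc: "Sym_ideal W (Z a) \<subseteq> carrier (Sym W)" if "a \<in> level L 1" for a
    using Sym_ideal_ideal(1)[OF Z_carrier[OF that]] by (auto dest: ideal.Icarr)
  interpret K: koszul_retract L "regular_module (Sym W)" "list_module (regular_module (Sym W))"
    "\<lambda>a. Sym_ideal W (Z a)" words words_at words_part ?D ?H word_prod sym_word top
  proof unfold_locales
    show "0 \<in> words" by (auto simp: words_def words_bounded_def)
    show "0 \<in> words_at i y" for i y by (auto simp: words_at_def words_def words_bounded_def)
    show "?D f \<in> words" if "f \<in> words" for f
      using that
    proof (rule words_boundedI)
      fix es assume "wd es f \<noteq> 0"
      from wd_witness[OF this] show "\<exists>t. f t \<noteq> 0 \<and> length t = length es" by auto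
    qed
    show "words_part x f \<in> words" if "f \<in> words" for x f
      using that by (rule words_boundedI) (auto simp: words_part_def split: if_splits)
    show "f + g \<in> words_at i y" if "f \<in> words_at i y" "g \<in> words_at i y" for f g i y
          proof -
      have "f + g \<in> words" using that by (intro words_add) (auto simp: words_at_def)
      moreover have "set t \<subseteq> below_basis y \<and> word_deg dg t = i" if "(f + g) t \<noteq> 0" for t
      proof (cases "f t = 0")
        case True
        with that have "g t \<noteq> 0" by simp
        then show ?thesis using words_atD \<open>g \<in> words_at i y\<close> by blast
      qed (use words_atD \<open>f \<in> words_at i y\<close> in blast)
      ultimately show ?thesis by (simp add: words_at_def)
    qed
    show "words_at i x \<subseteq> words_at i y" if "x \<sqsubseteq>\<^bsub>L\<^esub> y" for x y i
      using below_basis_mono[OF that] by (auto simp: words_at_def)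
    show "words_at 1 z \<subseteq> {0}" if z: "z \<in> carrier L" "rk L z = 0" for z
    proof
      fix f assume f: "f \<in> words_at 1 z"
      have "f t = 0" for t
      proof (rule ccontr)
        assume "f t \<noteq> 0"
        from words_atD[OF f this] have t: "set t \<subseteq> below_basis z" "word_deg dg t = 1" by auto
        \<comment> \<open>Such a letter has a position of positive rank by \<open>rk_ps_pos\<close>,
          which cannot lie below \<open>z\<close>.\<close>
        have "\<exists>e\<in>set t. dg e \<noteq> 0"
        proof (rule ccontr)
          assume "\<not> ?thesis"
          then have "word_deg dg t = 0" by (simp add: sum_list_eq_0_iff)
          with t(2) show False by simp
        qed
        then obtain e where "e \<in> set t" "dg e \<noteq> 0" by blast
        with t have "e \<in> E" "ps e \<sqsubseteq>\<^bsub>L\<^esub> z" "0 < rk L (ps e)"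
          using rk_ps_pos by (auto simp: below_basis_def)
        with z show False using rk_less[OF ps_carrier z(1)] by (cases "ps e = z") auto
      qed
      then show "f \<in> {0}" by auto
    qed
    show "?D (f + g) = ?D f + ?D g" for f g
      by (auto simp: plus_fun_def word_diff_add)
    show "?H y (f + g) = ?H y f + ?H y g" for y f g
      by (auto simp: plus_fun_def word_htpy_add)
    show "?D f \<in> words_at i y" if "y \<in> carrier L" "f \<in> words_at (Suc i) y" for f i y
      using that by (rule wd_words_at)
    show "?D (?D f) = 0" for f by (auto simp: wd_wd)
    show "?H y f \<in> words_at (Suc i) y" if "y \<in> carrier L" "f \<in> words_at i y" for y f i
      using that by (rule H_words_at)
    show "?D (?H y f) = f" if "y \<in> carrier L" "f \<in> words_at (Suc i) y" "?D f = 0" for y f i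
      using htpy[OF that] pmap0[OF that(1,2)] by blast
    show "words_part x (f + g) = words_part x f + words_part x g" for x f g
      by (auto simp: words_part_def)
    show "words_part x f \<in> words_at i x" if x: "x \<in> carrier L" and f: "f \<in> words_at i y" for x y i f
    proof -
      have "words_part x f \<in> words"
        using words_at_words[OF f] by (rule words_boundedI) (auto simp: words_part_def split: if_splits)
      moreover have "set t \<subseteq> below_basis x \<and> word_deg dg t = i" if "words_part x f t \<noteq> 0" for t
      proof -
        have t: "f t \<noteq> 0" "posn t = x" using that by (auto simp: words_part_def split: if_splits)
        note t' = words_atD[OF f t(1)]
        then have "posn t \<sqsubseteq>\<^bsub>L\<^esub> x \<longleftrightarrow> set t \<subseteq> below_basis x" using posn(3)[of t x] x by blast
        with t t' le_refl[OF x] show ?thesis by blast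
      qed
      ultimately show ?thesis by (simp add: words_at_def)
    qed
    show "words_part x f = 0" if y: "y \<in> carrier L" and f: "f \<in> words_at i y" and xy: "\<not> x \<sqsubseteq>\<^bsub>L\<^esub> y" for x y i f
    proof
      fix t
      have "f t = 0" if "posn t = x"
        using words_atD[OF f, of t] posn(3)[of t y] y xy that by blast
      then show "words_part x f t = 0 t" by (simp add: words_part_def)
    qed
    show "(\<Sum>z | z \<in> carrier L \<and> z \<sqsubseteq>\<^bsub>L\<^esub> y \<and> rk L z \<le> i. words_part z f) = f"
      if y: "y \<in> carrier L" and f: "f \<in> words_at i y" for y f i
    proof
      fix t
      let ?S = "{z. z \<in> carrier L \<and> z \<sqsubseteq>\<^bsub>L\<^esub> y \<and> rk L z \<le> i}"
      have fin: "finite ?S" using finite_L by simp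
      have "(\<Sum>z\<in>?S. words_part z f) t = (if posn t \<in> ?S then f t else 0)"
        unfolding sum_fun_apply words_part_def using fin by (simp add: sum.delta')
      also have "\<dots> = f t"
      proof (cases "f t = 0")
        case False
        note t = words_atD[OF f this]
        then have "posn t \<in> ?S" using posn(1,2)[of t] posn(3)[of t y] y by auto
        then show ?thesis by simp
      qed simp
      finally show "(\<Sum>z\<in>?S. words_part z f) t = f t" .
    qed
    show "word_prod (f + g) = word_prod f \<oplus>\<^bsub>regular_module (Sym W)\<^esub> word_prod g"
      if "f \<in> words" "g \<in> words" for f g
      using that word_prod_add by (auto simp: words_def plus_fun_def)
    show "word_prod (?D f) \<in> Sym_ideal W (Z a)" if a: "a \<in> level L 1" and f: "f \<in> words_at 1 a" for f a
    proof (rule word_prod_diff_ideal[OF E0_eq _ Z_carrier[OF a], where B = "{e \<in> E. dg e = 1 \<and> ps e \<sqsubseteq>\<^bsub>L\<^esub> a}"])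
      show "set t \<subseteq> E \<and> word_deg dg t = 1 \<and> {e \<in> set t. dg e = 1} \<subseteq> {e \<in> E. dg e = 1 \<and> ps e \<sqsubseteq>\<^bsub>L\<^esub> a}"
        if "f t \<noteq> 0" for t
        using words_atD[OF f that] by (auto simp: below_basis_def)
    qed (use d_E Z_boundary[OF a] in auto)
    show "sym_word (u \<oplus>\<^bsub>regular_module (Sym W)\<^esub> v) = sym_word u + sym_word v"
      if "u \<in> carrier (regular_module (Sym W))" "v \<in> carrier (regular_module (Sym W))" for u v
      using that sym_word_add by (auto simp: plus_fun_def)
    show "?D (?H a (sym_word u)) = sym_word u" if a: "a \<in> level L 1" and u: "u \<in> Sym_ideal W (Z a)" for a u
    proof -
      have ac: "a \<in> carrier L" using a by (rule level_carrier)
      interpret word_homotopy E dg d "below_basis a" "h a" "p a" by (rule WH[OF ac])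
      have uc: "u \<in> carrier (Sym W)" using Zc[OF a] u by blast
      \<comment> \<open>The element \<open>x\<close> is the boundary of a chain over
        \<open>a\<close>, where p d = 0. Hence the error term of the homotopy vanishes on the
        symmetrization of the ideal.\<close>
      have "(\<Sum>e'\<in>E. p a e e' * co e' x) = 0" if x: "x \<in> Z a" for x e
      proof -
        obtain c where c: "\<And>e. c e \<noteq> 0 \<Longrightarrow> e \<in> below_basis a" "\<And>e. e \<in> E0 \<Longrightarrow> co e x = matvec E d c e"
          using Z_span[OF a x] by (auto simp: below_basis_def)
        \<comment> \<open>The boundary formula for coordinates holds at basis elements of
          \<open>E0\<close>; at all others \<open>p\<close> has a zero column.\<close>
        have "p a e e' * co e' x = p a e e' * matvec E d c e'" if "e' \<in> E" for e'
          using that c(2)[of e'] p_B[of e e'] E0_eq by (cases "p a e e' = 0") auto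
        then have "(\<Sum>e'\<in>E. p a e e' * co e' x) = (\<Sum>e'\<in>E. \<Sum>f\<in>E. p a e e' * d e' f * c f)"
          by (simp add: matvec_def sum_distrib_left mult.assoc)
        also have "\<dots> = (\<Sum>f\<in>E. matmul E (p a) d e f * c f)"
          by (subst sum.swap) (simp add: matmul_def sum_distrib_right)
        also have "\<dots> = 0"
        proof (rule sum.neutral, rule ballI)
          fix f show "matmul E (p a) d e f * c f = 0" using c(1)[of f] p_d[of f e] by (cases "c f = 0") auto
        qed
        finally show ?thesis .
      qed
      then have "word_map E (p a) es (sym_word u) = 0" for es
        using word_map_sym_word_ideal[OF Z_carrier[OF a] _ u] by blast
      then show ?thesis
        using htpy[OF ac sym_words_at[OF ac uc] deg0[OF sym_words_at[OF ac uc]]] by blast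
    qed
    show "Sym_ideal W (Z a) \<subseteq> carrier (regular_module (Sym W))" if "a \<in> level L 1" for a
      using Zc[OF that] by simp
    show "words_at i y \<subseteq> words" for i y by (auto simp: words_at_def)
    show "f + g \<in> words" if "f \<in> words" "g \<in> words" for f g using that by (rule words_add)
    show "top \<in> carrier L" by (rule top)
    show "x \<sqsubseteq>\<^bsub>L\<^esub> top" if "x \<in> carrier L" for x using that by (rule top)
    show "word_prod f \<in> carrier (regular_module (Sym W))" for f by (simp add: word_prod_carrier)
    show "sym_word u \<in> words_at 0 y" if "y \<in> carrier L" "u \<in> carrier (regular_module (Sym W))" for y u
      using that by (intro sym_words_at) auto
    show "word_prod (sym_word u) = u" if "u \<in> carrier (regular_module (Sym W))" for u
      using that by (intro word_prod_sym_word) auto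
  qed
  show ?thesis by (rule K.exact_minimal_complex)
qed

end

section \<open>Dimension counts inside a finitely generated span\<close>

context vector_space begin

text \<open>Functionals are vectors of the space of all functions on \<open>'u\<close>, which need
  not be finite-dimensional. Comparisons of \<open>dim\<close> are therefore made inside the span of
  a finite set \<open>C\<close>.\<close>

lemma dim_mono_finite:
  assumes "S \<subseteq> T" "T \<subseteq> span C" "finite C"
  shows "dim S \<le> dim T"
proof -
  obtain B where B: "B \<subseteq> T" "independent B" "T \<subseteq> span B" "card B = dim T"
    using basis_exists by blast
  have "finite B" using independent_span_bound[OF assms(3) B(2)] B(1) assms(2) by auto
  then show ?thesis using dim_le_card[of S B] B assms(1) by auto
qed

lemma subspace_dim_eq_finite:
  assumes "subspace S" "S \<subseteq> T" "T \<subseteq> span C" "finite C" "dim T \<le> dim S"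
  shows "S = T"
proof -
  obtain B' where B': "B' \<subseteq> S" "independent B'" "S \<subseteq> span B'" "card B' = dim S"
    using basis_exists by blast
  obtain B where B: "B' \<subseteq> B" "B \<subseteq> T" "independent B" "T \<subseteq> span B"
    using maximal_independent_subset_extend[of B' T] B' assms(2) by blast
  have "finite B" using independent_span_bound[OF assms(4) B(3)] B(2) assms(3) by auto
  moreover have "card B = dim T" using basis_card_eq_dim[OF B(2,4,3)] .
  ultimately have "B' = B" using B(1) B'(4) assms(5) by (intro card_seteq) auto
  then have "T \<subseteq> span B'" using B(4) by simp
  also have "span B' \<subseteq> S" using B'(1) assms(1) by (intro span_minimal)
  finally show ?thesis using assms(2) by auto
qed

lemma dim_insert_finite:
  assumes "subspace S" "v \<notin> S" "T \<subseteq> span (insert v S)" "insert v S \<subseteq> T" "S \<subseteq> span C" "finite C"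
  shows "dim T = Suc (dim S)"
proof -
  obtain B where B: "B \<subseteq> S" "independent B" "S \<subseteq> span B" "card B = dim S"
    using basis_exists by blast
  have fin: "finite B" using independent_span_bound[OF assms(6) B(2)] B(1) assms(5) by auto
  have span: "span B = S" using B span_minimal[OF B(1) assms(1)] by auto
  have ind: "independent (insert v B)" using B(2) assms(2) span by (intro independent_insertI) auto
  have "span (insert v S) \<subseteq> span (insert v B)"
    using B(3) span_mono[of B "insert v B"] by (intro span_minimal) (auto simp: span_base)
  then have "T \<subseteq> span (insert v B)" using assms(3) by auto
  moreover have "insert v B \<subseteq> T" using B(1) assms(4) by auto
  ultimately have "card (insert v B) = dim T" using ind by (intro basis_card_eq_dim)
  moreover have "v \<notin> B" using B(1) assms(2) by auto
  ultimately show ?thesis using fin B(4) by simp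
qed

text \<open>A vector \<open>v\<close> of \<open>x\<close> outside \<open>h\<close> spans
  \<open>E\<close> together with \<open>h\<close>. Subtracting multiples of \<open>v\<close> then
  moves any element of \<open>x\<close> into \<open>x \<inter> h\<close>.\<close>

lemma dim_Int_hyperplane:
  assumes E: "subspace E" "E \<subseteq> span C" "finite C"
    and h: "subspace h" "h \<subseteq> E" "dim h + 1 = dim E"
    and x: "subspace x" "x \<subseteq> E" "\<not> x \<subseteq> h"
  shows "dim (x \<inter> h) + 1 = dim x"
proof -
  obtain v where v: "v \<in> x" "v \<notin> h" using x(3) by auto
  have hC: "h \<subseteq> span C" using h(2) E(2) by auto
  have "dim (span (insert v h)) = Suc (dim h)"
    by (rule dim_insert_finite[OF h(1) v(2) order.refl span_superset hC E(3)])
  moreover have "span (insert v h) \<subseteq> E" using v(1) x(2) h(2) E(1) by (intro span_minimal) auto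
  ultimately have "span (insert v h) = E"
    using E h(3) by (intro subspace_dim_eq_finite[OF subspace_span _ E(2,3)]) auto
  have "x \<subseteq> span (insert v (x \<inter> h))"
  proof
    fix u assume u: "u \<in> x"
    then have "u \<in> span (insert v h)" using \<open>span (insert v h) = E\<close> x(2) by auto
    then obtain c where c: "u - scale c v \<in> h"
      using span_breakdown_eq[of u v h] span_eq_iff[THEN iffD2, OF h(1)] by auto
    moreover have "u - scale c v \<in> x" using u v(1) x(1) by (intro subspace_diff subspace_scale)
    ultimately have "u - scale c v \<in> span (insert v (x \<inter> h))" by (intro span_base) auto
    moreover have "scale c v \<in> span (insert v (x \<inter> h))" by (intro span_scale span_base) auto
    ultimately have "(u - scale c v) + scale c v \<in> span (insert v (x \<inter> h))" by (rule span_add)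
    then show "u \<in> span (insert v (x \<inter> h))" by simp
  qed
  then have "dim x = Suc (dim (x \<inter> h))"
    using v x(1) h(1) hC E(3)
    by (intro dim_insert_finite[of "x \<inter> h" v x C]) (auto intro: subspace_inter)
  then show ?thesis by simp
qed

end

section \<open>Intersection lattices and dual spaces\<close>

locale hyperplane_arr =
  fixes Es :: "('u \<Rightarrow> 'k::field) set" and \<H> :: "('u \<Rightarrow> 'k) set set" and C :: "('u \<Rightarrow> 'k) set"
  assumes Es: "module.subspace fun_scale Es" "Es \<subseteq> module.span fun_scale C" "finite C"
    and arr: "hyperplane_arrangement Es \<H>"
begin

sublocale F: vector_space "fun_scale :: 'k \<Rightarrow> ('u \<Rightarrow> 'k) \<Rightarrow> _" by (rule fun_scale_vector_space)

definition \<L> where "\<L> = intersection_lattice Es \<H>"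

lemma \<L>_simps:
  "carrier \<L> = {Es \<inter> \<Inter>\<A> | \<A>. \<A> \<subseteq> \<H>}" "eq \<L> = (=)" "x \<sqsubseteq>\<^bsub>\<L>\<^esub> y \<longleftrightarrow> y \<subseteq> x"
  "rk \<L> x = F.dim Es - F.dim x"
  by (simp_all add: \<L>_def intersection_lattice_def)

lemma Es_\<L>: "Es \<in> carrier \<L>"
  unfolding \<L>_simps by (intro CollectI exI[of _ "{}"]) auto

lemma \<L>_subspace: "x \<in> carrier \<L> \<Longrightarrow> F.subspace x"
  using arr Es(1) by (auto simp: \<L>_simps hyperplane_arrangement_def intro!: F.subspace_inter F.subspace_Inter)

lemma \<L>_subset: "x \<in> carrier \<L> \<Longrightarrow> x \<subseteq> Es"
  by (auto simp: \<L>_simps)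

lemma finite_\<L>: "finite (carrier \<L>)"
proof -
  have "carrier \<L> = (\<lambda>\<A>. Es \<inter> \<Inter>\<A>) ` Pow \<H>" by (auto simp: \<L>_simps)
  then show ?thesis using arr by (simp add: hyperplane_arrangement_def)
qed

lemma \<L>_Int: "x \<in> carrier \<L> \<Longrightarrow> y \<in> carrier \<L> \<Longrightarrow> x \<inter> y \<in> carrier \<L>"
proof -
  assume "x \<in> carrier \<L>" "y \<in> carrier \<L>"
  then obtain A B where "x = Es \<inter> \<Inter>A" "A \<subseteq> \<H>" "y = Es \<inter> \<Inter>B" "B \<subseteq> \<H>" by (auto simp: \<L>_simps)
  then show ?thesis unfolding \<L>_simps by (intro CollectI exI[of _ "A \<union> B"]) auto
qed

lemma \<L>_Inter:
  assumes "finite S" "S \<noteq> {}" "S \<subseteq> carrier \<L>"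
  shows "\<Inter>S \<in> carrier \<L>"
  using assms by (induction S rule: finite_ne_induct) (auto intro: \<L>_Int)

lemma \<H>_\<L>: "h \<in> \<H> \<Longrightarrow> h \<in> carrier \<L>"
  using arr unfolding \<L>_simps hyperplane_arrangement_def by (intro CollectI exI[of _ "{h}"]) auto

lemma dim_\<L>: "x \<in> carrier \<L> \<Longrightarrow> F.dim x \<le> F.dim Es"
  using F.dim_mono_finite[OF \<L>_subset Es(2,3)] .

lemma dim_mono_\<L>: "y \<in> carrier \<L> \<Longrightarrow> x \<subseteq> y \<Longrightarrow> F.dim x \<le> F.dim y"
  using F.dim_mono_finite[OF _ _ Es(3)] \<L>_subset Es(2) by (meson subset_trans)

lemma dim_eq_\<L>: "y \<in> carrier \<L> \<Longrightarrow> F.subspace x \<Longrightarrow> x \<subseteq> y \<Longrightarrow> F.dim y \<le> F.dim x \<Longrightarrow> x = y"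
  using F.subspace_dim_eq_finite[OF _ _ _ Es(3)] \<L>_subset Es(2) by (meson subset_trans)

lemma dim_rk: "x \<in> carrier \<L> \<Longrightarrow> F.dim x + rk \<L> x = F.dim Es"
  using dim_\<L> by (simp add: \<L>_simps)

lemma rk_mono_\<L>: "x \<in> carrier \<L> \<Longrightarrow> y \<in> carrier \<L> \<Longrightarrow> x \<subseteq> y \<Longrightarrow> rk \<L> y \<le> rk \<L> x"
  using dim_mono_\<L>[of y x] by (simp add: \<L>_simps)

lemma dim_Int_\<H>:
  assumes "h \<in> \<H>" "x \<in> carrier \<L>" "\<not> x \<subseteq> h"
  shows "F.dim (x \<inter> h) + 1 = F.dim x"
  using assms arr \<L>_subspace \<L>_subset
  by (intro F.dim_Int_hyperplane[OF Es]) (auto simp: hyperplane_arrangement_def)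

text \<open>Some hyperplane in a description of \<open>y\<close> does not contain \<open>m\<close>.
  Cutting \<open>m\<close> with it is a step of codimension one that does not lose \<open>y\<close>;
  all rank arguments walk along such steps.\<close>

lemma \<L>_step:
  assumes m: "m \<in> carrier \<L>" and y: "y \<in> carrier \<L>" and "y \<subset> m"
  shows "\<exists>h\<in>\<H>. y \<subseteq> m \<inter> h \<and> m \<inter> h \<in> carrier \<L> \<and> F.dim (m \<inter> h) + 1 = F.dim m"
proof -
  obtain A where A: "y = Es \<inter> \<Inter>A" "A \<subseteq> \<H>" using y by (auto simp: \<L>_simps)
  have "\<exists>h\<in>A. \<not> m \<subseteq> h" using A assms(3) \<L>_subset[OF m] by blast
  then obtain h where h: "h \<in> A" "\<not> m \<subseteq> h" by auto
  then have "h \<in> \<H>" using A by auto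
  then show ?thesis using h A assms(3) dim_Int_\<H>[OF _ m h(2)] \<L>_Int[OF m \<H>_\<L>] by blast
qed

lemma ranked_order_\<L>: "ranked_order \<L>"
proof
  show "finite (carrier \<L>)" by (rule finite_\<L>)
  show "eq \<L> = (=)" by (rule \<L>_simps(2))
  show "x \<sqsubseteq>\<^bsub>\<L>\<^esub> x" for x by (simp add: \<L>_simps(3))
  show "x \<sqsubseteq>\<^bsub>\<L>\<^esub> z" if "x \<sqsubseteq>\<^bsub>\<L>\<^esub> y" "y \<sqsubseteq>\<^bsub>\<L>\<^esub> z" for x y z using that by (auto simp: \<L>_simps(3))
  show "rk \<L> x < rk \<L> y" if "x \<in> carrier \<L>" "y \<in> carrier \<L>" "x \<sqsubseteq>\<^bsub>\<L>\<^esub> y" "x \<noteq> y" for x y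
  proof -
    have "y \<subseteq> x" using that(3) by (simp add: \<L>_simps(3))
    then have "\<not> F.dim x \<le> F.dim y" using dim_eq_\<L>[OF that(1) \<L>_subspace[OF that(2)]] that(4) by auto
    then show ?thesis using dim_rk[OF that(1)] dim_rk[OF that(2)] by linarith
  qed
  show "rk \<L> x = Suc (rk \<L> y)" if "covers \<L> x y" for x y
  proof -
    have xy: "x \<in> carrier \<L>" "y \<in> carrier \<L>" "x \<subset> y"
      and no: "\<And>z. z \<in> carrier \<L> \<Longrightarrow> \<not> (z \<subset> y \<and> x \<subset> z)"
      using that by (auto simp: covers_def lless_def \<L>_simps(2,3))
    obtain h where h: "h \<in> \<H>" "x \<subseteq> y \<inter> h" "y \<inter> h \<in> carrier \<L>" "F.dim (y \<inter> h) + 1 = F.dim y"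
      using \<L>_step[OF xy(2,1,3)] by blast
    then have "y \<inter> h \<noteq> y" by auto
    \<comment> \<open>One hyperplane cut already lies between \<open>y\<close> and \<open>x\<close>,
      so for a cover it must be \<open>x\<close>.\<close>
    then have "y \<inter> h = x" using no[OF h(3)] h(2) by blast
    then show ?thesis using h(4) dim_rk[OF xy(1)] dim_rk[OF xy(2)] by simp
  qed
qed

sublocale \<L>: ranked_order \<L> by (rule ranked_order_\<L>)

lemma exists_between:
  assumes "m \<in> carrier \<L>" "y \<in> carrier \<L>" "y \<subseteq> m" "rk \<L> m \<le> n" "n \<le> rk \<L> y"
  shows "\<exists>z\<in>carrier \<L>. y \<subseteq> z \<and> z \<subseteq> m \<and> rk \<L> z = n"
  using assms
proof (induction "n - rk \<L> m" arbitrary: m)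
  case 0
  then show ?case by (intro bexI[of _ m]) auto
next
  case (Suc j)
  then have "y \<noteq> m" by auto
  then obtain h where h: "h \<in> \<H>" "y \<subseteq> m \<inter> h" "m \<inter> h \<in> carrier \<L>" "F.dim (m \<inter> h) + 1 = F.dim m"
    using \<L>_step[OF Suc.prems(1,2)] Suc.prems(3) by blast
  then have r: "rk \<L> (m \<inter> h) = Suc (rk \<L> m)" using dim_rk[OF Suc.prems(1)] dim_rk[OF h(3)] by simp
  have "j = n - rk \<L> (m \<inter> h)" "rk \<L> (m \<inter> h) \<le> n" using r Suc.hyps(2) by simp_all
  from Suc.hyps(1)[OF this(1) h(3) Suc.prems(2) h(2) this(2) Suc.prems(5)]
  obtain z where "z \<in> carrier \<L>" "y \<subseteq> z" "z \<subseteq> m \<inter> h" "rk \<L> z = n" by blast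
  then show ?case by blast
qed

text \<open>Each hyperplane cut on the way from \<open>m\<close> down to \<open>y\<close> lowers the
  dimension of \<open>m\<close> by one and that of \<open>x \<inter> m\<close> by at most one. With
  \<open>m = Es\<close> this becomes the subadditivity of the rank in \<open>rk_Int\<close>.\<close>

lemma dim_Int_\<L>:
  assumes "m \<in> carrier \<L>" "y \<in> carrier \<L>" "x \<in> carrier \<L>" "y \<subseteq> m"
  shows "F.dim (x \<inter> m) + F.dim y \<le> F.dim m + F.dim (x \<inter> y)"
  using assms
proof (induction "F.dim m" arbitrary: m rule: less_induct)
  case less
  show ?case
  proof (cases "y = m")
    case False
    then obtain h where h: "h \<in> \<H>" "y \<subseteq> m \<inter> h" "m \<inter> h \<in> carrier \<L>" "F.dim (m \<inter> h) + 1 = F.dim m"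
      using \<L>_step[OF less.prems(1,2)] less.prems(4) by blast
    have IH: "F.dim (x \<inter> (m \<inter> h)) + F.dim y \<le> F.dim (m \<inter> h) + F.dim (x \<inter> y)"
      using h less by (intro less.hyps) auto
    have "F.dim (x \<inter> m) \<le> F.dim (x \<inter> (m \<inter> h)) + 1"
    proof (cases "x \<inter> m \<subseteq> h")
      case True
      then have "x \<inter> (m \<inter> h) = x \<inter> m" by auto
      then show ?thesis by simp
    next
      case False
      then show ?thesis
        using dim_Int_\<H>[OF h(1) \<L>_Int[OF less.prems(3,1)]] by (simp add: Int_assoc)
    qed
    with IH h(4) show ?thesis by linarith
  qed simp
qed

lemma rk_Int:
  assumes "x \<in> carrier \<L>" "y \<in> carrier \<L>"
  shows "rk \<L> (x \<inter> y) \<le> rk \<L> x + rk \<L> y"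
proof -
  have "x \<inter> Es = x" using \<L>_subset[OF assms(1)] by auto
  then have "F.dim x + F.dim y \<le> F.dim Es + F.dim (x \<inter> y)"
    using dim_Int_\<L>[OF Es_\<L> assms(2,1) \<L>_subset[OF assms(2)]] by simp
  then show ?thesis
    using dim_rk[OF assms(1)] dim_rk[OF assms(2)] dim_rk[OF \<L>_Int[OF assms]] by linarith
qed

end

lemma dual_space_subspace:
  assumes "vector_space scale"
  shows "module.subspace fun_scale (dual_space scale P)"
proof -
  interpret F: vector_space "fun_scale :: 'a \<Rightarrow> ('b \<Rightarrow> 'a) \<Rightarrow> _" by (rule fun_scale_vector_space)
  show ?thesis
    by (auto simp: F.subspace_def dual_space_def fun_scale_def algebra_simps)
qed

text \<open>The coordinate functionals of a basis of \<open>P\<close>, extended by zero outside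
  \<open>P\<close>, form a basis of the dual.\<close>

lemma dual_space_basis:
  fixes scale :: "'k::field \<Rightarrow> 'u::ab_group_add \<Rightarrow> 'u"
  assumes "finite_dimensional_vector_space scale Basis" and P: "module.subspace scale P"
  shows "vector_space.dim fun_scale (dual_space scale P) = vector_space.dim scale P"
    and "\<exists>C. finite C \<and> dual_space scale P \<subseteq> module.span fun_scale C"
proof -
  interpret U: finite_dimensional_vector_space scale Basis by (fact assms(1))
  interpret F: vector_space "fun_scale :: 'k \<Rightarrow> ('u \<Rightarrow> 'k) \<Rightarrow> _" by (rule fun_scale_vector_space)
  obtain B where B: "B \<subseteq> P" "U.independent B" "P \<subseteq> U.span B" "card B = U.dim P"
    using U.basis_exists by blast
  have fin: "finite B" using B(2) by (rule U.finiteI_independent)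
  have P_span: "P = U.span B" using B U.span_minimal[OF B(1) P] by auto
  define f where "f = (\<lambda>b u. if u \<in> P then U.representation B u b else 0)"
  have closed: "u + v \<in> P" "scale c u \<in> P" if "u \<in> P" "v \<in> P" for u v c
    using that P by (auto intro: U.subspace_add U.subspace_scale)
  have f_dual: "f b \<in> dual_space scale P" for b
    using closed P_span
    by (auto simp: dual_space_def f_def U.representation_add[OF B(2)] U.representation_scale[OF B(2)])
  have f_B: "f b b' = (if b' = b then 1 else 0)" if "b \<in> B" "b' \<in> B" for b b'
    using that B(1) by (auto simp: f_def U.representation_basis[OF B(2)] subset_iff)
  have inj: "inj_on f B"
  proof (rule inj_onI)
    fix b b' assume "b \<in> B" "b' \<in> B" "f b = f b'"
    then have "f b b = f b' b" by simp
    with f_B \<open>b \<in> B\<close> \<open>b' \<in> B\<close> show "b = b'" by (auto split: if_splits)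
  qed
  have span: "g \<in> F.span (f ` B)" if g: "g \<in> dual_space scale P" for g
  proof -
    have g_sum: "(\<Sum>b\<in>A. scale (c b) b) \<in> P \<and> g (\<Sum>b\<in>A. scale (c b) b) = (\<Sum>b\<in>A. c b * g b)"
      if "A \<subseteq> B" for A c
      using finite_subset[OF that fin] that
    proof (induction A)
      case empty
      have "0 \<in> P" using P by (rule U.subspace_0)
      moreover from this have "g (scale 0 0) = 0 * g 0" using g unfolding dual_space_def by blast
      ultimately show ?case by simp
    next
      case (insert b A)
      then have "b \<in> P" using B(1) by auto
      with insert g closed show ?case by (auto simp: dual_space_def)
    qed
    have "g = (\<Sum>b\<in>B. fun_scale (g b) (f b))"
    proof
      fix u show "g u = (\<Sum>b\<in>B. fun_scale (g b) (f b)) u"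
      proof (cases "u \<in> P")
        case True
        then have u: "u \<in> U.span B" using P_span by simp
        have "(\<Sum>b\<in>B. scale (U.representation B u b) b) = u"
          by (rule U.sum_representation_eq[OF B(2) u fin]) simp
        then have "g u = (\<Sum>b\<in>B. U.representation B u b * g b)"
          using g_sum[of B "U.representation B u"] by simp
        with True show ?thesis by (simp add: sum_fun_apply fun_scale_def f_def mult.commute)
      next
        case False
        with g show ?thesis by (simp add: sum_fun_apply fun_scale_def f_def dual_space_def)
      qed
    qed
    moreover have "(\<Sum>b\<in>B. fun_scale (g b) (f b)) \<in> F.span (f ` B)"
      by (intro F.span_sum F.span_scale F.span_base) auto
    ultimately show ?thesis by simp
  qed
  have "F.independent (f ` B)"
  proof (rule F.independent_if_scalars_zero)
    show "finite (f ` B)" using fin by simp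
    fix c g assume z: "(\<Sum>x\<in>f ` B. fun_scale (c x) x) = 0" and "g \<in> f ` B"
    then obtain b where b: "b \<in> B" "g = f b" by auto
    have "(\<Sum>b\<in>B. fun_scale (c (f b)) (f b)) b = 0"
      using z by (simp add: sum.reindex[OF inj])
    then have "(\<Sum>b'\<in>B. c (f b') * (if b = b' then 1 else 0)) = 0"
      using b f_B by (simp add: sum_fun_apply fun_scale_def)
    with b fin show "c g = 0" by (simp add: sum_mult_delta)
  qed
  then have "F.dim (dual_space scale P) = card (f ` B)"
    using span f_dual by (intro F.dim_unique[of "f ` B"]) auto
  then show "F.dim (dual_space scale P) = U.dim P" using B(4) card_image[OF inj] by simp
  show "\<exists>C. finite C \<and> dual_space scale P \<subseteq> F.span C"
    using span fin by (intro exI[of _ "f ` B"]) auto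
qed

text \<open>Applying \<open>pr i\<close> to a vanishing combination leaves only the part supported
  on \<open>B i\<close>. The maps are required to act as projections on the given vectors only,
  which suits projections defined by reading list heads.\<close>

lemma (in vector_space) independent_direct_family:
  assumes "finite I" and B: "\<And>i. i \<in> I \<Longrightarrow> finite (B i) \<and> independent (B i)"
    and lin: "\<And>i. Vector_Spaces.linear scale scale (pr i)"
    and same: "\<And>i e. i \<in> I \<Longrightarrow> e \<in> B i \<Longrightarrow> pr i e = e"
    and diff: "\<And>i j e. i \<in> I \<Longrightarrow> j \<in> I \<Longrightarrow> i \<noteq> j \<Longrightarrow> e \<in> B j \<Longrightarrow> pr i e = 0"
  shows "independent (\<Union>i\<in>I. B i)"
proof (rule independent_if_scalars_zero)
  show "finite (\<Union>i\<in>I. B i)" using assms by auto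
  fix c e assume z: "(\<Sum>e\<in>(\<Union>i\<in>I. B i). c e *s e) = 0" and "e \<in> (\<Union>i\<in>I. B i)"
  then obtain i where i: "i \<in> I" "e \<in> B i" by auto
  interpret pr: Vector_Spaces.linear scale scale "pr i" by (rule lin)
  have "e' \<notin> B j" if "e' \<in> B i" "j \<in> I" "j \<noteq> i" for e' j
  proof
    assume "e' \<in> B j"
    with same[OF i(1) that(1)] diff[OF i(1) that(2)] that(3) have "e' = 0" by auto
    with that(1) B[OF i(1)] dependent_zero show False by blast
  qed
  have "0 = pr i (\<Sum>e\<in>(\<Union>i\<in>I. B i). c e *s e)" using z by simp
  also have "\<dots> = (\<Sum>e\<in>(\<Union>i\<in>I. B i). c e *s pr i e)" by (simp add: pr.sum pr.scale)
  also have "\<dots> = (\<Sum>e\<in>B i. c e *s e)"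
  proof (rule sum.mono_neutral_cong_right)
    show "\<forall>e\<in>(\<Union>i\<in>I. B i) - B i. c e *s pr i e = 0"
    proof
      fix e assume "e \<in> (\<Union>i\<in>I. B i) - B i"
      then obtain j where "j \<in> I" "j \<noteq> i" "e \<in> B j" by auto
      then show "c e *s pr i e = 0" using diff[OF i(1)] by simp
    qed
  qed (use assms(1) B i same in auto)
  finally have "(\<Sum>e\<in>B i. c e *s e) = 0" by simp
  then show "c e = 0" using independentD[of "B i" "B i" c e] B[OF i(1)] i(2) by auto
qed

lemma space_module_simps [simp]:
  "carrier (space_module scale) = UNIV"
  "x \<oplus>\<^bsub>space_module scale\<^esub> y = x + y"
  "\<zero>\<^bsub>space_module scale\<^esub> = 0"
  by (simp_all add: space_module_def)

lemma abelian_group_space_module: "abelian_group (space_module scale)"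
proof (rule abelian_groupI, goal_cases)
  case (6 x)
  then show ?case by (intro bexI[of _ "- x"]) auto
qed (auto simp: ac_simps)

lemma finsum_space_module: "finite S \<Longrightarrow> finsum (space_module scale) f S = sum f S"
proof (induction S rule: finite_induct)
  case empty
  interpret abelian_group "space_module scale" by (rule abelian_group_space_module)
  show ?case by simp
next
  case (insert x S)
  interpret abelian_group "space_module scale" by (rule abelian_group_space_module)
  show ?case using insert by simp
qed

definition list_scale :: "('k \<Rightarrow> 'u \<Rightarrow> 'u) \<Rightarrow> 'k \<Rightarrow> ('a list \<Rightarrow> 'u) \<Rightarrow> 'a list \<Rightarrow> 'u" where
  "list_scale scale c w = (\<lambda>t. scale c (w t))"

lemma vector_space_list_scale:
  assumes "vector_space scale"
  shows "vector_space (list_scale scale :: _ \<Rightarrow> ('a list \<Rightarrow> 'u::ab_group_add) \<Rightarrow> _)"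
proof -
  interpret vector_space scale by (fact assms)
  show ?thesis by unfold_locales (auto simp: list_scale_def fun_eq_iff scale_right_distrib scale_left_distrib)
qed

section \<open>Minimal complexes of vector spaces\<close>

locale vec_cx = ranked_order L + U: finite_dimensional_vector_space scale Basis
  for L :: "('a, 'y) ranked_poset_scheme"
    and scale :: "'k::field \<Rightarrow> 'u::ab_group_add \<Rightarrow> 'u" and Basis :: "'u set" +
  fixes A :: "'a \<Rightarrow> 'u set" and bot :: 'a
  assumes A_subspace: "a \<in> level L 1 \<Longrightarrow> U.subspace (A a)"
    and bot: "bot \<in> carrier L" "rk L bot = 0" "x \<in> carrier L \<Longrightarrow> bot \<sqsubseteq>\<^bsub>L\<^esub> x"
begin

abbreviation "sc \<equiv> list_scale scale"

abbreviation N where "N \<equiv> list_module (space_module scale) :: ('k, 'a list \<Rightarrow> 'u) module"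

sublocale minimal_cx L "space_module scale" N A
  by (intro minimal_cx.intro list_fun_module.intro minimal_cx_axioms.intro
      abelian_group_space_module ranked_order_axioms) auto

sublocale FV: vector_space sc
  by (rule vector_space_list_scale) unfold_locales

lemma level_0: "x \<in> level L 0 \<longleftrightarrow> x = bot"
  using rk_less[of bot x] bot by (cases "bot = x") (auto simp: level_def)

lemma finsum_N_sum: "finite S \<Longrightarrow> finsum N w S = (\<Sum>x\<in>S. w x)"
  by (rule ext) (subst finsum_N, auto simp: finsum_space_module sum_fun_apply)

lemma psum_eq: "finite S \<Longrightarrow> psum i S = {\<Sum>x\<in>S. w x | w. \<forall>x\<in>S. w x \<in> minimal_piece L (space_module scale) A i x}"
  by (auto simp: sum_submodules_def finsum_N_sum Pi_def)

abbreviation piece' where "piece' i x \<equiv> minimal_piece L (space_module scale) A i x"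

lemma bd_eq: "bd i w = (\<lambda>c. \<Sum>x\<in>level L i. w (x # c))"
  by (simp add: list_diff_def finsum_space_module)

lemma bd_add: "bd i (v + w) = bd i v + bd i w"
  by (simp add: bd_eq sum.distrib fun_eq_iff)

lemma bd_scale: "bd i (sc c w) = sc c (bd i w)"
  by (simp add: bd_eq list_scale_def U.scale_sum_right)

lemma bd_sum: "bd i (sum w T) = (\<Sum>t\<in>T. bd i (w t))"
proof (induction T rule: infinite_finite_induct)
  case empty
  show ?case by (simp add: bd_eq fun_eq_iff)
next
  case (infinite T)
  then show ?case by (simp add: bd_eq fun_eq_iff)
next
  case (insert t T)
  show ?case unfolding sum.insert[OF insert.hyps(1,2)] bd_add insert.IH ..
qed

lemma root_copy_subspace:
  assumes "U.subspace Y"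
  shows "FV.subspace (root_copy (space_module scale) ` Y)"
proof -
  have "root_copy (space_module scale) 0 = 0"
    and "root_copy (space_module scale) u + root_copy (space_module scale) v = root_copy (space_module scale) (u + v)"
    and "sc c (root_copy (space_module scale) u) = root_copy (space_module scale) (scale c u)" for u v c
    by (auto simp: root_copy_def fun_eq_iff list_scale_def)
  with assms show ?thesis
    unfolding FV.subspace_def U.subspace_def by (auto simp del: plus_fun_def intro!: image_eqI)
qed

lemma psum_subspace_aux:
  assumes "finite T" "\<And>x. x \<in> T \<Longrightarrow> FV.subspace (piece' i x)"
  shows "FV.subspace (psum i T)"
  unfolding FV.subspace_def psum_eq[OF assms(1)]
proof (intro conjI ballI allI)
  show "0 \<in> {\<Sum>x\<in>T. w x | w. \<forall>x\<in>T. w x \<in> piece' i x}"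
    using assms(2) by (intro CollectI exI[of _ "\<lambda>_. 0"]) (auto intro: FV.subspace_0)
next
  fix v w assume "v \<in> {\<Sum>x\<in>T. w x | w. \<forall>x\<in>T. w x \<in> piece' i x}" "w \<in> {\<Sum>x\<in>T. w x | w. \<forall>x\<in>T. w x \<in> piece' i x}"
  then obtain f g where "v = (\<Sum>x\<in>T. f x)" "\<forall>x\<in>T. f x \<in> piece' i x" "w = (\<Sum>x\<in>T. g x)" "\<forall>x\<in>T. g x \<in> piece' i x"
    by blast
  then show "v + w \<in> {\<Sum>x\<in>T. w x | w. \<forall>x\<in>T. w x \<in> piece' i x}"
    using assms(2) by (intro CollectI exI[of _ "\<lambda>x. f x + g x"]) (auto simp: sum.distrib intro: FV.subspace_add)
next
  fix c v assume "v \<in> {\<Sum>x\<in>T. w x | w. \<forall>x\<in>T. w x \<in> piece' i x}"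
  then obtain f where "v = (\<Sum>x\<in>T. f x)" "\<forall>x\<in>T. f x \<in> piece' i x" by blast
  then show "sc c v \<in> {\<Sum>x\<in>T. w x | w. \<forall>x\<in>T. w x \<in> piece' i x}"
    using assms(2) by (intro CollectI exI[of _ "\<lambda>x. sc c (f x)"]) (auto simp: FV.scale_sum_right intro: FV.subspace_scale)
qed

lemma piece_subspace: "x \<in> level L i \<Longrightarrow> FV.subspace (piece' i x)"
proof (induction i arbitrary: x)
  case 0
  show ?case by (simp add: root_copy_subspace)
next
  case (Suc i)
  have pre: "FV.subspace (pre i x)"
  proof (cases i)
    case 0
    then show ?thesis using Suc.prems A_subspace by (simp add: pre_piece_def root_copy_subspace)
  next
    case (Suc j)
    have "FV.subspace (psum (Suc j) {y \<in> level L (Suc j). y \<sqsubseteq>\<^bsub>L\<^esub> x})"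
      using Suc.IH Suc by (intro psum_subspace_aux) auto
    moreover have "FV.subspace {w. bd (Suc j) w = 0}"
      unfolding FV.subspace_def by (auto simp: bd_add bd_scale) (simp add: bd_eq fun_eq_iff)
    ultimately have "FV.subspace (psum (Suc j) {y \<in> level L (Suc j). y \<sqsubseteq>\<^bsub>L\<^esub> x} \<inter> {w. bd (Suc j) w = 0})"
      by (rule FV.subspace_inter)
    also have "psum (Suc j) {y \<in> level L (Suc j). y \<sqsubseteq>\<^bsub>L\<^esub> x} \<inter> {w. bd (Suc j) w = 0} = pre i x"
      using Suc.prems Suc by (auto simp: pre_Suc zero_fun_def)
    finally show ?thesis .
  qed
  have "copy (space_module scale) x 0 = 0"
    and "copy (space_module scale) x u + copy (space_module scale) x v = copy (space_module scale) x (u + v)"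
    and "sc c (copy (space_module scale) x u) = copy (space_module scale) x (sc c u)" for u v c
    by (auto simp: copy_def fun_eq_iff list_scale_def split: list.split)
  with pre show ?case
    unfolding minimal_piece_Suc FV.subspace_def by (auto simp del: plus_fun_def intro!: image_eqI)
qed

lemma psum_subspace: "T \<subseteq> level L i \<Longrightarrow> FV.subspace (psum i T)"
  using piece_subspace finite_subset[OF _ finite_level] by (intro psum_subspace_aux) auto

lemma pre_zero: "x \<in> level L (Suc i) \<Longrightarrow> (\<lambda>c. 0) \<in> pre i x"
proof -
  assume x: "x \<in> level L (Suc i)"
  have "0 \<in> psum (Suc i) {x}" using psum_subspace[of "{x}" "Suc i"] x by (intro FV.subspace_0) auto
  then show ?thesis using x by (simp add: psum_Suc_iff)
qed

lemma piece_psum: "T \<subseteq> level L i \<Longrightarrow> x \<in> T \<Longrightarrow> piece' i x \<subseteq> psum i T"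
proof
  fix v assume T: "T \<subseteq> level L i" "x \<in> T" and v: "v \<in> piece' i x"
  have fin: "finite T" using finite_subset[OF T(1) finite_level] .
  have "v = (\<Sum>y\<in>T. if y = x then v else 0)" using T fin by simp
  moreover have "\<forall>y\<in>T. (if y = x then v else 0) \<in> piece' i y"
    using T v piece_subspace FV.subspace_0 by auto
  ultimately show "v \<in> psum i T"
    unfolding psum_eq[OF fin] by (intro CollectI exI[of _ "\<lambda>y. if y = x then v else 0"]) auto
qed

lemma psum_mono_set: "T \<subseteq> T' \<Longrightarrow> T' \<subseteq> level L i \<Longrightarrow> psum i T \<subseteq> psum i T'"
proof
  fix v assume T: "T \<subseteq> T'" "T' \<subseteq> level L i" and v: "v \<in> psum i T"
  have fin: "finite T" using finite_subset[OF T(1)] finite_subset[OF T(2) finite_level] by blast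
  from v obtain w where w: "v = (\<Sum>x\<in>T. w x)" "\<forall>x\<in>T. w x \<in> piece' i x" unfolding psum_eq[OF fin] by blast
  have "w x \<in> psum i T'" if "x \<in> T" for x using w(2) that piece_psum[OF T(2)] T(1) by blast
  then show "v \<in> psum i T'" unfolding w(1) by (intro FV.subspace_sum psum_subspace T(2))
qed

text \<open>A list in the support has one entry per degree and starts with the tag of its piece. So
  pieces of different degrees, too, stay independent inside the one ambient module.\<close>

lemma psum_support:
  "x \<in> level L i \<Longrightarrow> w \<in> piece' i x \<Longrightarrow> w c \<noteq> 0 \<Longrightarrow>
    length c = i \<and> set c \<subseteq> carrier L \<and> (i > 0 \<longrightarrow> hd c = x)"
proof (induction i arbitrary: x w c)
  case 0
  then show ?case by (auto simp: root_copy_def split: if_splits)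
next
  case (Suc i)
  then obtain v where v: "v \<in> pre i x" "w = copy (space_module scale) x v" by (auto simp: minimal_piece_Suc)
  then obtain c' where c: "c = x # c'" "v c' \<noteq> 0"
    using Suc.prems(3) by (cases c) (auto split: if_splits)
  have "length c' = i \<and> set c' \<subseteq> carrier L"
  proof (cases i)
    case 0
    then show ?thesis using v(1) c(2) by (auto simp: pre_piece_def root_copy_def split: if_splits)
  next
    case (Suc j)
    let ?T = "{y \<in> level L (Suc j). y \<sqsubseteq>\<^bsub>L\<^esub> x}"
    have "v \<in> psum (Suc j) ?T" using v(1) Suc Suc.prems(1) by (simp add: pre_Suc)
    then obtain f where f: "v = (\<Sum>y\<in>?T. f y)" "\<forall>y\<in>?T. f y \<in> piece' (Suc j) y"
      by (subst (asm) psum_eq) auto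
    then have "(\<Sum>y\<in>?T. f y c') \<noteq> 0" using c(2) by (simp add: sum_fun_apply)
    then obtain y where "y \<in> ?T" "f y c' \<noteq> 0" by (rule sum_nonzero_witness)
    then show ?thesis using Suc.IH[of y "f y" c'] f(2) Suc by auto
  qed
  with c Suc.prems(1) show ?case by (auto simp: level_def)
qed

text \<open>Reading the head of a list recovers the piece, in all degrees at once. Rank 0 is
  separate because its piece sits at the empty list.\<close>

definition pr :: "'a \<Rightarrow> ('a list \<Rightarrow> 'u) \<Rightarrow> 'a list \<Rightarrow> 'u" where
  "pr x w = (\<lambda>c. if rk L x = 0 then if c = [] then w c else 0
     else if c \<noteq> [] \<and> hd c = x then w c else 0)"

lemma pr_linear: "Vector_Spaces.linear sc sc (pr x)"
  by (auto simp: Vector_Spaces.linear_iff FV.vector_space_axioms pr_def list_scale_def fun_eq_iff)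

lemma pr_same: "x \<in> carrier L \<Longrightarrow> w \<in> piece' (rk L x) x \<Longrightarrow> pr x w = w"
proof
  fix c assume "x \<in> carrier L" "w \<in> piece' (rk L x) x"
  then show "pr x w c = w c"
    using psum_support[of x "rk L x" w c] by (cases "w c = 0"; cases c) (auto simp: pr_def level_def)
qed

lemma pr_diff: "x \<in> carrier L \<Longrightarrow> y \<in> carrier L \<Longrightarrow> x \<noteq> y \<Longrightarrow> w \<in> piece' (rk L y) y \<Longrightarrow> pr x w = 0"
proof
  fix c assume xy: "x \<in> carrier L" "y \<in> carrier L" "x \<noteq> y" "w \<in> piece' (rk L y) y"
  have "\<not> (rk L x = 0 \<and> rk L y = 0)" using level_0[of x] level_0[of y] xy by (auto simp: level_def)
  then show "pr x w c = 0 c"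
    using psum_support[of y "rk L y" w c] xy by (cases "w c = 0") (auto simp: pr_def level_def)
qed

lemma piece_finite_span:
  assumes "x \<in> level L i"
  shows "\<exists>C. finite C \<and> piece' i x \<subseteq> FV.span C"
proof -
  let ?single = "\<lambda>c u t. if t = c then u else (0 :: 'u)"
  let ?Ls = "{c. set c \<subseteq> carrier L \<and> length c = i}"
  let ?C = "(\<lambda>(c, b). ?single c b) ` (?Ls \<times> Basis)"
  have fin: "finite ?Ls" by (rule finite_lists_length_eq[OF finite_L])
  have single: "?single c u \<in> FV.span ?C" if c: "c \<in> ?Ls" for c u
  proof -
    have "u \<in> U.span Basis" using U.span_Basis by simp
    then show ?thesis
    proof (induction rule: U.span_induct_alt)
      case base
      have "?single c 0 = 0" by (auto simp: fun_eq_iff)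
      then show ?case using FV.span_zero by simp
    next
      case (step r b u)
      have "?single c (scale r b + u) = sc r (?single c b) + ?single c u"
        by (auto simp: fun_eq_iff list_scale_def)
      moreover have "?single c b \<in> FV.span ?C" using c step(1) by (intro FV.span_base) auto
      ultimately show ?case using step(2) by (auto intro: FV.span_add FV.span_scale)
    qed
  qed
  have "w \<in> FV.span ?C" if w: "w \<in> piece' i x" for w
  proof -
    have "w = (\<Sum>c\<in>?Ls. ?single c (w c))"
    proof
      fix t
      have "(\<Sum>c\<in>?Ls. ?single c (w c) t) = (if t \<in> ?Ls then w t else 0)"
        using fin by (simp add: sum.delta)
      also have "\<dots> = w t" using psum_support[OF assms w, of t] by auto
      finally show "w t = (\<Sum>c\<in>?Ls. ?single c (w c)) t" by (simp add: sum_fun_apply)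
    qed
    also have "\<dots> \<in> FV.span ?C" by (intro FV.span_sum single)
    finally show ?thesis .
  qed
  moreover have "finite ?C" using fin U.finite_Basis by auto
  ultimately show ?thesis by blast
qed

definition B :: "'a \<Rightarrow> ('a list \<Rightarrow> 'u) set" where
  "B x = (SOME B. B \<subseteq> piece' (rk L x) x \<and> FV.independent B \<and> piece' (rk L x) x \<subseteq> FV.span B)"

lemma B: "B x \<subseteq> piece' (rk L x) x" "FV.independent (B x)" "piece' (rk L x) x \<subseteq> FV.span (B x)"
proof -
  obtain B' where "B' \<subseteq> piece' (rk L x) x" "FV.independent B'" "piece' (rk L x) x \<subseteq> FV.span B'"
    using FV.maximal_independent_subset by blast
  then have "\<exists>B. B \<subseteq> piece' (rk L x) x \<and> FV.independent B \<and> piece' (rk L x) x \<subseteq> FV.span B" by blast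
  from someI_ex[OF this] show "B x \<subseteq> piece' (rk L x) x" "FV.independent (B x)" "piece' (rk L x) x \<subseteq> FV.span (B x)"
    unfolding B_def by auto
qed

lemma finite_B:
  assumes "x \<in> carrier L" shows "finite (B x)"
proof -
  obtain C where "finite C" "piece' (rk L x) x \<subseteq> FV.span C"
    using piece_finite_span[of x "rk L x"] assms by (auto simp: level_def)
  then show ?thesis using FV.independent_span_bound[of C "B x"] B(1,2)[of x] by blast
qed

lemma psum_span:
  assumes "T \<subseteq> level L i"
  shows "psum i T = FV.span (\<Union>x\<in>T. B x)"
proof
  have fin: "finite T" using finite_subset[OF assms finite_level] .
  have rk: "rk L x = i" if "x \<in> T" for x using assms that by (auto simp: level_def)
  show "psum i T \<subseteq> FV.span (\<Union>x\<in>T. B x)"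
  proof
    fix v assume "v \<in> psum i T"
    then obtain w where w: "v = (\<Sum>x\<in>T. w x)" "\<forall>x\<in>T. w x \<in> piece' i x" unfolding psum_eq[OF fin] by blast
    have "w x \<in> FV.span (\<Union>x\<in>T. B x)" if "x \<in> T" for x
      using w(2) that B(3)[of x] rk[OF that] FV.span_mono[of "B x" "\<Union>x\<in>T. B x"] by blast
    then show "v \<in> FV.span (\<Union>x\<in>T. B x)" unfolding w(1) by (rule FV.span_sum)
  qed
  show "FV.span (\<Union>x\<in>T. B x) \<subseteq> psum i T"
  proof (rule FV.span_minimal[OF _ psum_subspace[OF assms]])
    show "(\<Union>x\<in>T. B x) \<subseteq> psum i T"
      using piece_psum[OF assms] B(1) rk by fastforce
  qed
qed

text \<open>Consecutive entries of a list in the support descend in \<open>L\<close>, because each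
  piece is cut out of the sum over the elements it covers.\<close>

lemma psum_Suc_subset:
  assumes "x \<in> level L (Suc i)" "v \<in> psum (Suc i) T" "T \<subseteq> level L (Suc i)" "v (x # y # c) \<noteq> 0"
  shows "y \<in> level L i \<and> y \<sqsubseteq>\<^bsub>L\<^esub> x"
proof -
  have "x \<in> T" using assms by (auto simp: psum_Suc_iff)
  then have pre: "(\<lambda>c. v (x # c)) \<in> pre i x" using assms(2,3) by (simp add: psum_Suc_iff)
  show ?thesis
  proof (cases i)
    case 0
    with pre assms(4) show ?thesis by (auto simp: pre_piece_def root_copy_def fun_eq_iff)
  next
    case (Suc j)
    then have "(\<lambda>c. v (x # c)) \<in> psum (Suc j) {y \<in> level L (Suc j). y \<sqsubseteq>\<^bsub>L\<^esub> x}"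
      using pre assms(1) by (simp add: pre_Suc)
    then show ?thesis using assms(4) Suc by (subst (asm) psum_Suc_iff) auto
  qed
qed

text \<open>If \<open>\<tau>\<close> assigns to the elements of a family a common upper bound whenever they share a
  lower bound of rank \<open>k\<close>, then a cycle splits into cycles below the values of \<open>\<tau>\<close>.\<close>

lemma exact_family:
  fixes F :: "'a set" and \<tau> :: "'a \<Rightarrow> 'a"
  assumes exact: "\<And>x v i. x \<in> carrier L \<Longrightarrow> v \<in> psum (Suc i) {y \<in> level L (Suc i). y \<sqsubseteq>\<^bsub>L\<^esub> x} \<Longrightarrow>
      bd (Suc i) v = 0 \<Longrightarrow>
      \<exists>v' \<in> psum (Suc (Suc i)) {y \<in> level L (Suc (Suc i)). y \<sqsubseteq>\<^bsub>L\<^esub> x}. bd (Suc (Suc i)) v' = v"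
    and below: "\<And>y j. y \<in> level L j \<Longrightarrow> k \<le> j \<Longrightarrow> \<exists>u\<in>level L k. u \<sqsubseteq>\<^bsub>L\<^esub> y"
    and \<tau>: "\<And>x. x \<in> carrier L \<Longrightarrow> k < rk L x \<Longrightarrow> x \<in> F \<Longrightarrow> \<tau> x \<in> carrier L \<and> x \<sqsubseteq>\<^bsub>L\<^esub> \<tau> x"
    and \<tau>_closed: "\<And>x y. x \<in> carrier L \<Longrightarrow> k < rk L x \<Longrightarrow> x \<in> F \<Longrightarrow> y \<in> carrier L \<Longrightarrow> k < rk L y \<Longrightarrow>
      y \<sqsubseteq>\<^bsub>L\<^esub> \<tau> x \<Longrightarrow> y \<in> F"
    and \<tau>_eq: "\<And>x y u. x \<in> carrier L \<Longrightarrow> k < rk L x \<Longrightarrow> x \<in> F \<Longrightarrow> y \<in> carrier L \<Longrightarrow> k < rk L y \<Longrightarrow> y \<in> F \<Longrightarrow>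
      u \<in> level L k \<Longrightarrow> u \<sqsubseteq>\<^bsub>L\<^esub> x \<Longrightarrow> u \<sqsubseteq>\<^bsub>L\<^esub> y \<Longrightarrow> \<tau> x = \<tau> y"
    and i: "k \<le> i" and v: "v \<in> psum (Suc i) (level L (Suc i) \<inter> F)" and bd_v: "bd (Suc i) v = 0"
  shows "\<exists>v' \<in> psum (Suc (Suc i)) (level L (Suc (Suc i)) \<inter> F). bd (Suc (Suc i)) v' = v"
proof -
  let ?S = "level L (Suc i) \<inter> F" and ?S' = "level L (Suc (Suc i)) \<inter> F"
  have S: "x \<in> carrier L" "k < rk L x" "x \<in> F" if "x \<in> ?S" for x
    using that i by (auto simp: level_def)
  define part where "part t = (\<lambda>c. case c of [] \<Rightarrow> 0 | x # c' \<Rightarrow> if x \<in> ?S \<and> \<tau> x = t then v c else 0)" for t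
  have v_iff: "v [] = 0" "\<And>x c. x \<notin> ?S \<Longrightarrow> v (x # c) = 0" "\<And>x. x \<in> ?S \<Longrightarrow> (\<lambda>c. v (x # c)) \<in> pre i x"
    using v by (subst (asm) psum_Suc_iff; auto)+
  \<comment> \<open>Two summands can meet at the slot \<open>c\<close> of the differential only if
    both lie above the head of \<open>c\<close>, which in turn lies above an element of rank
    \<open>k\<close>.\<close>
  have common: "\<exists>u\<in>level L k. u \<sqsubseteq>\<^bsub>L\<^esub> x \<and> u \<sqsubseteq>\<^bsub>L\<^esub> y"
    if x: "x \<in> ?S" "v (x # c) \<noteq> 0" and y: "y \<in> ?S" "v (y # c) \<noteq> 0" for x y c
  proof (cases c)
    case Nil
    from v obtain f where f: "v = (\<Sum>x\<in>?S. f x)" "\<forall>x\<in>?S. f x \<in> piece' (Suc i) x" by (subst (asm) psum_eq) auto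
    from x(2) have "(\<Sum>z\<in>?S. f z (x # c)) \<noteq> 0" using f(1) by (simp add: sum_fun_apply)
    then obtain z where "z \<in> ?S" "f z (x # c) \<noteq> 0" by (rule sum_nonzero_witness)
    then have "length (x # c) = Suc i" using f(2) psum_support[of z "Suc i" "f z" "x # c"] by blast
    \<comment> \<open>An empty \<open>c\<close> means degree 1, hence \<open>k = 0\<close>, and the
      least element is the common lower bound.\<close>
    then have "k = 0" using Nil i by simp
    with below[of x "Suc i"] below[of y "Suc i"] x y level_0 show ?thesis by auto
  next
    case (Cons z c')
    have "z \<in> level L i \<and> z \<sqsubseteq>\<^bsub>L\<^esub> x" and "z \<in> level L i \<and> z \<sqsubseteq>\<^bsub>L\<^esub> y"
      using psum_Suc_subset[OF _ v] x y Cons by auto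
    with below[of z i] i show ?thesis by (meson le_trans)
  qed
  have ex: "\<exists>v' \<in> psum (Suc (Suc i)) ?S'. bd (Suc (Suc i)) v' = part t" if t: "t \<in> \<tau> ` ?S" for t
  proof -
    obtain x where x: "x \<in> ?S" "t = \<tau> x" using t by blast
    have tc: "t \<in> carrier L" using \<tau>[OF S[OF x(1)]] x(2) by simp
    have "part t \<in> psum (Suc i) {y \<in> level L (Suc i). y \<sqsubseteq>\<^bsub>L\<^esub> t}"
    proof -
      have "part t (y # c) = 0" if "\<not> (y \<in> level L (Suc i) \<and> y \<sqsubseteq>\<^bsub>L\<^esub> t)" for y c
        using that \<tau>[OF S[of y]] by (auto simp: part_def)
      moreover have "(\<lambda>c. part t (y # c)) \<in> pre i y" if "y \<in> level L (Suc i)" for y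
        using v_iff(3)[of y] pre_zero[OF that] by (cases "y \<in> ?S \<and> \<tau> y = t") (auto simp: part_def)
      moreover have "part t [] = 0" by (simp add: part_def)
      ultimately show ?thesis by (subst psum_Suc_iff) auto
    qed
    moreover have "bd (Suc i) (part t) = 0"
    proof
      fix c
      have bd_c: "(\<Sum>y\<in>level L (Suc i). v (y # c)) = 0" using bd_v by (simp add: bd_eq fun_eq_iff)
      show "bd (Suc i) (part t) c = 0 c"
      \<comment> \<open>By \<open>common\<close> and \<open>\<tau>_eq\<close> all summands
        contributing at the slot \<open>c\<close> have the same value of \<open>\<tau>\<close>. So
        \<open>part t\<close> has there either all contributions of \<open>v\<close> or none, and
        the boundary vanishes in both cases.\<close>
      proof (cases "\<exists>y\<in>?S. v (y # c) \<noteq> 0 \<and> \<tau> y = t")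
        case True
        then obtain y where y: "y \<in> ?S" "v (y # c) \<noteq> 0" "\<tau> y = t" by blast
        have "part t (z # c) = v (z # c)" for z
        proof (cases "z \<in> ?S \<and> v (z # c) \<noteq> 0")
          case True
          then obtain u where "u \<in> level L k" "u \<sqsubseteq>\<^bsub>L\<^esub> z" "u \<sqsubseteq>\<^bsub>L\<^esub> y" using common[of z c y] y by blast
          then have "\<tau> z = t" using \<tau>_eq[OF S[of z] S[OF y(1)]] True y(3) by blast
          with True show ?thesis by (simp add: part_def)
        next
          case False
          then show ?thesis using v_iff(2)[of z c] by (auto simp: part_def)
        qed
        then show ?thesis using bd_c by (simp add: bd_eq)
      next
        case False
        then have "part t (z # c) = 0" for z by (auto simp: part_def)
        then show ?thesis by (simp add: bd_eq)
      qed
    qed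
    ultimately obtain v' where v': "v' \<in> psum (Suc (Suc i)) {y \<in> level L (Suc (Suc i)). y \<sqsubseteq>\<^bsub>L\<^esub> t}"
      "bd (Suc (Suc i)) v' = part t"
      using exact[OF tc] by blast
    have "{y \<in> level L (Suc (Suc i)). y \<sqsubseteq>\<^bsub>L\<^esub> t} \<subseteq> ?S'"
    proof
      fix y assume y: "y \<in> {y \<in> level L (Suc (Suc i)). y \<sqsubseteq>\<^bsub>L\<^esub> t}"
      then have "y \<in> carrier L" "k < rk L y" using i by (auto simp: level_def)
      with y \<tau>_closed[OF S[OF x(1)], of y] x(2) show "y \<in> ?S'" by simp
    qed
    with psum_mono_set[of _ ?S'] v' show ?thesis by blast
  qed
  then obtain w where w: "\<And>t. t \<in> \<tau> ` ?S \<Longrightarrow> w t \<in> psum (Suc (Suc i)) ?S' \<and> bd (Suc (Suc i)) (w t) = part t"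
    by metis
  have "bd (Suc (Suc i)) (\<Sum>t\<in>\<tau> ` ?S. w t) = (\<Sum>t\<in>\<tau> ` ?S. part t)"
    unfolding bd_sum by (rule sum.cong) (use w in auto)
  also have "\<dots> = v"
  proof
    fix c
    show "(\<Sum>t\<in>\<tau> ` ?S. part t) c = v c"
    proof (cases c)
      case Nil
      then show ?thesis using v_iff(1) by (simp add: sum_fun_apply part_def)
    next
      case (Cons x c')
      show ?thesis
      proof (cases "x \<in> ?S")
        case True
        then have "(\<Sum>t\<in>\<tau> ` ?S. part t c) = (\<Sum>t\<in>\<tau> ` ?S. if t = \<tau> x then v c else 0)"
          using Cons by (intro sum.cong) (auto simp: part_def)
        also have "\<dots> = v c" using True by (subst sum.delta) auto
        finally show ?thesis by (simp add: sum_fun_apply)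
      next
        case False
        then have "part t c = 0" for t using Cons by (auto simp: part_def)
        with False show ?thesis using Cons v_iff(2) by (simp add: sum_fun_apply)
      qed
    qed
  qed
  finally show ?thesis
    using w by (intro bexI[of _ "\<Sum>t\<in>\<tau> ` ?S. w t"]) (auto intro!: FV.subspace_sum psum_subspace)
qed

end

section \<open>The truncated complex in coordinates\<close>

locale trunc_cx = vec_cx L scale Basis A bot
  for L :: "('a, 'y) ranked_poset_scheme"
    and scale :: "'k::field \<Rightarrow> 'u::ab_group_add \<Rightarrow> 'u" and Basis :: "'u set"
    and A :: "'a \<Rightarrow> 'u set" and bot :: 'a +
  fixes k :: nat
begin

definition "upp = {x \<in> carrier L. k \<le> rk L x}"
definition "E = (\<Union>x\<in>upp. B x)"
definition "loc e = (THE x. x \<in> upp \<and> e \<in> B x)"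
definition "dg e = rk L (loc e) - k"
text \<open>One operator for the differentials of all degrees. Summing only over ranks above
  \<open>k\<close> makes it zero on the chains of rank \<open>k\<close>, the lowest degree after
  truncation.\<close>

definition D :: "('a list \<Rightarrow> 'u) \<Rightarrow> 'a list \<Rightarrow> 'u" where
  "D w = (\<lambda>c. \<Sum>x | x \<in> carrier L \<and> k < rk L x. w (x # c))"
abbreviation "rep \<equiv> FV.representation E"
definition "d e e' = (if e' \<in> E then rep (D e') e else 0)"

lemma finite_upp: "finite upp" using finite_L by (simp add: upp_def)

lemma upp_carrier: "x \<in> upp \<Longrightarrow> x \<in> carrier L" by (simp add: upp_def)

lemma level_upp: "x \<in> level L i \<Longrightarrow> k \<le> i \<Longrightarrow> x \<in> upp" by (auto simp: level_def upp_def)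

lemma finite_E: "finite E"
  using finite_upp finite_B upp_carrier by (simp add: E_def)

lemma independent_E: "FV.independent E"
  unfolding E_def
proof (rule FV.independent_direct_family[where pr = pr])
  show "pr x e = e" if "x \<in> upp" "e \<in> B x" for x e
    using that B(1) pr_same upp_carrier by blast
  show "pr x e = 0" if "x \<in> upp" "y \<in> upp" "x \<noteq> y" "e \<in> B y" for x y e
    using that B(1)[of y] pr_diff[of x y e] upp_carrier by blast
qed (use finite_upp finite_B upp_carrier B(2) pr_linear in auto)

lemma loc: "x \<in> upp \<Longrightarrow> e \<in> B x \<Longrightarrow> loc e = x"
  unfolding loc_def
proof (rule the_equality)
  fix y assume x: "x \<in> upp" "e \<in> B x" and y: "y \<in> upp \<and> e \<in> B y"
  show "y = x"
  proof (rule ccontr)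
    assume "y \<noteq> x"
    then have "pr x e = 0" using x y B(1)[of y] pr_diff[of x y e] upp_carrier by blast
    moreover have "pr x e = e" using x B(1)[of x] pr_same upp_carrier by blast
    moreover have "e \<noteq> 0" using x B(2)[of x] FV.dependent_zero by blast
    ultimately show False by simp
  qed
qed simp

lemma E_loc: "e \<in> E \<Longrightarrow> loc e \<in> upp \<and> e \<in> B (loc e)"
  using loc by (auto simp: E_def)

lemma E_dg: "e \<in> E \<Longrightarrow> loc e \<in> level L (k + dg e)"
  using E_loc[of e] by (auto simp: level_def dg_def upp_def)

lemma B_E: "x \<in> upp \<Longrightarrow> B x \<subseteq> E" by (auto simp: E_def)

lemma psum_span_E:
  assumes "T \<subseteq> level L i" "k \<le> i"
  shows "psum i T \<subseteq> FV.span E"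
  unfolding psum_span[OF assms(1)]
  using assms level_upp B_E by (intro FV.span_mono) blast

text \<open>The bases of the summands in \<open>T\<close> are part of \<open>E\<close>, and
  coordinates do not change when an independent set is enlarged.\<close>

lemma rep_psum:
  assumes "v \<in> psum i T" "T \<subseteq> level L i" "k \<le> i" "rep v e \<noteq> 0"
  shows "e \<in> E \<and> loc e \<in> T"
proof -
  have sub: "(\<Union>x\<in>T. B x) \<subseteq> E" using assms(2,3) level_upp B_E by blast
  have "rep v = FV.representation (\<Union>x\<in>T. B x) v"
    using assms(1) psum_span[OF assms(2)] by (intro FV.representation_extend[OF independent_E _ sub]) simp
  then have "e \<in> (\<Union>x\<in>T. B x)" using FV.representation_ne_zero assms(4) by metis
  then show ?thesis using sub loc level_upp assms(2,3) by blast
qed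

lemma D_add: "D (v + w) = D v + D w"
  by (simp add: D_def sum.distrib fun_eq_iff)

lemma D_scale: "D (sc c w) = sc c (D w)"
  by (simp add: D_def list_scale_def U.scale_sum_right)

lemma D_zero: "D 0 = 0" by (simp add: D_def fun_eq_iff)

lemma D_sum: "D (sum w T) = (\<Sum>t\<in>T. D (w t))"
proof (induction T rule: infinite_finite_induct)
  case (insert t T)
  show ?case unfolding sum.insert[OF insert.hyps(1,2)] D_add insert.IH ..
next
  case empty
  show ?case unfolding sum.empty by (rule D_zero)
next
  case (infinite T)
  show ?case unfolding sum.infinite[OF infinite] by (rule D_zero)
qed

lemma D_psum:
  assumes "v \<in> psum (Suc i) T" "T \<subseteq> level L (Suc i)" "k \<le> i"
  shows "D v = bd (Suc i) v"
proof
  fix c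
  have "v (x # c) = 0" if "x \<notin> level L (Suc i)" for x
    using assms(1,2) that by (subst (asm) psum_Suc_iff) auto
  then have "bd (Suc i) v c = D v c"
    unfolding bd_eq D_def using assms(3) finite_L
    by (intro sum.mono_neutral_left) (auto simp: level_def)
  then show "D v c = bd (Suc i) v c" by simp
qed

lemma D_psum_k:
  assumes "v \<in> psum k T" "T \<subseteq> level L k"
  shows "D v = 0"
proof
  fix c
  have fin: "finite T" using finite_subset[OF assms(2) finite_level] .
  have "v (x # c) = 0" if "x \<in> carrier L" "k < rk L x" for x
  proof (rule ccontr)
    assume nz: "v (x # c) \<noteq> 0"
    from assms(1) obtain w where w: "v = (\<Sum>y\<in>T. w y)" "\<forall>y\<in>T. w y \<in> piece' k y"
      unfolding psum_eq[OF fin] by blast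
    from nz have "(\<Sum>y\<in>T. w y (x # c)) \<noteq> 0" using w(1) by (simp add: sum_fun_apply)
    then obtain y where y: "y \<in> T" "w y (x # c) \<noteq> 0" by (rule sum_nonzero_witness)
    then have "length (x # c) = k \<and> (k > 0 \<longrightarrow> hd (x # c) = y)"
      using psum_support[of y k "w y" "x # c"] w(2) assms(2) by blast
    then have "x = y" by auto
    with y(1) assms(2) that(2) show False by (auto simp: level_def)
  qed
  then show "D v c = 0 c" by (simp add: D_def)
qed

lemma D_B:
  assumes x: "x \<in> level L (Suc i)" and i: "k \<le> i" and e: "e \<in> piece' (Suc i) x"
  shows "D e \<in> psum i {y \<in> level L i. y \<sqsubseteq>\<^bsub>L\<^esub> x}" "D (D e) = 0"
proof -
  let ?T = "{y \<in> level L i. y \<sqsubseteq>\<^bsub>L\<^esub> x}"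
  have ex: "e \<in> psum (Suc i) {x}" using piece_psum[of "{x}" "Suc i" x] x e by auto
  have "D e = (\<lambda>c. e (x # c))"
    using D_psum[OF ex _ i] diff_single[OF ex x] x by simp
  moreover have "(\<lambda>c. e (x # c)) \<in> pre i x" using ex x by (simp add: psum_Suc_iff)
  ultimately have pre: "D e \<in> pre i x" by simp
  have "D e \<in> psum i ?T \<and> D (D e) = 0"
  proof (cases i)
    case 0
    \<comment> \<open>Every piece of degree 0 is the full copy of the space at the empty list, so a
      value in the copy of \<open>A x\<close> may be placed at \<open>bot\<close>.\<close>
    then have "D e \<in> piece' 0 bot" using pre by (auto simp: pre_piece_def)
    moreover have "bot \<in> ?T" using 0 bot x by (auto simp: level_0 level_def)
    ultimately have "D e \<in> psum i ?T" using piece_psum[of ?T i bot] 0 by auto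
    then show ?thesis using D_psum_k[of "D e" ?T] 0 i by auto
  next
    case (Suc j)
    then have *: "D e \<in> psum (Suc j) ?T" "bd (Suc j) (D e) = 0"
      using pre x by (auto simp: pre_Suc zero_fun_def)
    have "D (D e) = 0"
    proof (cases "k \<le> j")
      case True
      then show ?thesis using D_psum[OF *(1)] *(2) Suc by auto
    next
      case False
      \<comment> \<open>Here \<open>D e\<close> has reached the lowest degree of the truncated
        complex, where \<open>D\<close> is zero.\<close>
      then have "k = Suc j" using i Suc by simp
      then show ?thesis using D_psum_k[of "D e" ?T] * Suc by auto
    qed
    with * Suc show ?thesis by simp
  qed
  then show "D e \<in> psum i ?T" "D (D e) = 0" by auto
qed

lemma D_E:
  assumes "e \<in> E"
  shows "D (D e) = 0" "D e \<in> FV.span E"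
    "rep (D e) e' \<noteq> 0 \<Longrightarrow> e' \<in> E \<and> dg e = Suc (dg e') \<and> loc e' \<sqsubseteq>\<^bsub>L\<^esub> loc e"
proof -
  let ?x = "loc e"
  have x: "?x \<in> upp" "e \<in> B ?x" using E_loc[OF assms] by auto
  have e: "e \<in> piece' (rk L ?x) ?x" using x B(1) by blast
  have "D (D e) = 0 \<and> D e \<in> FV.span E \<and>
    (rep (D e) e' \<noteq> 0 \<longrightarrow> e' \<in> E \<and> dg e = Suc (dg e') \<and> loc e' \<sqsubseteq>\<^bsub>L\<^esub> loc e)"
  proof (cases "rk L ?x = k")
    case True
    then have "?x \<in> level L k" using x(1) by (auto simp: level_def upp_def)
    then have "e \<in> psum k {?x}" using piece_psum[of "{?x}" k ?x] e True by auto
    then have "D e = 0" using D_psum_k[of e "{?x}"] \<open>?x \<in> level L k\<close> by simp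
    then show ?thesis by (simp add: D_zero FV.span_zero FV.representation_zero)
  next
    case False
    then obtain i where i: "rk L ?x = Suc i" "k \<le> i" using x(1) by (cases "rk L ?x") (auto simp: upp_def)
    then have lev: "?x \<in> level L (Suc i)" using x(1) by (auto simp: level_def upp_def)
    have e': "e \<in> piece' (Suc i) ?x" using e i by simp
    note D_B[OF lev i(2) e']
    moreover have "psum i {y \<in> level L i. y \<sqsubseteq>\<^bsub>L\<^esub> ?x} \<subseteq> FV.span E"
      using i(2) by (intro psum_span_E) auto
    moreover have "e' \<in> E \<and> loc e' \<in> {y \<in> level L i. y \<sqsubseteq>\<^bsub>L\<^esub> ?x}" if "rep (D e) e' \<noteq> 0"
      using rep_psum[OF D_B(1)[OF lev i(2) e'] _ i(2) that] by auto
    ultimately show ?thesis using i by (auto simp: dg_def level_def)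
  qed
  then show "D (D e) = 0" "D e \<in> FV.span E"
    "rep (D e) e' \<noteq> 0 \<Longrightarrow> e' \<in> E \<and> dg e = Suc (dg e') \<and> loc e' \<sqsubseteq>\<^bsub>L\<^esub> loc e" by auto
qed

lemma d_nonzero: "d e e' \<noteq> 0 \<Longrightarrow> e \<in> E \<and> e' \<in> E \<and> dg e' = Suc (dg e) \<and> loc e \<sqsubseteq>\<^bsub>L\<^esub> loc e'"
  using D_E(3)[of e' e] by (auto simp: d_def split: if_splits)

lemma sum_rep: "v \<in> FV.span E \<Longrightarrow> (\<Sum>e\<in>E. sc (rep v e) e) = v"
  by (rule FV.sum_representation_eq[OF independent_E _ finite_E]) auto

lemma comb_span: "(\<Sum>e\<in>E. sc (g e) e) \<in> FV.span E"
  by (intro FV.span_sum FV.span_scale FV.span_base)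

lemma rep_comb:
  assumes "\<And>e. g e \<noteq> 0 \<Longrightarrow> e \<in> E"
  shows "rep (\<Sum>e\<in>E. sc (g e) e) = g"
proof
  fix e
  have "rep (\<Sum>e\<in>E. sc (g e) e) e = (\<Sum>e'\<in>E. g e' * (if e = e' then 1 else 0))"
    by (simp add: FV.representation_sum[OF independent_E] FV.span_scale FV.span_base
        FV.representation_scale[OF independent_E] FV.representation_basis[OF independent_E])
  then show "rep (\<Sum>e\<in>E. sc (g e) e) e = g e"
    using assms[of e] by (auto simp: sum_mult_delta[OF finite_E])
qed

lemma matvec_d: "matvec E d g = rep (D (\<Sum>e\<in>E. sc (g e) e))"
proof
  fix e
  have "rep (D (\<Sum>e\<in>E. sc (g e) e)) e = (\<Sum>e'\<in>E. g e' * rep (D e') e)"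
    by (simp add: D_sum D_scale FV.representation_sum[OF independent_E] FV.span_scale D_E(2)
        FV.representation_scale[OF independent_E])
  then show "matvec E d g e = rep (D (\<Sum>e\<in>E. sc (g e) e)) e"
    by (simp add: matvec_def d_def mult.commute)
qed

lemma D_span: "v \<in> FV.span E \<Longrightarrow> D v \<in> FV.span E"
  using sum_rep[of v] by (metis (no_types, lifting) D_sum D_scale D_E(2) FV.span_sum FV.span_scale)

lemma d_d: "matmul E d d e e' = 0"
proof (cases "e' \<in> E")
  case True
  have "matmul E d d e e' = matvec E d (rep (D e')) e" using True by (simp add: matmul_column d_def)
  also have "\<dots> = rep (D (D e')) e" by (simp add: matvec_d sum_rep[OF D_E(2)[OF True]])
  finally show ?thesis by (simp add: D_E(1)[OF True] FV.representation_zero)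
qed (simp add: matmul_def d_def)

sublocale word_complex E dg d
  by unfold_locales (use finite_E d_nonzero d_d in auto)

lemma exact_coordinates:
  fixes F :: "'a set" and \<tau> :: "'a \<Rightarrow> 'a"
  assumes fam: "\<And>i v. k \<le> i \<Longrightarrow> v \<in> psum (Suc i) (level L (Suc i) \<inter> F) \<Longrightarrow> bd (Suc i) v = 0 \<Longrightarrow>
      \<exists>v' \<in> psum (Suc (Suc i)) (level L (Suc (Suc i)) \<inter> F). bd (Suc (Suc i)) v' = v"
    and g: "\<And>e. g e \<noteq> 0 \<Longrightarrow> e \<in> E \<and> loc e \<in> F \<and> dg e = Suc i"
    and cycle: "\<And>e. matvec E d g e = 0"
  shows "\<exists>g'. (\<forall>e. g' e \<noteq> 0 \<longrightarrow> e \<in> E \<and> loc e \<in> F \<and> dg e = Suc (Suc i)) \<and> matvec E d g' = g"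
proof -
  \<comment> \<open>Degree \<open>j\<close> of the truncated complex is rank \<open>k + j\<close> in
    \<open>L\<close>.\<close>
  let ?T = "level L (Suc (k + i)) \<inter> F" and ?T' = "level L (Suc (Suc (k + i))) \<inter> F"
  define v where "v = (\<Sum>e\<in>E. sc (g e) e)"
  have v: "v \<in> psum (Suc (k + i)) ?T"
    unfolding v_def
  proof (intro FV.subspace_sum psum_subspace)
    fix e assume "e \<in> E"
    show "sc (g e) e \<in> psum (Suc (k + i)) ?T"
    proof (cases "g e = 0")
      case True
      then show ?thesis using psum_subspace[of ?T "Suc (k + i)"] by (simp add: FV.subspace_0)
    next
      case False
      then have "loc e \<in> ?T" "e \<in> B (loc e)" using g[OF False] E_dg[of e] E_loc[of e] by auto
      then have "e \<in> psum (Suc (k + i)) ?T" by (subst psum_span) (auto intro: FV.span_base)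
      then show ?thesis using psum_subspace[of ?T "Suc (k + i)"] by (intro FV.subspace_scale) auto
    qed
  qed auto
  have v_span: "v \<in> FV.span E" unfolding v_def by (rule comb_span)
  have "rep (D v) = (\<lambda>_. 0)" using cycle matvec_d[of g] by (auto simp: v_def fun_eq_iff)
  then have "D v = 0" using sum_rep[OF D_span[OF v_span]] by simp
  then have "bd (Suc (k + i)) v = 0" using D_psum[OF v] by simp
  from fam[OF _ v this] obtain v' where v': "v' \<in> psum (Suc (Suc (k + i))) ?T'" "bd (Suc (Suc (k + i))) v' = v"
    by auto
  have v'_span: "v' \<in> FV.span E" using v'(1) psum_span_E[of ?T' "Suc (Suc (k + i))"] by auto
  have "D v' = v" using D_psum[OF v'(1)] v'(2) by simp
  then have "matvec E d (rep v') = g"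
    using rep_comb[of g] g by (simp add: matvec_d sum_rep[OF v'_span]) (simp add: v_def)
  moreover have "e \<in> E \<and> loc e \<in> F \<and> dg e = Suc (Suc i)" if "rep v' e \<noteq> 0" for e
  proof -
    have "e \<in> E \<and> loc e \<in> ?T'" by (rule rep_psum[OF v'(1) _ _ that]) auto
    then show ?thesis by (auto simp: dg_def level_def)
  qed
  ultimately show ?thesis by blast
qed

end

locale trunc_sym = trunc_cx L scale Basis A bot k
  for L :: "('a, 'y) ranked_poset_scheme"
    and scale :: "'k::field_char_0 \<Rightarrow> 'u::ab_group_add \<Rightarrow> 'u" and Basis :: "'u set"
    and A :: "'a \<Rightarrow> 'u set" and bot :: 'a and k :: nat
begin

definition W :: "('k, 'a list \<Rightarrow> 'u) module" where
  "W = N\<lparr>carrier := psum k (level L k)\<rparr>"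

definition "E0 = {e \<in> E. dg e = 0}"

definition "co e w = (if e \<in> E0 then rep w e else 0)"

lemma W_simps [simp]: "carrier W = psum k (level L k)" "v \<oplus>\<^bsub>W\<^esub> w = v + w" "c \<odot>\<^bsub>W\<^esub> w = sc c w"
  by (auto simp: W_def list_module_def list_scale_def space_module_def)

lemma E0_level: "e \<in> E0 \<longleftrightarrow> e \<in> E \<and> loc e \<in> level L k"
  using E_dg[of e] by (auto simp: E0_def level_def dg_def)

sublocale sym_words W sc E0 co
proof
  have sub: "FV.subspace (psum k (level L k))" by (rule psum_subspace) simp
  have span: "psum k (level L k) \<subseteq> FV.span E" by (rule psum_span_E) auto
  show "v \<oplus>\<^bsub>W\<^esub> w = v + w" "c \<odot>\<^bsub>W\<^esub> w = sc c w" "sc 0 v = 0" for v w c by simp_all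
  show "0 \<in> carrier W" using FV.subspace_0[OF sub] by simp
  show "v + w \<in> carrier W" if "v \<in> carrier W" "w \<in> carrier W" for v w
    using FV.subspace_add[OF sub] that by simp
  show "sc c v \<in> carrier W" if "v \<in> carrier W" for c v using FV.subspace_scale[OF sub] that by simp
  show "finite E0" using finite_E by (simp add: E0_def)
  show "E0 \<subseteq> carrier W"
  proof
    fix e assume "e \<in> E0"
    then have "loc e \<in> level L k" "e \<in> B (loc e)" using E0_level E_loc by auto
    then show "e \<in> carrier W" by (auto simp: psum_span intro: FV.span_base)
  qed
  show "co e (v + w) = co e v + co e w" if "v \<in> carrier W" "w \<in> carrier W" for e v w
    using that span by (auto simp: co_def FV.representation_add[OF independent_E] subset_iff)
  show "co e (sc c v) = c * co e v" if "v \<in> carrier W" for e c v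
    using that span by (auto simp: co_def FV.representation_scale[OF independent_E] subset_iff)
  show "(\<Sum>e\<in>E0. sc (co e v) e) = v" if v: "v \<in> carrier W" for v
  proof -
    have "(\<Sum>e\<in>E0. sc (co e v) e) = (\<Sum>e\<in>E. sc (rep v e) e)"
    proof (rule sum.mono_neutral_cong_left)
      show "\<forall>e\<in>E - E0. sc (rep v e) e = 0"
        using rep_psum[of v k "level L k"] v E0_level by fastforce
    qed (auto simp: finite_E E0_def co_def)
    also have "\<dots> = v" using v span by (intro sum_rep) auto
    finally show ?thesis .
  qed
  show "co e v = 0" if "e \<notin> E0" for e v using that by (simp add: co_def)
qed

end

text \<open>For a cycle \<open>v\<close> the homotopy identity reduces to v = \<partial> (h v).
  Above the rank of \<open>x\<close> there are no chains, so nothing is to be filled.\<close>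

lemma (in vec_cx) contractible_exact:
  assumes contr: "L_contractible R L (minimal_complex L (space_module scale) A)" and x: "x \<in> carrier L"
    and v: "v \<in> psum (Suc i) {y \<in> level L (Suc i). y \<sqsubseteq>\<^bsub>L\<^esub> x}" and bd_v: "bd (Suc i) v = 0"
  shows "\<exists>v' \<in> psum (Suc (Suc i)) {y \<in> level L (Suc (Suc i)). y \<sqsubseteq>\<^bsub>L\<^esub> x}. bd (Suc (Suc i)) v' = v"
proof -
  let ?C = "minimal_complex L (space_module scale) A" and ?T = "\<lambda>j. {y \<in> level L j. y \<sqsubseteq>\<^bsub>L\<^esub> x}"
  have level: "level (below L x) j = ?T j" for j by (auto simp: below_def level_def)
  have chains: "chains (below L x) ?C j = psum j (?T j)" for j
  proof -
    have "Pi (?T j) (\<lambda>x. piece' (rk L x) x) = Pi (?T j) (piece' j)" by (auto simp: level_def Pi_def)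
    then show ?thesis by (simp add: chains_def level minimal_complex_def sum_submodules_def)
  qed
  have zero: "0 \<in> psum j (?T j)" for j by (rule FV.subspace_0, rule psum_subspace) auto
  show ?thesis
  proof (cases "Suc i \<le> rk L x")
    case False
    then have "?T (Suc i) = {}" using level_below_empty[OF x, of "Suc i"] by simp
    then have "v \<in> psum (Suc i) {}" using v by (simp only:)
    then have "v = 0" using psum_eq[of "{}" "Suc i"] by simp
    then show ?thesis using zero bd_sum[of "Suc (Suc i)" _ "{}"] by (intro bexI[of _ 0]) auto
  next
    case True
    obtain h where h: "L_homotopy R (below L x) ?C h" using contr x by (auto simp: L_contractible_def)
    have "rk L y \<le> rk L x" if "y \<in> carrier L" "y \<sqsubseteq>\<^bsub>L\<^esub> x" for y
      using rk_less[OF that(1) x that(2)] by (cases "y = x") auto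
    then have "poset_rank (below L x) = rk L x"
      unfolding poset_rank_def below_def using x le_refl[OF x] finite_L
      by (intro Max_eqI) auto
    then have lin0: "h 0 \<in> linear_maps R N (bd 1 ` psum 1 (?T 1)) (psum 1 (?T 1))"
      and lin: "\<And>j. j \<in> {1..rk L x} \<Longrightarrow> h j \<in> linear_maps R N (psum j (?T j)) (psum (j + 1) (?T (j + 1)))"
      and eq: "\<And>j w. j \<in> {1..rk L x} \<Longrightarrow> w \<in> psum j (?T j) \<Longrightarrow> h (j - 1) (bd j w) + bd (j + 1) (h j w) = w"
      using h unfolding L_homotopy_def chains by (auto simp: minimal_complex_def plus_fun_def)
    \<comment> \<open>\<open>h i\<close> is additive only on its domain, so zero has to be found
      there. For \<open>i = 0\<close> the domain is the image of the first differential, and zero is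
      the boundary of the cycle \<open>v\<close> itself.\<close>
    have "h i 0 = 0"
    proof -
      have "\<exists>Y Z. h i \<in> linear_maps R N Y Z \<and> 0 \<in> Y"
      proof (cases i)
        case 0
        then have "0 \<in> bd 1 ` psum 1 (?T 1)" using v bd_v by (intro image_eqI[of _ _ v]) simp_all
        then show ?thesis using lin0 unfolding \<open>i = 0\<close> by blast
      next
        case Suc
        then have "h i \<in> linear_maps R N (psum i (?T i)) (psum (i + 1) (?T (i + 1)))" using True by (intro lin) simp
        then show ?thesis using zero[of i] by blast
      qed
      then obtain Y Z where "h i \<in> linear_maps R N Y Z" "0 \<in> Y" by blast
      then have "h i (0 \<oplus>\<^bsub>N\<^esub> 0) = h i 0 \<oplus>\<^bsub>N\<^esub> h i 0" unfolding linear_maps_def by blast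
      moreover have "f \<oplus>\<^bsub>N\<^esub> g = f + g" for f g by (simp add: plus_fun_def)
      ultimately have "h i 0 + h i 0 = h i 0 + 0" by (simp only: add_0_right)
      then show ?thesis by (rule add_left_imp_eq)
    qed
    moreover have "h (Suc i) v \<in> psum (Suc (Suc i)) (?T (Suc (Suc i)))"
      using lin[of "Suc i"] True v by (auto simp: linear_maps_def)
    ultimately show ?thesis using eq[of "Suc i" v] True v bd_v by auto
  qed
qed

section \<open>Subspaces in general position\<close>

locale generic_section = U: finite_dimensional_vector_space scale Basis
  for scale :: "'k::field_char_0 \<Rightarrow> 'u::ab_group_add \<Rightarrow> 'u" and Basis :: "'u set" +
  fixes \<H> :: "('u \<Rightarrow> 'k) set set" and P :: "'u set" and k :: nat
  assumes arr: "hyperplane_arrangement (dual_space scale UNIV) \<H>"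
    and P: "U.subspace P"
    and dim_P: "U.dim P + k = U.dim UNIV"
    and general: "general_position scale \<H> P k"
begin

abbreviation "Us \<equiv> dual_space scale UNIV"
abbreviation "Ps \<equiv> dual_space scale P"
abbreviation "proj \<equiv> dual_proj P :: ('u \<Rightarrow> 'k) \<Rightarrow> _"
abbreviation "l x \<equiv> proj ` x"

definition "CU = (SOME C. finite C \<and> Us \<subseteq> module.span fun_scale C)"
definition "CP = (SOME C. finite C \<and> Ps \<subseteq> module.span fun_scale C)"

lemma fdvs: "finite_dimensional_vector_space scale Basis" by unfold_locales

lemma CU: "finite CU" "Us \<subseteq> module.span fun_scale CU"
  using someI_ex[OF dual_space_basis(2)[OF fdvs U.subspace_UNIV]] by (auto simp: CU_def)

lemma CP: "finite CP" "Ps \<subseteq> module.span fun_scale CP"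
  using someI_ex[OF dual_space_basis(2)[OF fdvs P]] by (auto simp: CP_def)

sublocale A: hyperplane_arr Us \<H> CU
  using dual_space_subspace[OF U.vector_space_axioms, of UNIV] CU arr
  by unfold_locales auto

abbreviation L where "L \<equiv> A.\<L>"

lemma le_L: "x \<sqsubseteq>\<^bsub>L\<^esub> y \<longleftrightarrow> y \<subseteq> x" by (rule A.\<L>_simps(3))

lemma proj_linear: "Vector_Spaces.linear fun_scale fun_scale proj"
  by (auto simp: Vector_Spaces.linear_iff fun_scale_vector_space dual_proj_def fun_scale_def fun_eq_iff)

sublocale pl: Vector_Spaces.linear fun_scale fun_scale proj by (rule proj_linear)

lemma proj_Us: "f \<in> Us \<Longrightarrow> proj f \<in> Ps"
  using P by (auto simp: dual_space_def dual_proj_def U.subspace_def)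

lemma proj_inj:
  assumes "u \<in> level L k"
  shows "inj_on proj u"
proof -
  have uL: "u \<in> carrier L" using assms by (simp add: level_def)
  have "f = 0" if f: "f \<in> u" "proj f = 0" for f
  proof -
    have "f \<in> Us" using f(1) A.\<L>_subset[OF uL] by auto
    then show ?thesis
      using general assms f unfolding general_position_def A.\<L>_def by (auto simp: Let_def)
  qed
  then show ?thesis using pl.inj_on_iff_eq_0[OF A.\<L>_subspace[OF uL]] by blast
qed

lemma inj_l: "inj_on (\<lambda>x. l x) (level L (Suc k))"
  using general by (simp add: general_position_def A.\<L>_def Let_def)

lemma l_mono: "x \<subseteq> y \<Longrightarrow> l x \<subseteq> l y" by auto

lemma l_Ps: "x \<in> carrier L \<Longrightarrow> l x \<subseteq> Ps"
  using A.\<L>_subset proj_Us by blast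

lemma l_subspace: "x \<in> carrier L \<Longrightarrow> A.F.subspace (l x)"
  using pl.subspace_image A.\<L>_subspace by blast

lemma rk_Us: "rk L Us = 0" by (simp add: A.\<L>_simps)

lemma exists_above:
  assumes "y \<in> carrier L" "k \<le> rk L y"
  shows "\<exists>u\<in>level L k. y \<subseteq> u"
  using A.exists_between[OF A.Es_\<L> assms(1) A.\<L>_subset[OF assms(1)], of k] assms(2) rk_Us
  by (auto simp: level_def)

text \<open>The subspace \<open>y\<close> lies in some \<open>u\<close> of rank \<open>k\<close>, on
  which general position makes the projection injective.\<close>

lemma dim_l:
  assumes "y \<in> carrier L" "k \<le> rk L y"
  shows "A.F.dim (l y) = A.F.dim y"
proof -
  interpret VP: vector_space_pair "fun_scale :: 'k \<Rightarrow> ('u \<Rightarrow> 'k) \<Rightarrow> _" "fun_scale :: 'k \<Rightarrow> ('u \<Rightarrow> 'k) \<Rightarrow> _" ..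
  obtain u where u: "u \<in> level L k" "y \<subseteq> u" using exists_above[OF assms] by blast
  obtain B where B: "B \<subseteq> y" "A.F.independent B" "y \<subseteq> A.F.span B" "card B = A.F.dim y"
    using A.F.basis_exists by blast
  have span: "A.F.span B = y" using B A.F.span_minimal[OF B(1) A.\<L>_subspace[OF assms(1)]] by auto
  have inj: "inj_on proj y" using proj_inj[OF u(1)] u(2) inj_on_subset by blast
  have "A.F.independent (l B)" using pl.independent_injective_image[OF B(2)] inj span by simp
  moreover have "l y \<subseteq> A.F.span (l B)" using pl.span_image[of B] span by simp
  ultimately have "A.F.dim (l y) = card (l B)" using B(1) by (intro A.F.dim_unique[of "l B"]) auto
  then show ?thesis using B(4) card_image[OF inj_on_subset[OF inj B(1)]] by simp
qed

lemma dim_Us: "A.F.dim Us = A.F.dim Ps + k"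
  using dual_space_basis(1)[OF fdvs P] dual_space_basis(1)[OF fdvs U.subspace_UNIV] dim_P by simp

text \<open>The projection keeps the dimension of \<open>y\<close> while the ambient dimension drops
  by \<open>k\<close>, so the codimension drops by \<open>k\<close>. In particular rank
  \<open>k + 1\<close> yields hyperplanes.\<close>

lemma rk_l: "y \<in> carrier L \<Longrightarrow> k \<le> rk L y \<Longrightarrow> A.F.dim (l y) + (rk L y - k) = A.F.dim Ps"
  using dim_l A.dim_rk[of y] dim_Us by simp

sublocale A2: hyperplane_arr Ps "(\<lambda>x. l x) ` level L (Suc k)" CP
proof
  show "A.F.subspace Ps" using dual_space_subspace[OF U.vector_space_axioms] .
  have "A.F.dim (l x) + 1 = A.F.dim Ps" if "x \<in> level L (Suc k)" for x
    using rk_l[of x] that by (simp add: level_def)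
  then show "hyperplane_arrangement Ps ((\<lambda>x. l x) ` level L (Suc k))"
    using l_Ps l_subspace A.finite_\<L> by (auto simp: hyperplane_arrangement_def level_def)
qed (use CP in auto)

abbreviation \<Lambda> where "\<Lambda> \<equiv> A2.\<L>"

lemma le_\<Lambda>: "x \<sqsubseteq>\<^bsub>\<Lambda>\<^esub> y \<longleftrightarrow> y \<subseteq> x" by (rule A2.\<L>_simps(3))

lemma l_Int: "u \<in> level L k \<Longrightarrow> x \<subseteq> u \<Longrightarrow> y \<subseteq> u \<Longrightarrow> l (x \<inter> y) = l x \<inter> l y"
  using proj_inj by (rule inj_on_image_Int)

text \<open>From rank \<open>k + 2\<close> on, \<open>x\<close> is the intersection of two elements
  of rank one less inside a common \<open>m\<close> of rank at least \<open>k\<close>. Since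
  \<open>m\<close> lies in some \<open>u\<close> of rank \<open>k\<close>, where the projection is
  injective, \<open>l\<close> commutes with this intersection, and the induction applies to both
  factors.\<close>

lemma l_carrier:
  assumes "x \<in> carrier L" "k < rk L x"
  shows "l x \<in> carrier \<Lambda>"
  using assms
proof (induction "rk L x" arbitrary: x rule: less_induct)
  case less
  show ?case
  proof (cases "rk L x = Suc k")
    case True
    then have "l x \<in> (\<lambda>x. l x) ` level L (Suc k)" using less.prems by (auto simp: level_def)
    then show ?thesis by (rule A2.\<H>_\<L>)
  next
    case False
    \<comment> \<open>Two ranks back, which leaves room for the two hyperplanes \<open>h1\<close>
      and \<open>h2\<close> that cut \<open>m\<close> down to \<open>x\<close>.\<close>
    define j where "j = rk L x - 2"
    have j: "rk L x = Suc (Suc j)" "k \<le> j" using False less.prems(2) unfolding j_def by linarith+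
    obtain m where m: "m \<in> carrier L" "x \<subseteq> m" "rk L m = j"
      using A.exists_between[OF A.Es_\<L> less.prems(1) A.\<L>_subset[OF less.prems(1)], of j] rk_Us j by auto
    then have "x \<subset> m" using j by auto
    then obtain h1 where h1: "h1 \<in> \<H>" "x \<subseteq> m \<inter> h1" "m \<inter> h1 \<in> carrier L" "A.F.dim (m \<inter> h1) + 1 = A.F.dim m"
      using A.\<L>_step[OF m(1) less.prems(1)] by blast
    have rk1: "rk L (m \<inter> h1) = Suc j" using A.dim_rk[OF m(1)] A.dim_rk[OF h1(3)] h1(4) m(3) by simp
    then have "x \<subset> m \<inter> h1" using h1(2) j by auto
    then obtain h2 where h2: "h2 \<in> \<H>" "x \<subseteq> (m \<inter> h1) \<inter> h2" "(m \<inter> h1) \<inter> h2 \<in> carrier L"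
        "A.F.dim ((m \<inter> h1) \<inter> h2) + 1 = A.F.dim (m \<inter> h1)"
      using A.\<L>_step[OF h1(3) less.prems(1)] by blast
    have "rk L (m \<inter> h1 \<inter> h2) = Suc (Suc j)" using A.dim_rk[OF h1(3)] A.dim_rk[OF h2(3)] h2(4) rk1 by simp
    then have x_eq: "x = m \<inter> h1 \<inter> h2"
      using A.dim_rk[OF less.prems(1)] A.dim_rk[OF h2(3)] j
      by (intro A.dim_eq_\<L>[OF h2(3) A.\<L>_subspace[OF less.prems(1)] h2(2)]) simp
    have "\<not> m \<subseteq> h2"
    proof
      assume "m \<subseteq> h2"
      then have "m \<inter> h1 \<inter> h2 = m \<inter> h1" by auto
      with h2(4) show False by simp
    qed
    then have "A.F.dim (m \<inter> h2) + 1 = A.F.dim m" using A.dim_Int_\<H>[OF h2(1) m(1)] by simp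
    moreover have m2: "m \<inter> h2 \<in> carrier L" using A.\<L>_Int[OF m(1) A.\<H>_\<L>[OF h2(1)]] .
    ultimately have rk2: "rk L (m \<inter> h2) = Suc j" using A.dim_rk[OF m(1)] A.dim_rk[OF m2] m(3) by simp
    obtain u where u: "u \<in> level L k" "m \<subseteq> u" using exists_above[OF m(1)] j(2) m(3) by auto
    have "l x = l ((m \<inter> h1) \<inter> (m \<inter> h2))" unfolding x_eq by (rule arg_cong[where f = "\<lambda>x. l x"]) auto
    also have "\<dots> = l (m \<inter> h1) \<inter> l (m \<inter> h2)" using u by (intro l_Int[OF u(1)]) auto
    also have "\<dots> \<in> carrier \<Lambda>"
    proof (rule A2.\<L>_Int)
      show "l (m \<inter> h1) \<in> carrier \<Lambda>" using less.hyps[OF _ h1(3)] rk1 j by simp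
      show "l (m \<inter> h2) \<in> carrier \<Lambda>" using less.hyps[OF _ m2] rk2 j by simp
    qed
    finally show ?thesis .
  qed
qed

lemma rk_\<Lambda>_l: "x \<in> carrier L \<Longrightarrow> k < rk L x \<Longrightarrow> rk \<Lambda> (l x) = rk L x - k"
  using rk_l[of x] A2.dim_rk[OF l_carrier, of x] by linarith

lemma rk_Ps: "rk \<Lambda> Ps = 0"
  by (simp only: A2.\<L>_simps(4) diff_self_eq_0)

text \<open>An element of rank 1 is contained in at least one of the given hyperplanes and has its
  dimension.\<close>

lemma atom_\<Lambda>:
  assumes "a \<in> level \<Lambda> 1"
  shows "\<exists>x\<in>level L (Suc k). a = l x"
proof -
  have a: "a \<in> carrier \<Lambda>" "rk \<Lambda> a = 1" using assms by (auto simp: level_def)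
  have "a \<noteq> Ps" using a(2) rk_Ps by auto
  obtain S where S: "S \<subseteq> (\<lambda>x. l x) ` level L (Suc k)" "a = Ps \<inter> \<Inter>S" using a(1) unfolding A2.\<L>_simps(1) by blast
  with \<open>a \<noteq> Ps\<close> obtain h where h: "h \<in> S" by auto
  then obtain x where x: "x \<in> level L (Suc k)" "h = l x" using S by auto
  have xL: "x \<in> carrier L" "k < rk L x" using x(1) by (auto simp: level_def)
  have "A.F.dim (l x) \<le> A.F.dim a"
    using A2.dim_rk[OF l_carrier[OF xL]] A2.dim_rk[OF a(1)] a(2) rk_\<Lambda>_l[OF xL] x(1) by (simp add: level_def)
  then have "a = l x"
    using S(2) h x(2) by (intro A2.dim_eq_\<L>[OF l_carrier[OF xL] A2.\<L>_subspace[OF a(1)]]) auto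
  then show ?thesis using x(1) by blast
qed

definition family :: "('u \<Rightarrow> 'k) set \<Rightarrow> ('u \<Rightarrow> 'k) set set" where
  "family t = {x \<in> carrier L. k < rk L x \<and> t \<subseteq> l x}"

definition family_top :: "('u \<Rightarrow> 'k) set \<Rightarrow> ('u \<Rightarrow> 'k) set \<Rightarrow> ('u \<Rightarrow> 'k) set" where
  "family_top t u = \<Inter>{x \<in> family t. x \<subseteq> u}"

lemma family_Inter:
  assumes "finite S" "S \<noteq> {}" "S \<subseteq> family t" "\<And>x. x \<in> S \<Longrightarrow> x \<subseteq> u" "u \<in> level L k"
  shows "\<Inter>S \<in> family t \<and> \<Inter>S \<subseteq> u"
  using assms
proof (induction S rule: finite_ne_induct)
  case (insert x S)
  then have *: "x \<in> family t" "x \<subseteq> u" "\<Inter>S \<in> family t" "\<Inter>S \<subseteq> u" by auto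
  then have L: "x \<inter> \<Inter>S \<in> carrier L" by (intro A.\<L>_Int) (auto simp: family_def)
  have "k < rk L (x \<inter> \<Inter>S)"
    using A.rk_mono_\<L>[OF L, of x] *(1) by (auto simp: family_def)
  moreover have "t \<subseteq> l (x \<inter> \<Inter>S)" using l_Int[OF insert.prems(3) *(2,4)] *(1,3) by (auto simp: family_def)
  ultimately show ?case using L * by (auto simp: family_def)
qed auto

lemma family_top:
  assumes "x \<in> family t" "x \<subseteq> u" "u \<in> level L k"
  shows "family_top t u \<in> family t" "family_top t u \<subseteq> x"
proof -
  have "finite {x \<in> family t. x \<subseteq> u}" using A.finite_\<L> by (auto simp: family_def)
  then show "family_top t u \<in> family t"
    unfolding family_top_def using assms(1,2) by (intro conjunct1[OF family_Inter[OF _ _ _ _ assms(3)]]) blast+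
  show "family_top t u \<subseteq> x" unfolding family_top_def using assms(1,2) by blast
qed

text \<open>The top for \<open>u'\<close> is contained in \<open>x\<close>, hence in
  \<open>u\<close>, and so is among the sets intersected for \<open>u\<close>; by symmetry the two
  tops agree.\<close>

lemma family_top_eq:
  assumes "x \<in> family t" "x \<subseteq> u" "u \<in> level L k" "x \<subseteq> u'" "u' \<in> level L k"
  shows "family_top t u = family_top t u'"
proof -
  have *: "family_top t u \<subseteq> family_top t u'" if "x \<subseteq> u" "u \<in> level L k" "x \<subseteq> u'" "u' \<in> level L k" for u u'
  proof -
    have "family_top t u' \<subseteq> u" using family_top(2)[OF assms(1) that(3,4)] that(1) by (rule subset_trans)
    then show ?thesis by (rule family_top(2)[OF family_top(1)[OF assms(1) that(3,4)] _ that(2)])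
  qed
  show ?thesis using *[OF assms(2-5)] *[OF assms(4,5,2,3)] by (rule subset_antisym)
qed

sublocale V: trunc_sym L scale Basis annihilator Us k
proof
  show "U.subspace (annihilator a)" if "a \<in> level L 1" for a
  proof -
    have "a \<subseteq> Us" using that A.\<L>_subset by (auto simp: level_def)
    then have lin: "f (u + v) = f u + f v" "f (scale c u) = c * f u" if "f \<in> a" for f u v c
      using that by (auto simp: dual_space_def)
    have zero: "f 0 = 0" if "f \<in> a" for f using lin(2)[OF that, of 0 0] by simp
    have "x + y \<in> annihilator a" if "x \<in> annihilator a" "y \<in> annihilator a" for x y
      unfolding annihilator_def
    proof (intro CollectI ballI)
      show "f (x + y) = 0" if f: "f \<in> a" for f
      proof -
        have "f x = 0" "f y = 0" using f \<open>x \<in> annihilator a\<close> \<open>y \<in> annihilator a\<close> by (auto simp: annihilator_def)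
        then show ?thesis unfolding lin(1)[OF f, of x y] by simp
      qed
    qed
    moreover have "scale c x \<in> annihilator a" if "x \<in> annihilator a" for c x
      unfolding annihilator_def
    proof (intro CollectI ballI)
      show "f (scale c x) = 0" if f: "f \<in> a" for f
      proof -
        have "f x = 0" using f \<open>x \<in> annihilator a\<close> by (auto simp: annihilator_def)
        then show ?thesis unfolding lin(2)[OF f, of c x] by simp
      qed
    qed
    moreover have "0 \<in> annihilator a" unfolding annihilator_def using zero by blast
    ultimately show ?thesis by (intro U.subspaceI)
  qed
  show "Us \<in> carrier L" by (rule A.Es_\<L>)
  show "rk L Us = 0" by (rule rk_Us)
  show "Us \<sqsubseteq>\<^bsub>L\<^esub> x" if "x \<in> carrier L" for x using A.\<L>_subset[OF that] by (simp add: le_L)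
qed

text \<open>At rank \<open>k\<close> the image \<open>l x\<close> has the dimension of
  \<open>Ps\<close> and equals it; writing \<open>Ps\<close> outright puts all of degree 0 at the
  least element of \<Lambda>.\<close>

definition posn_of :: "('u \<Rightarrow> 'k) set \<Rightarrow> ('u \<Rightarrow> 'k) set" where
  "posn_of x = (if rk L x = k then Ps else l x)"

definition atom_boundary :: "('u \<Rightarrow> 'k) set \<Rightarrow> (('u \<Rightarrow> 'k) set list \<Rightarrow> 'u) set" where
  "atom_boundary a = (let x = the_inv_into (level L (Suc k)) (\<lambda>x. l x) a in V.bd (Suc k) ` V.piece' (rk L x) x)"

lemma atom_boundary:
  assumes "x \<in> level L (Suc k)"
  shows "atom_boundary (l x) = V.D ` V.piece' (Suc k) x"
proof -
  have "the_inv_into (level L (Suc k)) (\<lambda>x. l x) (l x) = x" using the_inv_into_f_f[OF inj_l assms] .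
  moreover have "V.bd (Suc k) w = V.D w" if "w \<in> V.piece' (Suc k) x" for w
  proof -
    have "w \<in> V.psum (Suc k) {x}" using V.piece_psum[of "{x}" "Suc k" x] assms that by auto
    then show ?thesis using V.D_psum[of w k "{x}"] assms by simp
  qed
  moreover have "rk L x = Suc k" using assms by (simp add: level_def)
  ultimately show ?thesis unfolding atom_boundary_def Let_def by (metis (no_types, lifting) image_cong)
qed

lemma exact_Sym_minimal_complex:
  assumes contr: "L_contractible Rg L (minimal_complex L (space_module scale) annihilator)"
  shows "exact_complex \<Lambda> (minimal_complex \<Lambda> (regular_module (Sym V.W)) (\<lambda>a. Sym_ideal V.W (atom_boundary a)))"
proof -
  have E_upp: "V.loc e \<in> carrier L" "k \<le> rk L (V.loc e)" "V.dg e = rk L (V.loc e) - k" if "e \<in> V.E" for e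
    using V.E_loc[OF that] by (auto simp: V.upp_def V.dg_def)
  have posn_carrier: "posn_of x \<in> carrier \<Lambda>" "rk \<Lambda> (posn_of x) = rk L x - k" if "x \<in> carrier L" "k \<le> rk L x" for x
    using that l_carrier[of x] rk_\<Lambda>_l[of x] A2.Es_\<L> rk_Ps by (auto simp: posn_of_def)
  interpret K: sym_koszul \<Lambda> V.E V.dg V.d V.W V.sc V.E0 V.co "\<lambda>e. posn_of (V.loc e)" "(\<inter>)"
    Ps "\<Inter>(carrier \<Lambda>)" atom_boundary
  proof unfold_locales
    show "V.E0 = {e \<in> V.E. V.dg e = 0}" by (rule V.E0_def)
    show "Ps \<in> carrier \<Lambda>" by (rule A2.Es_\<L>)
    show "rk \<Lambda> Ps = 0" by (rule rk_Ps)
    show "Ps \<sqsubseteq>\<^bsub>\<Lambda>\<^esub> x" if "x \<in> carrier \<Lambda>" for x using A2.\<L>_subset[OF that] by (simp add: le_\<Lambda>)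
    show "\<Inter>(carrier \<Lambda>) \<in> carrier \<Lambda>" using A2.Es_\<L> A2.finite_\<L> by (intro A2.\<L>_Inter) auto
    show "x \<sqsubseteq>\<^bsub>\<Lambda>\<^esub> \<Inter>(carrier \<Lambda>)" if "x \<in> carrier \<Lambda>" for x using that by (auto simp: le_\<Lambda>)
    show "x \<inter> y \<in> carrier \<Lambda>" if "x \<in> carrier \<Lambda>" "y \<in> carrier \<Lambda>" for x y using that by (rule A2.\<L>_Int)
    show "x \<inter> y \<sqsubseteq>\<^bsub>\<Lambda>\<^esub> z \<longleftrightarrow> x \<sqsubseteq>\<^bsub>\<Lambda>\<^esub> z \<and> y \<sqsubseteq>\<^bsub>\<Lambda>\<^esub> z" for x y z by (auto simp: le_\<Lambda>)
    show "rk \<Lambda> (x \<inter> y) \<le> rk \<Lambda> x + rk \<Lambda> y" if "x \<in> carrier \<Lambda>" "y \<in> carrier \<Lambda>" for x y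
      using that by (rule A2.rk_Int)
    show "posn_of (V.loc e) \<in> carrier \<Lambda>" if "e \<in> V.E" for e using posn_carrier E_upp[OF that] by blast
    show "rk \<Lambda> (posn_of (V.loc e)) \<le> V.dg e" if "e \<in> V.E" for e using posn_carrier E_upp[OF that] by simp
    show "0 < rk \<Lambda> (posn_of (V.loc e))" if "e \<in> V.E" "0 < V.dg e" for e
      using posn_carrier E_upp[OF that(1)] that(2) by simp
    show "posn_of (V.loc e) \<sqsubseteq>\<^bsub>\<Lambda>\<^esub> posn_of (V.loc e')" if "V.d e e' \<noteq> 0" for e e'
    proof -
      from V.d_nonzero[OF that] have e: "e \<in> V.E" "e' \<in> V.E" "V.dg e' = Suc (V.dg e)" "V.loc e' \<subseteq> V.loc e"
        by (auto simp: le_L)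
      then have "posn_of (V.loc e') = l (V.loc e')" using E_upp(3)[OF e(2)] by (auto simp: posn_of_def)
      then show ?thesis
        using l_Ps[OF E_upp(1)[OF e(2)]] e(4) by (auto simp: le_\<Lambda> posn_of_def)
    qed
    show "\<exists>g'. (\<forall>e. g' e \<noteq> 0 \<longrightarrow> e \<in> V.E \<and> posn_of (V.loc e) \<sqsubseteq>\<^bsub>\<Lambda>\<^esub> t \<and> V.dg e = Suc (Suc i)) \<and> matvec V.E V.d g' = g"
      if t: "t \<in> carrier \<Lambda>" and g: "\<And>e. g e \<noteq> 0 \<Longrightarrow> e \<in> V.E \<and> posn_of (V.loc e) \<sqsubseteq>\<^bsub>\<Lambda>\<^esub> t \<and> V.dg e = Suc i"
        and cyc: "\<And>e. matvec V.E V.d g e = 0" for t g i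
    proof -
      define F where "F = {x. posn_of x \<sqsubseteq>\<^bsub>\<Lambda>\<^esub> t}"
      \<comment> \<open>Any \<open>u\<close> of rank \<open>k\<close> containing \<open>x\<close>
        gives the same top, so the choice is free. Two elements lying in one common \<open>u\<close>
        therefore get the same value, as \<open>V.exact_family\<close> demands.\<close>
      define \<tau> where "\<tau> x = family_top t (SOME u. u \<in> level L k \<and> x \<subseteq> u)" for x
      have F: "x \<in> family t" if "x \<in> carrier L" "k < rk L x" "x \<in> F" for x
        using that by (auto simp: F_def family_def posn_of_def le_\<Lambda>)
      have \<tau>: "\<tau> x = family_top t u" if "x \<in> family t" "u \<in> level L k" "x \<subseteq> u" for x u
      proof -
        have "(SOME u. u \<in> level L k \<and> x \<subseteq> u) \<in> level L k \<and> x \<subseteq> (SOME u. u \<in> level L k \<and> x \<subseteq> u)"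
          using that by (intro someI[of "\<lambda>u. u \<in> level L k \<and> x \<subseteq> u" u]) auto
        then show ?thesis unfolding \<tau>_def using that family_top_eq by blast
      qed
      have \<tau>_family: "\<tau> x \<in> family t \<and> \<tau> x \<subseteq> x" if x: "x \<in> family t" for x
      proof -
        obtain u where "u \<in> level L k" "x \<subseteq> u" using exists_above[of x] x by (auto simp: family_def)
        then show ?thesis using \<tau>[OF x] family_top[OF x] by auto
      qed
      have fam: "\<exists>v' \<in> V.psum (Suc (Suc j)) (level L (Suc (Suc j)) \<inter> F). V.bd (Suc (Suc j)) v' = v"
        if "k \<le> j" "v \<in> V.psum (Suc j) (level L (Suc j) \<inter> F)" "V.bd (Suc j) v = 0" for j v
      proof (rule V.exact_family[where k = k and \<tau> = \<tau>])
        show "\<exists>v' \<in> V.psum (Suc (Suc i)) {y \<in> level L (Suc (Suc i)). y \<sqsubseteq>\<^bsub>L\<^esub> x}. V.bd (Suc (Suc i)) v' = v"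
          if "x \<in> carrier L" "v \<in> V.psum (Suc i) {y \<in> level L (Suc i). y \<sqsubseteq>\<^bsub>L\<^esub> x}" "V.bd (Suc i) v = 0" for x v i
          using V.contractible_exact[OF contr that] .
        show "\<exists>u\<in>level L k. u \<sqsubseteq>\<^bsub>L\<^esub> y" if "y \<in> level L j" "k \<le> j" for y j
          using exists_above[of y] that by (auto simp: level_def le_L)
        show "\<tau> x \<in> carrier L \<and> x \<sqsubseteq>\<^bsub>L\<^esub> \<tau> x" if "x \<in> carrier L" "k < rk L x" "x \<in> F" for x
          using \<tau>_family[OF F[OF that]] by (auto simp: le_L family_def)
        show "y \<in> F" if "x \<in> carrier L" "k < rk L x" "x \<in> F" "y \<in> carrier L" "k < rk L y" "y \<sqsubseteq>\<^bsub>L\<^esub> \<tau> x" for x y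
        proof -
          have "t \<subseteq> l (\<tau> x)" using \<tau>_family[OF F[OF that(1-3)]] by (simp add: family_def)
          also have "\<dots> \<subseteq> l y" using that(6) by (intro l_mono) (simp add: le_L)
          finally show ?thesis using that(5) by (simp add: F_def posn_of_def le_\<Lambda>)
        qed
        show "\<tau> x = \<tau> y" if "x \<in> carrier L" "k < rk L x" "x \<in> F" "y \<in> carrier L" "k < rk L y" "y \<in> F"
          "u \<in> level L k" "u \<sqsubseteq>\<^bsub>L\<^esub> x" "u \<sqsubseteq>\<^bsub>L\<^esub> y" for x y u
          using \<tau>[OF F[OF that(1-3)] that(7)] \<tau>[OF F[OF that(4-6)] that(7)] that(8,9) by (simp add: le_L)
      qed (use that in auto)
      have "\<exists>g'. (\<forall>e. g' e \<noteq> 0 \<longrightarrow> e \<in> V.E \<and> V.loc e \<in> F \<and> V.dg e = Suc (Suc i)) \<and> matvec V.E V.d g' = g"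
        by (rule V.exact_coordinates[OF fam _ cyc]) (use g in \<open>auto simp: F_def\<close>)
      then show ?thesis by (auto simp: F_def)
    qed
    show "atom_boundary a \<subseteq> carrier V.W" if a: "a \<in> level \<Lambda> 1" for a
    proof -
      obtain x where x: "x \<in> level L (Suc k)" "a = l x" using atom_\<Lambda>[OF a] by blast
      have "V.D w \<in> V.psum k (level L k)" if "w \<in> V.piece' (Suc k) x" for w
        using V.D_B(1)[of x k w] V.psum_mono_set[of "{y \<in> level L k. y \<sqsubseteq>\<^bsub>L\<^esub> x}" "level L k" k] x(1) that by auto
      then show ?thesis using atom_boundary[OF x(1)] x(2) by auto
    qed
    show "(\<Sum>e'\<in>V.E0. V.sc (V.d e' e) e') \<in> atom_boundary a"
      if a: "a \<in> level \<Lambda> 1" and e: "e \<in> V.E" "V.dg e = 1" "posn_of (V.loc e) \<sqsubseteq>\<^bsub>\<Lambda>\<^esub> a" for a e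
    proof -
      obtain x where x: "x \<in> level L (Suc k)" "a = l x" using atom_\<Lambda>[OF a] by blast
      have le: "V.loc e \<in> level L (Suc k)" using V.E_dg[OF e(1)] e(2) by simp
      then have leL: "V.loc e \<in> carrier L" "k < rk L (V.loc e)" by (auto simp: level_def)
      have xL: "x \<in> carrier L" "k < rk L x" using x(1) by (auto simp: level_def)
      \<comment> \<open>Both images are hyperplanes of the dual of \<open>P\<close>, so the
        inclusion is an equality, and the distinctness clause of general position identifies
        \<open>V.loc e\<close> with \<open>x\<close>.\<close>
      have "l x \<subseteq> l (V.loc e)" using e(3) x(2) leL by (simp add: le_\<Lambda> posn_of_def)
      moreover have "A.F.dim (l (V.loc e)) \<le> A.F.dim (l x)"
        using A2.dim_rk[OF l_carrier[OF xL]] A2.dim_rk[OF l_carrier[OF leL]] rk_\<Lambda>_l[OF xL] rk_\<Lambda>_l[OF leL] x(1) le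
        by (simp add: level_def)
      ultimately have "l x = l (V.loc e)"
        by (intro A2.dim_eq_\<L>[OF l_carrier[OF leL] l_subspace[OF xL(1)]])
      then have x_eq: "x = V.loc e" using inj_onD[OF inj_l _ x(1) le] by simp
      have "(\<Sum>e'\<in>V.E0. V.sc (V.d e' e) e') = (\<Sum>e'\<in>V.E. V.sc (V.rep (V.D e) e') e')"
      \<comment> \<open>The boundary of a basis element of degree 1 has coordinates in degree 0
        only.\<close>
      proof (rule sum.mono_neutral_cong_left)
        show "\<forall>e'\<in>V.E - V.E0. V.sc (V.rep (V.D e) e') e' = 0"
          using V.D_E(3)[OF e(1)] e(2) by (fastforce simp: V.E0_def)
      qed (use e(1) V.finite_E in \<open>auto simp: V.E0_def V.d_def\<close>)
      also have "\<dots> = V.D e" using V.D_E(2)[OF e(1)] by (rule V.sum_rep)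
      also have "\<dots> \<in> atom_boundary a"
      proof -
        have "rk L (V.loc e) = Suc k" using le by (simp add: level_def)
        then have "e \<in> V.piece' (Suc k) x" using V.E_loc[OF e(1)] V.B(1)[of x] x_eq by auto
        then show ?thesis using atom_boundary[OF x(1)] x(2) by blast
      qed
      finally show ?thesis .
    qed
    show "\<exists>c. (\<forall>e. c e \<noteq> 0 \<longrightarrow> e \<in> V.E \<and> posn_of (V.loc e) \<sqsubseteq>\<^bsub>\<Lambda>\<^esub> a) \<and> (\<forall>e\<in>V.E0. V.co e u = matvec V.E V.d c e)"
      if a: "a \<in> level \<Lambda> 1" and u: "u \<in> atom_boundary a" for a u
    proof -
      obtain x where x: "x \<in> level L (Suc k)" "a = l x" using atom_\<Lambda>[OF a] by blast
      \<comment> \<open>The coordinates of such a preimage serve as \<open>c\<close>: they are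
        supported on the basis of the single piece at \<open>x\<close>, whose position is
        \<open>a\<close>.\<close>
      obtain w where w: "w \<in> V.piece' (Suc k) x" "u = V.D w" using u atom_boundary[OF x(1)] x(2) by auto
      have wx: "w \<in> V.psum (Suc k) {x}" using V.piece_psum[of "{x}" "Suc k" x] x(1) w(1) by auto
      have "w \<in> V.FV.span V.E" using wx V.psum_span_E[of "{x}" "Suc k"] x(1) by auto
      then have "V.co e u = matvec V.E V.d (V.rep w) e" if "e \<in> V.E0" for e
        using that w(2) by (simp add: V.co_def V.matvec_d V.sum_rep)
      moreover have "e \<in> V.E \<and> posn_of (V.loc e) \<sqsubseteq>\<^bsub>\<Lambda>\<^esub> a" if "V.rep w e \<noteq> 0" for e
      proof -
        have "e \<in> V.E \<and> V.loc e \<in> {x}" using x(1) by (intro V.rep_psum[OF wx _ _ that]) auto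
        moreover have "posn_of x = l x" using x(1) by (simp add: posn_of_def level_def)
        ultimately show ?thesis using x(2) by (auto simp: le_\<Lambda>)
      qed
      ultimately show ?thesis by (intro exI[of _ "V.rep w"]) blast
    qed
  qed
  show ?thesis by (rule K.exact_minimal_complex_Sym)
qed

end

theorem corollary5p7:
  fixes scale :: "'k::field_char_0 \<Rightarrow> 'u::ab_group_add \<Rightarrow> 'u"
    and Basis :: "'u set"
    and \<H> :: "('u \<Rightarrow> 'k) set set"
    and P :: "'u set"
    and k :: nat
  assumes "finite_dimensional_vector_space scale Basis"
    and "hyperplane_arrangement (dual_space scale UNIV) \<H>"
    and L: "L = intersection_lattice (dual_space scale UNIV) \<H>"
    and V: "V = relation_complex scale \<H>"
    and "module.subspace scale P"
    and "vector_space.dim scale P + k = vector_space.dim scale UNIV"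
    and "k \<le> poset_rank L"
    and "general_position scale \<H> P k"
    and l: "l = (\<lambda>x. dual_proj P ` x)"
    and \<Lambda>: "\<Lambda> = intersection_lattice (dual_space scale P) (l ` level L (k + 1))"
    and "L_contractible (ring_of_type_algebra :: 'k ring) L V"
  shows "exact_complex \<Lambda>
    (minimal_complex \<Lambda>
      (regular_module (Sym (chain_module L V k)))
      (\<lambda>a. Sym_ideal (chain_module L V k)
             (diff V (k + 1) ` piece V (the_inv_into (level L (k + 1)) l a))))"
proof -
  interpret finite_dimensional_vector_space scale Basis by (fact assms(1))
  interpret G: generic_section scale Basis \<H> P k
    by unfold_locales (use assms in auto)
  have L_eq: "L = G.A.\<L>" by (simp add: L G.A.\<L>_def)
  have V_eq: "V = minimal_complex L (space_module scale) annihilator"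
    by (simp add: V relation_complex_def L)
  have \<Lambda>_eq: "\<Lambda> = G.A2.\<L>" by (simp add: \<Lambda> G.A2.\<L>_def l L_eq)
  have "Pi (level L k) (\<lambda>x. G.V.piece' (rk L x) x) = Pi (level L k) (G.V.piece' k)"
    by (auto simp: level_def Pi_def)
  then have W: "chain_module L V k = G.V.W"
    by (simp add: chain_module_def G.V.W_def V_eq minimal_complex_def chains_def sum_submodules_def L_eq)
  have boundary: "G.atom_boundary a = diff V (k + 1) ` piece V (the_inv_into (level L (k + 1)) l a)" for a
    by (simp add: G.atom_boundary_def Let_def V_eq minimal_complex_def L_eq l)
  have "L_contractible (ring_of_type_algebra :: 'k ring) G.A.\<L> (minimal_complex G.A.\<L> (space_module scale) annihilator)"
    using assms(11) unfolding V_eq L_eq .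
  then show ?thesis
    using G.exact_Sym_minimal_complex[of ring_of_type_algebra] unfolding W \<Lambda>_eq boundary by blast
qed

end
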